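(* Let $p$ be a prime, $Q=\mathrm{Spf}\,\mathbb Z_p[[q-1]]$, and let $H_Q$, with its $\mathbb Z_p^\times$-action, be as in the context; identify $H_Q$ with $\mathrm{Spf}\,\mathbb Z_p[[q-1,z]]$ by means of the coordinate $z$ described in the context. Then the action of $n\in\mathbb Z_p^\times$ on $H_Q$ is given by $$(q,z)\mapsto\Bigl(q^n,\frac{h_n(z,q)}{h_n(1,q)}\Bigr),$$ where $$h_n(z,q)=\frac{(1+(q-1)z)^n-1}{q-1}=\sum_{i=1}^\infty\frac{n(n-1)\cdots(n-i+1)}{i!}z^i(q-1)^{i-1}$$ (so $h_n(1,q)=\frac{q^n-1}{q-1}$).
   Context: Fix a prime $p$. $W$ is the ring scheme of $p$-typical Witt vectors; $[a]$ is the Teichmüller representative; $\Phi_p$ is the $p$-th cyclotomic polynomial. $Q:=\mathrm{Spf}\,\mathbb Z_p[[q-1]]$ with the $(p,q-1)$-adic topology. $\mathbb Z_p^\times$ acts on $Q$: $n\in\mathbb Z_p^\times$ acts by $q\mapsto q^n=\sum_{i\ge0}\frac{n(n-1)\cdots(n-i+1)}{i!}(q-1)^i$. $G_Q$ is the following flat affine commutative group scheme over $Q$: for any ring $A$ in which $p$ is nilpotent, $$G_Q(A)=\{(q,x)\mid q\in A^\times,\ q-1\text{ nilpotent},\ x\in W(A),\ 1+\Phi_p([q])x\in[A^\times]\},$$ with operation (over fixed $q$) $(x_1,x_2)\mapsto x_1+x_2+\Phi_p([q])x_1x_2$. $H_Q$ is the $1$-dimensional commutative formal group over $Q$ whose Cartier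 dual $\underline{\mathrm{Hom}}(H_Q,\mathbb G_m)$ is $G_Q$ (it exists). The section $\sigma:Q\to G_Q$, $\sigma(q)=(q,[q]-1)$, gives by Cartier duality a homomorphism $\sigma^*:H_Q\to(\hat{\mathbb G}_m)_Q$. There is a unique coordinate $z$ on $H_Q$, i.e. an identification $H_Q=\mathrm{Spf}\,\mathbb Z_p[[q-1,z]]$ over $Q$, such that $\sigma^*$ is given by $(q,z)\mapsto(q,1+(q-1)z)$; in this coordinate the group law is $z_1*z_2=z_1+z_2+(q-1)z_1z_2$. $\mathbb Z_p^\times$-action on $H_Q$: The morphism $\pi:Q\to\Sigma=W_{\mathrm{prim}}/W^\times$ defined by $\Phi_p([q])$ factors through $Q/\mathbb Z_p^\times$, and $G_Q$, $H_Q$ are pullbacks via $\pi$ of groups over $\Sigma$, so they are $\mathbb Z_p^\times$-equivariant. (Here $W_{\mathrm{prim}}$ is the formal completion of $W$ along the locus $p=x_0=0$, $x_1\neq0$, and $u\in W^\times$ acts on it by $\xi\mapsto u^{-1}\xi$.) Explicitly, for $n\in\mathbb Z_p^\times$ there is a unique $u_n\in W(\mathbb Z_p[[q-1]])^\times$ with $\Phi_p([q^n])=u_n\Phi_p([q])$; $n$ acts on $G_Q$ by $(q,x)\mapsto(q^n,u_n^{-1}x)$, and $H_Q$ carries the corresponding dual action (so that the duality pairing between $G_Q$ and $H_Q$ is $\mathbb Z_p^\times$-invariant), lifting the action on $Q$. *)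

theory Defs
  imports
    "HOL-Algebra.Ring"
    "HOL-Library.Poly_Mapping"
    "HOL-Computational_Algebra.Primes"
begin

section \<open>Formal power series over a ring\<close>

definition ps :: "('a, 'm) ring_scheme \<Rightarrow> (nat \<Rightarrow> 'a) ring" where
  "ps R = \<lparr>carrier = {f. \<forall>i. f i \<in> carrier R},
           monoid.mult = (\<lambda>f g k. \<Oplus>\<^bsub>R\<^esub>i\<in>{..k}. f i \<otimes>\<^bsub>R\<^esub> g (k - i)),
           one = (\<lambda>k. if k = 0 then \<one>\<^bsub>R\<^esub> else \<zero>\<^bsub>R\<^esub>),
           zero = (\<lambda>k. \<zero>\<^bsub>R\<^esub>),
           add = (\<lambda>f g k. f k \<oplus>\<^bsub>R\<^esub> g k)\<rparr>"

definition ps_const :: "('a, 'm) ring_scheme \<Rightarrow> 'a \<Rightarrow> nat \<Rightarrow> 'a" where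
  "ps_const R c = (\<lambda>k. if k = 0 then c else \<zero>\<^bsub>R\<^esub>)"

definition ps_monom :: "('a, 'm) ring_scheme \<Rightarrow> 'a \<Rightarrow> nat \<Rightarrow> nat \<Rightarrow> 'a" where
  "ps_monom R c n = (\<lambda>k. if k = n then c else \<zero>\<^bsub>R\<^esub>)"

abbreviation ps_var :: "('a, 'm) ring_scheme \<Rightarrow> nat \<Rightarrow> 'a" where
  "ps_var R \<equiv> ps_monom R \<one>\<^bsub>R\<^esub> 1"

definition ps_smult :: "('a, 'm) ring_scheme \<Rightarrow> 'a \<Rightarrow> (nat \<Rightarrow> 'a) \<Rightarrow> nat \<Rightarrow> 'a" where
  "ps_smult R c f = (\<lambda>k. c \<otimes>\<^bsub>R\<^esub> f k)"

text \<open>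
  Substitution \<open>f(g(z))\<close>; meaningful when \<open>g\<close> has constant term zero, so that \<open>g ^ i\<close> does not
  contribute to the coefficient of \<open>z ^ k\<close> for \<open>i > k\<close>.
\<close>
definition ps_comp :: "('a, 'm) ring_scheme \<Rightarrow> (nat \<Rightarrow> 'a) \<Rightarrow> (nat \<Rightarrow> 'a) \<Rightarrow> nat \<Rightarrow> 'a" where
  "ps_comp R f g = (\<lambda>k. \<Oplus>\<^bsub>R\<^esub>i\<in>{..k}. f i \<otimes>\<^bsub>R\<^esub> (g [^]\<^bsub>ps R\<^esub> i) k)"

text \<open>
  Series in two variables are elements of \<open>ps (ps R)\<close>, those in three variables are elements of
  \<open>ps (ps (ps R))\<close>; \<open>F i j\<close> is the coefficient of \<open>x ^ i * y ^ j\<close>.  The next two operations are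
  \<open>g(F(x,y))\<close> and \<open>F(a,b)\<close> for \<open>a\<close>, \<open>b\<close> in three variables, where \<open>F\<close>, \<open>a\<close>, \<open>b\<close> have constant
  term zero.
\<close>
definition ps_comp_1_2 ::
    "('a, 'm) ring_scheme \<Rightarrow> (nat \<Rightarrow> 'a) \<Rightarrow> (nat \<Rightarrow> nat \<Rightarrow> 'a) \<Rightarrow> nat \<Rightarrow> nat \<Rightarrow> 'a" where
  "ps_comp_1_2 R g F = (\<lambda>k l. \<Oplus>\<^bsub>R\<^esub>i\<in>{..k + l}. g i \<otimes>\<^bsub>R\<^esub> (F [^]\<^bsub>ps (ps R)\<^esub> i) k l)"

definition ps_comp_2_3 ::
    "('a, 'm) ring_scheme \<Rightarrow> (nat \<Rightarrow> nat \<Rightarrow> 'a) \<Rightarrow> (nat \<Rightarrow> nat \<Rightarrow> nat \<Rightarrow> 'a) \<Rightarrow>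
      (nat \<Rightarrow> nat \<Rightarrow> nat \<Rightarrow> 'a) \<Rightarrow> nat \<Rightarrow> nat \<Rightarrow> nat \<Rightarrow> 'a" where
  "ps_comp_2_3 R F a b = (\<lambda>k l m. \<Oplus>\<^bsub>R\<^esub>i\<in>{..k + l + m}. \<Oplus>\<^bsub>R\<^esub>j\<in>{..k + l + m}.
     F i j \<otimes>\<^bsub>R\<^esub>
       ((a [^]\<^bsub>ps (ps (ps R))\<^esub> i) \<otimes>\<^bsub>ps (ps (ps R))\<^esub> (b [^]\<^bsub>ps (ps (ps R))\<^esub> j)) k l m)"

text \<open>One-dimensional commutative formal group laws; the last clause is \<open>F(F(x,y),z) = F(x,F(y,z))\<close>.\<close>
definition formal_group_law :: "('a, 'm) ring_scheme \<Rightarrow> (nat \<Rightarrow> nat \<Rightarrow> 'a) \<Rightarrow> bool" where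
  "formal_group_law R F \<longleftrightarrow>
     F \<in> carrier (ps (ps R)) \<and>
     (\<forall>i. F i 0 = ps_var R i) \<and> (\<forall>j. F 0 j = ps_var R j) \<and>
     (\<forall>i j. F i j = F j i) \<and>
     ps_comp_2_3 R F (\<lambda>k l m. if m = 0 then F k l else \<zero>\<^bsub>R\<^esub>)
                     (\<lambda>k l m. if k = 0 \<and> l = 0 \<and> m = 1 then \<one>\<^bsub>R\<^esub> else \<zero>\<^bsub>R\<^esub>) =
     ps_comp_2_3 R F (\<lambda>k l m. if k = 1 \<and> l = 0 \<and> m = 0 then \<one>\<^bsub>R\<^esub> else \<zero>\<^bsub>R\<^esub>)
                     (\<lambda>k l m. if k = 0 then F l m else \<zero>\<^bsub>R\<^esub>)"

text \<open>
  Homomorphisms over \<open>R\<close> from the formal group with group law \<open>F\<close> to the multiplicative group: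
  series \<open>g\<close> with \<open>g(0) = 1\<close> and \<open>g(F(x,y)) = g(x) g(y)\<close>.
\<close>
definition formal_characters ::
    "('a, 'm) ring_scheme \<Rightarrow> (nat \<Rightarrow> nat \<Rightarrow> 'a) \<Rightarrow> (nat \<Rightarrow> 'a) set" where
  "formal_characters R F =
     {g \<in> carrier (ps R). g 0 = \<one>\<^bsub>R\<^esub> \<and> ps_comp_1_2 R g F = (\<lambda>k l. g k \<otimes>\<^bsub>R\<^esub> g l)}"


section \<open>Witt vectors\<close>

type_synonym 'v zpoly = "('v \<Rightarrow>\<^sub>0 nat) \<Rightarrow>\<^sub>0 int"

definition zvar :: "'v \<Rightarrow> 'v zpoly" where
  "zvar v = Poly_Mapping.single (Poly_Mapping.single v 1) 1"

definition zpoly_eval :: "('a, 'm) ring_scheme \<Rightarrow> ('v \<Rightarrow> 'a) \<Rightarrow> 'v zpoly \<Rightarrow> 'a" where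
  "zpoly_eval R x P = (\<Oplus>\<^bsub>R\<^esub>m\<in>Poly_Mapping.keys P. [Poly_Mapping.lookup P m] \<cdot>\<^bsub>R\<^esub>
     (\<Otimes>\<^bsub>R\<^esub>v\<in>Poly_Mapping.keys m. x v [^]\<^bsub>R\<^esub> Poly_Mapping.lookup m v))"

definition witt_ghost :: "nat \<Rightarrow> nat \<Rightarrow> (nat \<Rightarrow> 'r::comm_ring_1) \<Rightarrow> 'r" where
  "witt_ghost p n x = (\<Sum>i\<le>n. of_nat (p ^ i) * x i ^ (p ^ (n - i)))"

text \<open>
  The universal Witt polynomials, in the variables \<open>Inl i\<close> (components of the first argument) and
  \<open>Inr i\<close> (components of the second one).
\<close>
definition witt_sum :: "nat \<Rightarrow> nat \<Rightarrow> (nat + nat) zpoly" where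
  "witt_sum p = (THE S. \<forall>n. witt_ghost p n S =
     witt_ghost p n (\<lambda>i. zvar (Inl i)) + witt_ghost p n (\<lambda>i. zvar (Inr i)))"

definition witt_prod :: "nat \<Rightarrow> nat \<Rightarrow> (nat + nat) zpoly" where
  "witt_prod p = (THE S. \<forall>n. witt_ghost p n S =
     witt_ghost p n (\<lambda>i. zvar (Inl i)) * witt_ghost p n (\<lambda>i. zvar (Inr i)))"

definition teich :: "('a, 'm) ring_scheme \<Rightarrow> 'a \<Rightarrow> nat \<Rightarrow> 'a" where
  "teich R a = (\<lambda>i. if i = 0 then a else \<zero>\<^bsub>R\<^esub>)"

definition Witt :: "nat \<Rightarrow> ('a, 'm) ring_scheme \<Rightarrow> (nat \<Rightarrow> 'a) ring" where
  "Witt p R = \<lparr>carrier = {x. \<forall>i. x i \<in> carrier R},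
               monoid.mult = (\<lambda>x y n. zpoly_eval R (case_sum x y) (witt_prod p n)),
               one = teich R \<one>\<^bsub>R\<^esub>,
               zero = (\<lambda>i. \<zero>\<^bsub>R\<^esub>),
               add = (\<lambda>x y n. zpoly_eval R (case_sum x y) (witt_sum p n))\<rparr>"

text \<open>The value at \<open>x\<close> of the cyclotomic polynomial \<open>1 + X + \<dots> + X ^ (p - 1)\<close>, \<open>p\<close> prime.\<close>
definition cyclo :: "nat \<Rightarrow> ('a, 'm) ring_scheme \<Rightarrow> 'a \<Rightarrow> 'a" where
  "cyclo p R x = (\<Oplus>\<^bsub>R\<^esub>i\<in>{..<p}. x [^]\<^bsub>R\<^esub> i)"

abbreviation cyclo_teich :: "nat \<Rightarrow> ('a, 'm) ring_scheme \<Rightarrow> 'a \<Rightarrow> nat \<Rightarrow> 'a" where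
  "cyclo_teich p R q \<equiv> cyclo p (Witt p R) (teich R q)"


section \<open>The base\<close>

text \<open>The \<open>p\<close>-adic integers, as compatible systems of residues modulo the powers of \<open>p\<close>.\<close>
definition Zp :: "nat \<Rightarrow> (nat \<Rightarrow> int) ring" where
  "Zp p = \<lparr>carrier = {a. \<forall>k. a k \<in> {0..<int p ^ k} \<and> a (Suc k) mod int p ^ k = a k},
           monoid.mult = (\<lambda>a b k. (a k * b k) mod int p ^ k),
           one = (\<lambda>k. 1 mod int p ^ k),
           zero = (\<lambda>k. 0),
           add = (\<lambda>a b k. (a k + b k) mod int p ^ k)\<rparr>"

text \<open>The binomial coefficient \<open>n (n - 1) \<dots> (n - i + 1) / i!\<close> for a \<open>p\<close>-adic integer \<open>n\<close>.\<close>
definition zp_binom :: "nat \<Rightarrow> (nat \<Rightarrow> int) \<Rightarrow> nat \<Rightarrow> nat \<Rightarrow> int" where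
  "zp_binom p n i = (THE c. c \<in> carrier (Zp p) \<and>
     [(fact i :: nat)] \<cdot>\<^bsub>Zp p\<^esub> c = (\<Otimes>\<^bsub>Zp p\<^esub>j\<in>{..<i}. n \<ominus>\<^bsub>Zp p\<^esub> [j] \<cdot>\<^bsub>Zp p\<^esub> \<one>\<^bsub>Zp p\<^esub>))"

text \<open>The ring \<open>\<int>\<^sub>p[[q - 1]]\<close> of functions on the base; its variable is \<open>q - 1\<close>.\<close>
abbreviation OQ :: "nat \<Rightarrow> (nat \<Rightarrow> nat \<Rightarrow> int) ring" where
  "OQ p \<equiv> ps (Zp p)"

abbreviation q_minus_1 :: "nat \<Rightarrow> nat \<Rightarrow> nat \<Rightarrow> int" where
  "q_minus_1 p \<equiv> ps_var (Zp p)"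

definition q_univ :: "nat \<Rightarrow> nat \<Rightarrow> nat \<Rightarrow> int" where
  "q_univ p = \<one>\<^bsub>OQ p\<^esub> \<oplus>\<^bsub>OQ p\<^esub> q_minus_1 p"

text \<open>\<open>q ^ n\<close> for a \<open>p\<close>-adic integer \<open>n\<close>, i.e. the binomial series in \<open>q - 1\<close>.\<close>
definition q_pow :: "nat \<Rightarrow> (nat \<Rightarrow> int) \<Rightarrow> nat \<Rightarrow> nat \<Rightarrow> int" where
  "q_pow p n = (\<lambda>i. zp_binom p n i)"

definition p_nilpotent_ring :: "nat \<Rightarrow> ('a, 'm) ring_scheme \<Rightarrow> bool" where
  "p_nilpotent_ring p A \<longleftrightarrow> cring A \<and> (\<exists>N. [(p ^ N)] \<cdot>\<^bsub>A\<^esub> \<one>\<^bsub>A\<^esub> = \<zero>\<^bsub>A\<^esub>)"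

definition Q_points :: "('a, 'm) ring_scheme \<Rightarrow> 'a set" where
  "Q_points A = {q \<in> Units A. \<exists>M::nat. (q \<ominus>\<^bsub>A\<^esub> \<one>\<^bsub>A\<^esub>) [^]\<^bsub>A\<^esub> M = \<zero>\<^bsub>A\<^esub>}"

text \<open>
  For \<open>p\<close> nilpotent in \<open>A\<close> and \<open>q \<in> Q_points A\<close>: the homomorphism from \<open>\<int>\<^sub>p\<close> to \<open>A\<close> and the
  continuous homomorphism from \<open>\<int>\<^sub>p[[q - 1]]\<close> to \<open>A\<close> corresponding to the point \<open>q\<close>.
\<close>
definition zp_to :: "nat \<Rightarrow> ('a, 'm) ring_scheme \<Rightarrow> (nat \<Rightarrow> int) \<Rightarrow> 'a" where
  "zp_to p A a = [a (LEAST N. [(p ^ N)] \<cdot>\<^bsub>A\<^esub> \<one>\<^bsub>A\<^esub> = \<zero>\<^bsub>A\<^esub>)] \<cdot>\<^bsub>A\<^esub> \<one>\<^bsub>A\<^esub>"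

definition ev :: "nat \<Rightarrow> ('a, 'm) ring_scheme \<Rightarrow> 'a \<Rightarrow> (nat \<Rightarrow> nat \<Rightarrow> int) \<Rightarrow> 'a" where
  "ev p A q f = (\<Oplus>\<^bsub>A\<^esub>i\<in>{..<(LEAST M::nat. (q \<ominus>\<^bsub>A\<^esub> \<one>\<^bsub>A\<^esub>) [^]\<^bsub>A\<^esub> M = \<zero>\<^bsub>A\<^esub>)}.
     zp_to p A (f i) \<otimes>\<^bsub>A\<^esub> (q \<ominus>\<^bsub>A\<^esub> \<one>\<^bsub>A\<^esub>) [^]\<^bsub>A\<^esub> i)"


section \<open>The group scheme and its Cartier dual\<close>

text \<open>The fibre over \<open>q \<in> Q_points A\<close> of the \<open>A\<close>-points, and its group operation.\<close>
definition G_points :: "nat \<Rightarrow> ('a, 'm) ring_scheme \<Rightarrow> 'a \<Rightarrow> (nat \<Rightarrow> 'a) set" where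
  "G_points p A q = {x \<in> carrier (Witt p A). \<exists>t \<in> Units A.
     \<one>\<^bsub>Witt p A\<^esub> \<oplus>\<^bsub>Witt p A\<^esub> cyclo_teich p A q \<otimes>\<^bsub>Witt p A\<^esub> x = teich A t}"

definition G_op ::
    "nat \<Rightarrow> ('a, 'm) ring_scheme \<Rightarrow> 'a \<Rightarrow> (nat \<Rightarrow> 'a) \<Rightarrow> (nat \<Rightarrow> 'a) \<Rightarrow> nat \<Rightarrow> 'a" where
  "G_op p A q x y = x \<oplus>\<^bsub>Witt p A\<^esub> y
     \<oplus>\<^bsub>Witt p A\<^esub> cyclo_teich p A q \<otimes>\<^bsub>Witt p A\<^esub> x \<otimes>\<^bsub>Witt p A\<^esub> y"

definition G_section :: "nat \<Rightarrow> ('a, 'm) ring_scheme \<Rightarrow> 'a \<Rightarrow> nat \<Rightarrow> 'a" where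
  "G_section p A q = teich A q \<ominus>\<^bsub>Witt p A\<^esub> \<one>\<^bsub>Witt p A\<^esub>"

text \<open>
  A one-dimensional formal group \<open>H\<close> over the base with a coordinate \<open>z\<close> is a formal group law \<open>F\<close>
  over \<open>OQ p\<close>.  That its Cartier dual is the group scheme \<open>G\<close> means that there is an isomorphism
  \<open>e\<close>, natural in the ring \<open>A\<close> and over the base, from \<open>G\<close> to the functor of characters of \<open>H\<close>; so
  \<open>e A q x\<close>, a series in \<open>z\<close> over \<open>A\<close>, is the duality pairing of \<open>(q, x)\<close> with \<open>(q, z)\<close>.
  The rings \<open>A\<close> range over all those with elements in the type \<open>'a\<close>, which acts as a universe.
\<close>
definition cartier_duality ::
    "nat \<Rightarrow> (nat \<Rightarrow> nat \<Rightarrow> nat \<Rightarrow> nat \<Rightarrow> int) \<Rightarrow>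
      ('a ring \<Rightarrow> 'a \<Rightarrow> (nat \<Rightarrow> 'a) \<Rightarrow> nat \<Rightarrow> 'a) \<Rightarrow> bool" where
  "cartier_duality p F e \<longleftrightarrow>
     (\<forall>A q. p_nilpotent_ring p A \<and> q \<in> Q_points A \<longrightarrow>
        bij_betw (e A q) (G_points p A q) (formal_characters A (\<lambda>i j. ev p A q (F i j))) \<and>
        (\<forall>x \<in> G_points p A q. \<forall>y \<in> G_points p A q.
           e A q (G_op p A q x y) = e A q x \<otimes>\<^bsub>ps A\<^esub> e A q y)) \<and>
     (\<forall>A B \<phi> q. p_nilpotent_ring p A \<and> p_nilpotent_ring p B \<and> \<phi> \<in> ring_hom A B \<and>
        q \<in> Q_points A \<longrightarrow>
        (\<forall>x \<in> G_points p A q. e B (\<phi> q) (\<phi> \<circ> x) = \<phi> \<circ> e A q x))"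

text \<open>
  The coordinate \<open>z\<close> is the one in which the homomorphism from \<open>H\<close> to the multiplicative group
  dual to the section \<open>q \<mapsto> (q, [q] - 1)\<close> is \<open>(q, z) \<mapsto> (q, 1 + (q - 1) z)\<close>.
\<close>
definition normalized_coordinate ::
    "nat \<Rightarrow> ('a ring \<Rightarrow> 'a \<Rightarrow> (nat \<Rightarrow> 'a) \<Rightarrow> nat \<Rightarrow> 'a) \<Rightarrow> bool" where
  "normalized_coordinate p e \<longleftrightarrow>
     (\<forall>A q. p_nilpotent_ring p A \<and> q \<in> Q_points A \<longrightarrow>
        e A q (G_section p A q) =
          \<one>\<^bsub>ps A\<^esub> \<oplus>\<^bsub>ps A\<^esub> ps_smult A (q \<ominus>\<^bsub>A\<^esub> \<one>\<^bsub>A\<^esub>) (ps_var A))"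


section \<open>The action of the group of \<open>p\<close>-adic units\<close>

definition cyclo_unit ::
    "nat \<Rightarrow> (nat \<Rightarrow> int) \<Rightarrow> (nat \<Rightarrow> nat \<Rightarrow> nat \<Rightarrow> int) \<Rightarrow> bool" where
  "cyclo_unit p n u \<longleftrightarrow> u \<in> Units (Witt p (OQ p)) \<and>
     cyclo_teich p (OQ p) (q_pow p n) =
       u \<otimes>\<^bsub>Witt p (OQ p)\<^esub> cyclo_teich p (OQ p) (q_univ p)"

text \<open>The \<open>x\<close>-component of the action \<open>(q, x) \<mapsto> (q ^ n, u\<^sup>-\<^sup>1 x)\<close> on the group scheme.\<close>
definition G_act ::
    "nat \<Rightarrow> (nat \<Rightarrow> nat \<Rightarrow> nat \<Rightarrow> int) \<Rightarrow> ('a, 'm) ring_scheme \<Rightarrow> 'a \<Rightarrow> (nat \<Rightarrow> 'a) \<Rightarrow> nat \<Rightarrow> 'a"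
  where
  "G_act p u A q x = (\<lambda>i. ev p A q ((inv\<^bsub>Witt p (OQ p)\<^esub> u) i)) \<otimes>\<^bsub>Witt p A\<^esub> x"

text \<open>
  An endomorphism of the pointed formal scheme \<open>H\<close> lifting \<open>q \<mapsto> q ^ n\<close> has the form
  \<open>(q, z) \<mapsto> (q ^ n, \<psi>(q, z))\<close> with a series \<open>\<psi>\<close> in \<open>z\<close> over \<open>OQ p\<close> without constant term.
  It is the dual action if the pairing takes the same value on \<open>(q, x)\<close>, \<open>(q, z)\<close> as on their
  images; compatibility of \<open>\<psi>\<close> with the group structures is a consequence.
\<close>
definition dual_action ::
    "nat \<Rightarrow> ('a ring \<Rightarrow> 'a \<Rightarrow> (nat \<Rightarrow> 'a) \<Rightarrow> nat \<Rightarrow> 'a) \<Rightarrow> (nat \<Rightarrow> int) \<Rightarrow>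
      (nat \<Rightarrow> nat \<Rightarrow> nat \<Rightarrow> int) \<Rightarrow> (nat \<Rightarrow> nat \<Rightarrow> nat \<Rightarrow> int) \<Rightarrow> bool" where
  "dual_action p e n u \<psi> \<longleftrightarrow>
     \<psi> \<in> carrier (ps (OQ p)) \<and> \<psi> 0 = \<zero>\<^bsub>OQ p\<^esub> \<and>
     (\<forall>A q. p_nilpotent_ring p A \<and> q \<in> Q_points A \<longrightarrow>
        (\<forall>x \<in> G_points p A q.
           ps_comp A (e A (ev p A q (q_pow p n)) (G_act p u A q x)) (\<lambda>i. ev p A q (\<psi> i)) =
           e A q x))"

text \<open>\<open>(1 + w) ^ n\<close> for a series \<open>w\<close> in \<open>z\<close> over \<open>OQ p\<close> without constant term.\<close>
definition one_plus_pow ::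
    "nat \<Rightarrow> (nat \<Rightarrow> int) \<Rightarrow> (nat \<Rightarrow> nat \<Rightarrow> nat \<Rightarrow> int) \<Rightarrow> nat \<Rightarrow> nat \<Rightarrow> nat \<Rightarrow> int" where
  "one_plus_pow p n w = ps_comp (OQ p) (\<lambda>i. ps_const (Zp p) (zp_binom p n i)) w"

text \<open>The series \<open>h\<^sub>n(z, q)\<close>, as a series in \<open>z\<close> over \<open>OQ p\<close>.\<close>
definition h_series :: "nat \<Rightarrow> (nat \<Rightarrow> int) \<Rightarrow> nat \<Rightarrow> nat \<Rightarrow> nat \<Rightarrow> int" where
  "h_series p n =
     (\<lambda>i. if i = 0 then \<zero>\<^bsub>OQ p\<^esub> else ps_monom (Zp p) (zp_binom p n i) (i - 1))"

text \<open>
  The value at \<open>z = 1\<close> of a series in \<open>z\<close> over \<open>OQ p\<close> in which the coefficient of each power of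
  \<open>q - 1\<close> is a polynomial in \<open>z\<close>.
\<close>
definition value_at_1 :: "nat \<Rightarrow> (nat \<Rightarrow> nat \<Rightarrow> nat \<Rightarrow> int) \<Rightarrow> nat \<Rightarrow> nat \<Rightarrow> int" where
  "value_at_1 p f = (\<lambda>j. \<Oplus>\<^bsub>Zp p\<^esub>i\<in>{i. f i j \<noteq> \<zero>\<^bsub>Zp p\<^esub>}. f i j)"

end

theory Submission
  imports Defs Complex_Main "HOL-Algebra.Weak_Morphisms" "HOL-Number_Theory.Cong"
begin

text \<open>
  Evaluate the invariance of the pairing at a point \<open>x\<close> over \<open>q\<close> that the action of \<open>n\<close> carries
  to \<open>[q ^ n] - 1\<close>.  The normalisation of the coordinate makes one side \<open>1 + (q ^ n - 1) \<psi>(z)\<close>.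
  Since \<open>1 + \<Phi>\<^sub>p([q]) x = [q] ^ (p n)\<close>, the point \<open>x\<close> is the \<open>n\<close>-th power of \<open>[q] - 1\<close> in the
  group, so the other side is \<open>(1 + (q - 1) z) ^ n\<close>.  Dividing by \<open>q - 1\<close> gives the formula.

  To make sense of \<open>p\<close>-adic powers, the argument is carried out over the finite rings
  \<open>\<int>\<^sub>p[[q - 1]] / (p ^ N, (q - 1) ^ M)\<close>, with \<open>n\<close> replaced by a natural number \<open>m\<close> close to it.  As
  \<open>\<Phi>\<^sub>p([q])\<close> is a zero divisor there, the identification of \<open>x\<close> with the \<open>m\<close>-th power takes place
  over \<open>\<int>\<^sub>p[[q - 1]]\<close>, up to an error that is estimated through the ghost components.
\<close>

section \<open>Power series rings\<close>

text \<open>One test point per quotient is enough because the pairing with the section is linear in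
  z: composing it with \<psi> returns \<psi> up to the factor q^n - 1, which is q - 1 times a series
  with constant term n, hence q - 1 times a unit. The test point is u ([q^n] - 1). Multiplying it by
  Phi_p([q]) gives Phi_p([q^n]) ([q^n] - 1) = [q^n]^p - 1, the source of the exponent p n. Precision
  is the main obstacle. A binomial coefficient of n loses the power of p in i!. Cancelling
  Phi_p([q]), whose ghost components are p modulo q - 1, loses one power of p per coefficient, so M
  in all. Recovering the k-th Witt component from ghost components loses k, which is offset because
  p^k-th powers of congruent elements gain k. A second obstacle is that ghost components do not
  determine a Witt vector over a ring with p-torsion. Ring axioms for Witt vectors are therefore
  proved over Z_p[[q - 1]] and pushed to its quotients along the surjection.\<close>

lemma (in ring) minus_eq_zero_iff:
  assumes "a \<in> carrier R" "b \<in> carrier R"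
  shows "a \<ominus> b = \<zero> \<longleftrightarrow> a = b"
proof
  have "a = (a \<ominus> b) \<oplus> b" using assms by algebra
  then show "a = b" if "a \<ominus> b = \<zero>" using that assms by simp
qed (use assms in \<open>simp add: a_minus_def r_neg\<close>)

lemma ps_carrier: "f \<in> carrier (ps R) \<longleftrightarrow> (\<forall>i. f i \<in> carrier R)"
  by (simp add: ps_def)

lemma ps_coeff_closed: "f \<in> carrier (ps R) \<Longrightarrow> f i \<in> carrier R"
  by (simp add: ps_def)

lemma ps_add: "(f \<oplus>\<^bsub>ps R\<^esub> g) k = f k \<oplus>\<^bsub>R\<^esub> g k"
  by (simp add: ps_def)

lemma ps_zero: "\<zero>\<^bsub>ps R\<^esub> k = \<zero>\<^bsub>R\<^esub>"
  by (simp add: ps_def)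

lemma ps_one: "\<one>\<^bsub>ps R\<^esub> k = (if k = 0 then \<one>\<^bsub>R\<^esub> else \<zero>\<^bsub>R\<^esub>)"
  by (simp add: ps_def)

lemma ps_mult: "(f \<otimes>\<^bsub>ps R\<^esub> g) k = (\<Oplus>\<^bsub>R\<^esub>i\<in>{..k}. f i \<otimes>\<^bsub>R\<^esub> g (k - i))"
  by (simp add: ps_def)

context cring
begin

lemma finsum_single:
  assumes "finite A" and "j \<in> A" and "f j \<in> carrier R"
    and "\<And>i. i \<in> A \<Longrightarrow> i \<noteq> j \<Longrightarrow> f i = \<zero>"
  shows "(\<Oplus>i\<in>A. f i) = f j"
proof -
  have closed: "f i \<in> carrier R" if "i \<in> A" for i
    using assms(3) assms(4)[OF that] by (cases "i = j") simp_all
  have "(\<Oplus>i\<in>A. f i) = (\<Oplus>i\<in>A. if j = i then f i else \<zero>)"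
  proof (rule finsum_cong'[OF refl])
    show "(\<lambda>i. if j = i then f i else \<zero>) \<in> A \<rightarrow> carrier R"
      by (simp add: Pi_def closed)
    show "f i = (if j = i then f i else \<zero>)" if "i \<in> A" for i
      using assms(4)[OF that] by (cases "j = i") simp_all
  qed
  also have "\<dots> = f j"
    using finsum_singleton[of j A f] assms(1,2) closed by (simp add: Pi_def)
  finally show ?thesis .
qed

lemma ps_mult_assoc:
  assumes R: "p \<in> carrier (ps R)" "q \<in> carrier (ps R)" "r \<in> carrier (ps R)"
  shows "(p \<otimes>\<^bsub>ps R\<^esub> q) \<otimes>\<^bsub>ps R\<^esub> r = p \<otimes>\<^bsub>ps R\<^esub> (q \<otimes>\<^bsub>ps R\<^esub> r)"
proof
  fix n
  {
    fix k and a b c :: "nat \<Rightarrow> 'a"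
    assume R: "a \<in> UNIV \<rightarrow> carrier R" "b \<in> UNIV \<rightarrow> carrier R"
      "c \<in> UNIV \<rightarrow> carrier R"
    \<comment> \<open>The outer limit k is separated from the degree n, since an induction on n
      itself would change every index n - j. The case k = n is associativity.\<close>
    then have "k \<le> n \<Longrightarrow>
      (\<Oplus>j \<in> {..k}. (\<Oplus>i \<in> {..j}. a i \<otimes> b (j-i)) \<otimes> c (n-j)) =
      (\<Oplus>j \<in> {..k}. a j \<otimes> (\<Oplus>i \<in> {..k-j}. b i \<otimes> c (n-j-i)))"
      (is "_ \<Longrightarrow> ?eq k")
    proof (induct k)
      case 0 then show ?case by (simp add: Pi_def m_assoc)
    next
      case (Suc k)
      then have "k \<le> n" by arith
      from this R have "?eq k" by (rule Suc)
      with R show ?case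
        by (simp cong: finsum_cong
             add: Suc_diff_le Pi_def l_distr r_distr m_assoc)
           (simp cong: finsum_cong add: Pi_def a_ac finsum_ldistr m_assoc)
    qed
  }
  with R show "((p \<otimes>\<^bsub>ps R\<^esub> q) \<otimes>\<^bsub>ps R\<^esub> r) n = (p \<otimes>\<^bsub>ps R\<^esub> (q \<otimes>\<^bsub>ps R\<^esub> r)) n"
    by (simp add: Pi_def ps_mult ps_carrier)
qed

lemma ps_mult_comm:
  assumes "p \<in> carrier (ps R)" "q \<in> carrier (ps R)"
  shows "p \<otimes>\<^bsub>ps R\<^esub> q = q \<otimes>\<^bsub>ps R\<^esub> p"
proof
  fix n :: nat
  have "(\<lambda>i. n - i) ` {..n} = {..n}"
    by (auto simp: image_iff Bex_def) (metis diff_diff_cancel diff_le_self)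
  then have "(\<Oplus>i\<in>{..n}. p i \<otimes> q (n - i)) = (\<Oplus>i\<in>(\<lambda>i. n - i) ` {..n}. p i \<otimes> q (n - i))"
    by (simp only:)
  also have "\<dots> = (\<Oplus>i\<in>{..n}. p (n - i) \<otimes> q (n - (n - i)))"
    by (rule finsum_reindex) (use assms in \<open>auto simp: inj_on_def ps_carrier\<close>)
  also have "\<dots> = (\<Oplus>i\<in>{..n}. q i \<otimes> p (n - i))"
    by (rule finsum_cong') (use assms in \<open>auto simp: m_comm ps_carrier\<close>)
  finally show "(p \<otimes>\<^bsub>ps R\<^esub> q) n = (q \<otimes>\<^bsub>ps R\<^esub> p) n"
    by (simp add: ps_mult)
qed

lemma ps_const_mult:
  assumes "a \<in> carrier R" "f \<in> carrier (ps R)"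
  shows "ps_const R a \<otimes>\<^bsub>ps R\<^esub> f = ps_smult R a f"
proof
  fix n
  have "(\<Oplus>i\<in>{..n}. ps_const R a i \<otimes> f (n - i)) = ps_const R a 0 \<otimes> f (n - 0)"
    by (rule finsum_single) (use assms in \<open>auto simp: ps_const_def ps_carrier\<close>)
  then show "(ps_const R a \<otimes>\<^bsub>ps R\<^esub> f) n = ps_smult R a f n"
    by (simp add: ps_mult ps_const_def ps_smult_def)
qed

lemma ps_cring: "cring (ps R)"
proof (rule cringI)
  show "abelian_group (ps R)"
  proof (rule abelian_groupI)
    fix f assume "f \<in> carrier (ps R)"
    then show "\<exists>y\<in>carrier (ps R). y \<oplus>\<^bsub>ps R\<^esub> f = \<zero>\<^bsub>ps R\<^esub>"
      by (intro bexI[of _ "\<lambda>i. \<ominus> f i"]) (auto simp: ps_carrier fun_eq_iff ps_add ps_zero l_neg)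
  qed (auto simp: ps_carrier fun_eq_iff ps_add ps_zero a_ac)
  show "comm_monoid (ps R)"
  proof (rule comm_monoidI)
    fix f assume "f \<in> carrier (ps R)"
    then have "ps_const R \<one> \<otimes>\<^bsub>ps R\<^esub> f = f"
      by (simp add: ps_const_mult ps_smult_def fun_eq_iff ps_carrier)
    moreover have "ps_const R \<one> = \<one>\<^bsub>ps R\<^esub>"
      by (simp add: ps_const_def fun_eq_iff ps_one)
    ultimately show "\<one>\<^bsub>ps R\<^esub> \<otimes>\<^bsub>ps R\<^esub> f = f" by simp
  next
    show "f \<otimes>\<^bsub>ps R\<^esub> g \<in> carrier (ps R)" if "f \<in> carrier (ps R)" "g \<in> carrier (ps R)" for f g
      using that by (auto simp: ps_carrier ps_mult intro!: finsum_closed)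
    show "\<one>\<^bsub>ps R\<^esub> \<in> carrier (ps R)"
      by (simp add: ps_carrier ps_one)
  qed (rule ps_mult_assoc ps_mult_comm; assumption)+
qed (auto simp: fun_eq_iff ps_mult ps_add ps_carrier l_distr Pi_def)

lemma ps_a_inv:
  assumes "f \<in> carrier (ps R)"
  shows "(\<ominus>\<^bsub>ps R\<^esub> f) k = \<ominus> f k"
proof -
  interpret P: cring "ps R" by (rule ps_cring)
  have "\<ominus>\<^bsub>ps R\<^esub> f = (\<lambda>i. \<ominus> f i)"
    by (rule P.minus_equality) (use assms in \<open>auto simp: ps_carrier fun_eq_iff ps_add ps_zero l_neg\<close>)
  then show ?thesis by simp
qed

lemma ps_minus:
  assumes "f \<in> carrier (ps R)" "g \<in> carrier (ps R)"
  shows "(f \<ominus>\<^bsub>ps R\<^esub> g) k = f k \<ominus> g k"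
  using assms by (simp add: a_minus_def ps_add ps_a_inv)

lemma ps_monom_closed [simp]: "c \<in> carrier R \<Longrightarrow> ps_monom R c n \<in> carrier (ps R)"
  by (simp add: ps_carrier ps_monom_def)

lemma ps_const_closed [simp]: "c \<in> carrier R \<Longrightarrow> ps_const R c \<in> carrier (ps R)"
  by (simp add: ps_carrier ps_const_def)

lemma ps_monom_mult:
  assumes "c \<in> carrier R" "f \<in> carrier (ps R)"
  shows "(ps_monom R c m \<otimes>\<^bsub>ps R\<^esub> f) k = (if k < m then \<zero> else c \<otimes> f (k - m))"
proof (cases "k < m")
  case True
  then have "(\<Oplus>i\<in>{..k}. ps_monom R c m i \<otimes> f (k - i)) = (\<Oplus>i\<in>{..k}. \<zero>)"
    by (intro finsum_cong') (use assms in \<open>auto simp: ps_monom_def ps_carrier\<close>)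
  then show ?thesis using True by (simp add: ps_mult)
next
  case False
  then have "(\<Oplus>i\<in>{..k}. ps_monom R c m i \<otimes> f (k - i)) = ps_monom R c m m \<otimes> f (k - m)"
    by (intro finsum_single) (use assms in \<open>auto simp: ps_monom_def ps_carrier\<close>)
  then show ?thesis using False by (simp add: ps_mult ps_monom_def)
qed

lemma ps_monom_power:
  assumes "c \<in> carrier R"
  shows "ps_monom R c 1 [^]\<^bsub>ps R\<^esub> n = ps_monom R (c [^] n) n"
proof (induction n)
  case 0
  show ?case by (simp add: ps_monom_def fun_eq_iff ps_one)
next
  case (Suc n)
  have "ps_monom R (c [^] n) n \<otimes>\<^bsub>ps R\<^esub> ps_monom R c 1 = ps_monom R (c [^] Suc n) (Suc n)"
    using assms by (auto simp: fun_eq_iff ps_monom_mult) (auto simp: ps_monom_def)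
  then show ?case using Suc by simp
qed

lemma ps_coeff_add_pow:
  assumes "f \<in> carrier (ps R)"
  shows "([(n::nat)] \<cdot>\<^bsub>ps R\<^esub> f) k = [n] \<cdot> f k"
proof -
  interpret P: cring "ps R" by (rule ps_cring)
  show ?thesis
    using assms by (induction n) (simp_all add: ps_zero ps_add)
qed

lemma ps_coeff0_hom: "(\<lambda>f. f 0) \<in> ring_hom (ps R) R"
  by (rule ring_hom_memI) (simp_all add: ps_mult ps_add ps_one ps_carrier)

text \<open>
  The recursion is on initial segments, because a coefficient of the inverse refers to all earlier
  ones.  Only the entries of index at most \<open>n\<close> are meaningful.
\<close>
primrec ps_inv_upto :: "(nat \<Rightarrow> 'a) \<Rightarrow> nat \<Rightarrow> nat \<Rightarrow> 'a" where
  "ps_inv_upto f 0 = (\<lambda>i. inv (f 0))"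
| "ps_inv_upto f (Suc n) = (\<lambda>i. if i \<le> n then ps_inv_upto f n i
      else \<ominus> (inv (f 0) \<otimes> (\<Oplus>i\<in>{..n}. ps_inv_upto f n i \<otimes> f (Suc n - i))))"

lemma ps_UnitsI:
  assumes f: "f \<in> carrier (ps R)" and u: "f 0 \<in> Units R"
  shows "f \<in> Units (ps R)"
proof -
  interpret P: cring "ps R" by (rule ps_cring)
  define g where "g n = ps_inv_upto f n n" for n
  have closed: "ps_inv_upto f n i \<in> carrier R" for n i
    using f u by (induction n arbitrary: i) (auto simp: ps_carrier intro!: finsum_closed)
  have stable: "i \<le> n \<Longrightarrow> ps_inv_upto f n i = g i" for n i
    by (induction n) (auto simp: g_def le_Suc_eq)
  have g: "g \<in> carrier (ps R)"
    by (simp add: ps_carrier g_def closed)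
  have "g \<otimes>\<^bsub>ps R\<^esub> f = \<one>\<^bsub>ps R\<^esub>"
  proof
    fix k
    show "(g \<otimes>\<^bsub>ps R\<^esub> f) k = \<one>\<^bsub>ps R\<^esub> k"
    proof (cases k)
      case 0
      then show ?thesis using f u by (simp add: ps_mult ps_one g_def ps_carrier)
    next
      case (Suc n)
      define s where "s = (\<Oplus>i\<in>{..n}. g i \<otimes> f (Suc n - i))"
      have s: "s \<in> carrier R" using f g by (auto simp: s_def ps_carrier intro!: finsum_closed)
      have "(\<Oplus>i\<in>{..n}. ps_inv_upto f n i \<otimes> f (Suc n - i)) = s"
        unfolding s_def by (rule finsum_cong') (use f g stable in \<open>auto simp: ps_carrier\<close>)
      then have "g (Suc n) = \<ominus> (inv (f 0) \<otimes> s)"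
        by (simp add: g_def)
      moreover have "(g \<otimes>\<^bsub>ps R\<^esub> f) (Suc n) = g (Suc n) \<otimes> f 0 \<oplus> s"
        using f g by (simp add: ps_mult s_def Pi_def ps_carrier)
      moreover have "\<ominus> (inv (f 0) \<otimes> s) \<otimes> f 0 = \<ominus> (inv (f 0) \<otimes> f 0 \<otimes> s)"
      proof -
        have "f 0 \<in> carrier R" "inv (f 0) \<in> carrier R" using u by auto
        then show ?thesis using s by algebra
      qed
      ultimately show ?thesis
        using s u Suc by (simp add: ps_one l_neg)
    qed
  qed
  then show ?thesis
    using f g P.m_comm[OF g f] unfolding Units_def by (auto intro!: bexI[of _ g])
qed

end

section \<open>The ring of \<open>p\<close>-adic integers\<close>

lemma Zp_carrierD:
  assumes "a \<in> carrier (Zp p)"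
  shows "0 \<le> a k" "a k < int p ^ k" "a (Suc k) mod int p ^ k = a k"
  using assms by (auto simp: Zp_def)

lemma Zp_ops:
  "(a \<oplus>\<^bsub>Zp p\<^esub> b) k = (a k + b k) mod int p ^ k"
  "(a \<otimes>\<^bsub>Zp p\<^esub> b) k = (a k * b k) mod int p ^ k"
  "\<zero>\<^bsub>Zp p\<^esub> k = 0"
  "\<one>\<^bsub>Zp p\<^esub> k = 1 mod int p ^ k"
  by (simp_all add: Zp_def)

lemma Zp_mod:
  assumes "a \<in> carrier (Zp p)" "k \<le> l"
  shows "a l mod int p ^ k = a k"
  using assms(2)
proof (induction l rule: dec_induct)
  case base
  show ?case using Zp_carrierD[OF assms(1), of k] by simp
next
  case (step l)
  have "a (Suc l) mod int p ^ k = a (Suc l) mod int p ^ l mod int p ^ k"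
    using step by (simp add: mod_mod_cancel le_imp_power_dvd)
  then show ?case using step Zp_carrierD(3)[OF assms(1), of l] by simp
qed

lemma Zp_carrierI:
  assumes "p > 0" "\<And>k. [b (Suc k) = b k] (mod int p ^ k)"
  shows "(\<lambda>k. b k mod int p ^ k) \<in> carrier (Zp p)"
proof -
  have "b (Suc k) mod (int p * int p ^ k) mod int p ^ k = b k mod int p ^ k" for k
    using assms(2)[of k] by (simp add: cong_def mod_mod_cancel)
  then show ?thesis using assms(1) by (simp add: Zp_def)
qed

lemma Zp_eqI:
  assumes "a \<in> carrier (Zp p)" "b \<in> carrier (Zp p)" "\<And>k. [a k = b k] (mod int p ^ k)"
  shows "a = b"
proof
  fix k show "a k = b k"
    using assms(3)[of k] Zp_carrierD[OF assms(1), of k] Zp_carrierD[OF assms(2), of k]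
    by (simp add: cong_def)
qed

lemma Zp_cong_Suc: "a \<in> carrier (Zp p) \<Longrightarrow> [a (Suc k) = a k] (mod int p ^ k)"
  using Zp_carrierD[of a p k] by (simp add: cong_def)

lemma Zp_add_closed:
  assumes "p > 0" "a \<in> carrier (Zp p)" "b \<in> carrier (Zp p)"
  shows "a \<oplus>\<^bsub>Zp p\<^esub> b \<in> carrier (Zp p)" "a \<otimes>\<^bsub>Zp p\<^esub> b \<in> carrier (Zp p)"
proof -
  have "(\<lambda>k. (a k + b k) mod int p ^ k) \<in> carrier (Zp p)"
    "(\<lambda>k. (a k * b k) mod int p ^ k) \<in> carrier (Zp p)"
    by (intro Zp_carrierI[OF assms(1)] cong_add cong_mult Zp_cong_Suc[OF assms(2)] Zp_cong_Suc[OF assms(3)])+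
  then show "a \<oplus>\<^bsub>Zp p\<^esub> b \<in> carrier (Zp p)" "a \<otimes>\<^bsub>Zp p\<^esub> b \<in> carrier (Zp p)"
    by (simp_all add: Zp_def)
qed

lemma Zp_cring:
  assumes "p > 0"
  shows "cring (Zp p)"
proof (rule cringI)
  have zero: "\<zero>\<^bsub>Zp p\<^esub> \<in> carrier (Zp p)" and one: "\<one>\<^bsub>Zp p\<^esub> \<in> carrier (Zp p)"
    using Zp_carrierI[OF assms, of "\<lambda>k. 0"] Zp_carrierI[OF assms, of "\<lambda>k. 1"]
    by (simp_all add: Zp_def)
  note closed = Zp_add_closed[OF assms] zero one
  show "abelian_group (Zp p)"
  proof (rule abelian_groupI)
    fix x assume x: "x \<in> carrier (Zp p)"
    have "(\<lambda>k. (- x k) mod int p ^ k) \<in> carrier (Zp p)"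
      using x assms by (intro Zp_carrierI) (auto simp: cong_minus_minus_iff Zp_cong_Suc)
    then show "\<exists>y\<in>carrier (Zp p). y \<oplus>\<^bsub>Zp p\<^esub> x = \<zero>\<^bsub>Zp p\<^esub>"
      by (rule bexI[rotated]) (simp add: fun_eq_iff Zp_ops mod_simps)
  qed (use closed Zp_carrierD in
      \<open>auto simp: fun_eq_iff Zp_ops mod_simps add.assoc add.commute add.left_commute\<close>)
  show "comm_monoid (Zp p)"
    by (rule comm_monoidI)
      (use closed Zp_carrierD in \<open>auto simp: fun_eq_iff Zp_ops mod_simps mult.assoc mult.commute mult.left_commute\<close>)
qed (auto simp: fun_eq_iff Zp_ops mod_simps distrib_right)

lemma Zp_minus:
  assumes "p > 0" "a \<in> carrier (Zp p)" "b \<in> carrier (Zp p)"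
  shows "(a \<ominus>\<^bsub>Zp p\<^esub> b) k = (a k - b k) mod int p ^ k"
proof -
  interpret Z: cring "Zp p" using assms(1) by (rule Zp_cring)
  define d where "d = a \<ominus>\<^bsub>Zp p\<^esub> b"
  have d: "d \<in> carrier (Zp p)" using assms by (simp add: d_def)
  have "a = d \<oplus>\<^bsub>Zp p\<^esub> b"
    unfolding d_def using assms(2,3) by algebra
  then have "a k = (d k + b k) mod int p ^ k" by (simp add: Zp_ops)
  then have "(a k - b k) mod int p ^ k = d k mod int p ^ k" by (simp add: mod_simps)
  then show ?thesis
    using Zp_carrierD[OF d, of k] by (simp add: d_def)
qed

lemma Zp_add_pow:
  assumes "p > 0" "a \<in> carrier (Zp p)"
  shows "([(m::nat)] \<cdot>\<^bsub>Zp p\<^esub> a) k = (int m * a k) mod int p ^ k"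
proof -
  interpret Z: cring "Zp p" using assms(1) by (rule Zp_cring)
  show ?thesis
  proof (induction m)
    case (Suc m)
    then show ?case
      using assms(2) by (simp add: Z.add.nat_pow_Suc Zp_ops mod_simps) (simp add: algebra_simps)
  qed (simp add: Zp_ops)
qed

lemma Zp_of_nat:
  assumes "p > 0"
  shows "([(m::nat)] \<cdot>\<^bsub>Zp p\<^esub> \<one>\<^bsub>Zp p\<^esub>) k = int m mod int p ^ k"
proof -
  interpret Z: cring "Zp p" using assms by (rule Zp_cring)
  show ?thesis
    using Zp_add_pow[OF assms Z.one_closed, of m k] by (simp add: Zp_ops mod_simps)
qed

text \<open>Writing m = p^v r with r prime to p, the factor r cancels for free and p^v costs v
  powers of p. Every loss of precision caused by a factorial goes back to this.\<close>

lemma prime_power_dvd_cancel: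
  fixes x :: int
  assumes "prime p" "m > 0" "int p ^ (k + multiplicity p m) dvd int m * x"
  shows "int p ^ k dvd x"
proof -
  define r where "r = m div p ^ multiplicity p m"
  have r: "m = p ^ multiplicity p m * r"
    by (simp add: r_def multiplicity_dvd)
  have "\<not> p dvd r"
    using multiplicity_decompose[of m p] prime_gt_Suc_0_nat[OF assms(1)] assms(2) by (auto simp: r_def)
  then have co: "coprime (int p ^ k) (int r)"
    using assms(1) by (simp add: prime_imp_coprime)
  have "int m = int p ^ multiplicity p m * int r"
    by (metis r of_nat_mult of_nat_power)
  then have "int m * x = int p ^ multiplicity p m * (int r * x)"
    by simp
  then have "int p ^ multiplicity p m * int p ^ k dvd int p ^ multiplicity p m * (int r * x)"
    using assms(3) unfolding power_add by (simp only: mult.commute)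
  then have "int p ^ k dvd int r * x"
    using assms(1) by (subst (asm) dvd_mult_cancel_left) (auto simp: prime_gt_0_nat)
  then show ?thesis
    using co by (simp add: coprime_dvd_mult_right_iff)
qed

text \<open>At level k alone, multiplication by m may kill a nonzero residue. The residue is
  therefore read off from a level deeper by the multiplicity of p in m.\<close>

lemma Zp_torsion_free:
  assumes "prime p" "m > 0" and a: "a \<in> carrier (Zp p)" and "[(m::nat)] \<cdot>\<^bsub>Zp p\<^esub> a = \<zero>\<^bsub>Zp p\<^esub>"
  shows "a = \<zero>\<^bsub>Zp p\<^esub>"
proof
  fix k
  define l where "l = k + multiplicity p m"
  have "int m * a l mod int p ^ l = 0"
    using Zp_add_pow[OF prime_gt_0_nat[OF assms(1)] a, of m l] assms(4) by (simp add: Zp_ops)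
  then have "int p ^ k dvd a l"
    using prime_power_dvd_cancel[OF assms(1,2), of k "a l"] by (simp add: l_def dvd_eq_mod_eq_0)
  then show "a k = \<zero>\<^bsub>Zp p\<^esub> k"
    using Zp_mod[OF a, of k l] by (simp add: l_def Zp_ops dvd_eq_mod_eq_0)
qed

text \<open>The differences are integers, so the formula also covers m < i, where a factor vanishes.
  It makes the dependence on m polynomial, hence compatible with congruences.\<close>

lemma fact_mult_binomial_eq_prod:
  "int (fact i) * int (m choose i) = (\<Prod>j<i. int m - int j)"
proof -
  have "of_int (int (fact i) * int (m choose i)) = (of_int (\<Prod>j<i. int m - int j) :: rat)"
    using gbinomial_mult_fact[of i "of_nat m :: rat"]
    by (simp add: binomial_gbinomial atLeast0LessThan)
  then show ?thesis by (simp only: of_int_eq_iff)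
qed

text \<open>Continuity of the binomial coefficient in its upper argument: the product of the m - j
  respects congruences, and removing i! costs its power of p.\<close>

lemma binomial_cong:
  assumes "prime p" "[int m = int m'] (mod int p ^ (k + multiplicity p (fact i)))"
  shows "[int (m choose i) = int (m' choose i)] (mod int p ^ k)"
proof -
  have "[int (fact i) * int (m choose i) = int (fact i) * int (m' choose i)]
      (mod int p ^ (k + multiplicity p (fact i)))"
    unfolding fact_mult_binomial_eq_prod using assms(2) by (intro cong_prod cong_diff) auto
  then have "int p ^ (k + multiplicity p (fact i)) dvd
      int (fact i) * (int (m choose i) - int (m' choose i))"
    by (simp add: cong_iff_dvd_diff right_diff_distrib)
  from prime_power_dvd_cancel[OF assms(1) _ this] show ?thesis
    by (simp add: cong_iff_dvd_diff)
qed

lemma Zp_finprod: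
  fixes i :: nat
  assumes "p > 0" "\<And>j. j < i \<Longrightarrow> f j \<in> carrier (Zp p)"
  shows "(\<Otimes>\<^bsub>Zp p\<^esub>j\<in>{..<i}. f j) k = (\<Prod>j<i. f j k) mod int p ^ k"
proof -
  interpret Z: cring "Zp p" using assms(1) by (rule Zp_cring)
  show ?thesis
    using assms(2)
  proof (induction i)
    case (Suc i)
    then have "(\<Otimes>\<^bsub>Zp p\<^esub>j\<in>{..<Suc i}. f j) = f i \<otimes>\<^bsub>Zp p\<^esub> (\<Otimes>\<^bsub>Zp p\<^esub>j\<in>{..<i}. f j)"
      unfolding lessThan_Suc by (intro Z.finprod_insert) auto
    with Suc show ?case by (simp add: Zp_ops mod_simps mult.commute)
  qed (simp add: Zp_ops)
qed

text \<open>The p-adic binomial coefficient is the limit of ordinary ones. Existence comes from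
  \<open>binomial_cong\<close>, uniqueness from the absence of torsion. The second claim lets any
  natural number close enough to n compute a given residue.\<close>

lemma zp_binom_spec:
  assumes p: "prime p" and n: "n \<in> carrier (Zp p)"
  shows "zp_binom p n i \<in> carrier (Zp p)"
    and "[int m = n (k + multiplicity p (fact i))] (mod int p ^ (k + multiplicity p (fact i))) \<Longrightarrow>
      zp_binom p n i k = int (m choose i) mod int p ^ k"
proof -
  define e where "e = multiplicity p (fact i :: nat)"
  have p0: "p > 0" using p by (rule prime_gt_0_nat)
  interpret Z: cring "Zp p" using p0 by (rule Zp_cring)
  \<comment> \<open>The residue of n is taken e levels deeper than the result, to make up for the
    division by i!.\<close>
  define c where "c k = int (nat (n (k + e)) choose i) mod int p ^ k" for k
  have nonneg: "0 \<le> n k" for k using Zp_carrierD[OF n] by blast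
  have c: "c \<in> carrier (Zp p)"
    unfolding c_def
  proof (rule Zp_carrierI[OF p0], rule binomial_cong[OF p])
    fix k show "[int (nat (n (Suc k + e))) = int (nat (n (k + e)))] (mod int p ^ (k + multiplicity p (fact i)))"
      using Zp_cong_Suc[OF n, of "k + e"] nonneg by (simp add: e_def)
  qed
  define P where "P = (\<Otimes>\<^bsub>Zp p\<^esub>j\<in>{..<i}. n \<ominus>\<^bsub>Zp p\<^esub> [j] \<cdot>\<^bsub>Zp p\<^esub> \<one>\<^bsub>Zp p\<^esub>)"
  have P: "P \<in> carrier (Zp p)" using n by (auto simp: P_def)
  have fact: "[(fact i :: nat)] \<cdot>\<^bsub>Zp p\<^esub> c = P"
  proof (rule Zp_eqI)
    fix k
    have "([(fact i :: nat)] \<cdot>\<^bsub>Zp p\<^esub> c) k = (int (fact i) * int (nat (n (k + e)) choose i)) mod int p ^ k"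
      by (simp add: Zp_add_pow[OF p0 c] c_def mod_simps)
    also have "\<dots> = (\<Prod>j<i. n (k + e) - int j) mod int p ^ k"
      unfolding fact_mult_binomial_eq_prod by (simp add: nonneg)
    also have "[(\<Prod>j<i. n (k + e) - int j) mod int p ^ k =
        (\<Prod>j<i. (n \<ominus>\<^bsub>Zp p\<^esub> [j] \<cdot>\<^bsub>Zp p\<^esub> \<one>\<^bsub>Zp p\<^esub>) k) mod int p ^ k] (mod int p ^ k)"
    proof -
      have "[n (k + e) - int j = (n \<ominus>\<^bsub>Zp p\<^esub> [j] \<cdot>\<^bsub>Zp p\<^esub> \<one>\<^bsub>Zp p\<^esub>) k] (mod int p ^ k)" for j
        using n Zp_mod[OF n, of k "k + e"]
        by (simp add: Zp_minus[OF p0] Zp_of_nat[OF p0] cong_def mod_simps) (metis mod_diff_left_eq)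
      then show ?thesis by (simp add: cong_prod)
    qed
    also have "(\<Prod>j<i. (n \<ominus>\<^bsub>Zp p\<^esub> [j] \<cdot>\<^bsub>Zp p\<^esub> \<one>\<^bsub>Zp p\<^esub>) k) mod int p ^ k = P k"
      unfolding P_def using n by (subst Zp_finprod[OF p0]) auto
    finally show "[([(fact i :: nat)] \<cdot>\<^bsub>Zp p\<^esub> c) k = P k] (mod int p ^ k)" .
  qed (use c P in simp_all)
  have "zp_binom p n i = c"
    unfolding zp_binom_def P_def[symmetric]
  proof (rule the_equality)
    fix d assume d: "d \<in> carrier (Zp p) \<and> [(fact i :: nat)] \<cdot>\<^bsub>Zp p\<^esub> d = P"
    have "[(fact i :: nat)] \<cdot>\<^bsub>Zp p\<^esub> (d \<ominus>\<^bsub>Zp p\<^esub> c) = [(fact i :: nat)] \<cdot>\<^bsub>Zp p\<^esub> d \<ominus>\<^bsub>Zp p\<^esub> [(fact i :: nat)] \<cdot>\<^bsub>Zp p\<^esub> c"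
      using d c by (simp add: a_minus_def Z.add.nat_pow_distrib Z.add.nat_pow_inv)
    also have "\<dots> = \<zero>\<^bsub>Zp p\<^esub>"
      using d c P fact by (simp add: Z.r_neg a_minus_def)
    finally have "d \<ominus>\<^bsub>Zp p\<^esub> c = \<zero>\<^bsub>Zp p\<^esub>"
      using Zp_torsion_free[OF p, of "fact i" "d \<ominus>\<^bsub>Zp p\<^esub> c"] d c by simp
    then show "d = c" using d c by (simp add: Z.minus_eq_zero_iff)
  next
    show "c \<in> carrier (Zp p) \<and> [(fact i :: nat)] \<cdot>\<^bsub>Zp p\<^esub> c = P"
      using c fact by blast
  qed
  with c show "zp_binom p n i \<in> carrier (Zp p)" by simp
  assume m: "[int m = n (k + multiplicity p (fact i))] (mod int p ^ (k + multiplicity p (fact i)))"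
  have "[int (nat (n (k + e)) choose i) = int (m choose i)] (mod int p ^ k)"
  proof (rule binomial_cong[OF p])
    have "int (nat (n (k + e))) = n (k + e)" using nonneg by simp
    then show "[int (nat (n (k + e))) = int m] (mod int p ^ (k + multiplicity p (fact i)))"
      using cong_sym[OF m] unfolding e_def by (simp only:)
  qed
  then show "zp_binom p n i k = int (m choose i) mod int p ^ k"
    using \<open>zp_binom p n i = c\<close> by (simp add: c_def cong_def)
qed

lemma zp_binom_cong:
  assumes "prime p" "n \<in> carrier (Zp p)"
    "k + multiplicity p (fact i) \<le> K" "[int m = n K] (mod int p ^ K)"
  shows "zp_binom p n i k = int (m choose i) mod int p ^ k"
proof (rule zp_binom_spec(2)[OF assms(1,2)])
  let ?l = "k + multiplicity p (fact i)"
  have "[int m = n K] (mod int p ^ ?l)"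
    using assms(3,4) by (rule cong_dvd_modulus[OF _ le_imp_power_dvd, rotated])
  then show "[int m = n ?l] (mod int p ^ ?l)"
    using Zp_mod[OF assms(2,3)] Zp_carrierD[OF assms(2), of ?l] by (simp add: cong_def)
qed

lemma zp_binom_0_1:
  assumes "prime p" "n \<in> carrier (Zp p)"
  shows "zp_binom p n 0 = \<one>\<^bsub>Zp p\<^esub>" "zp_binom p n 1 = n"
proof -
  have "[int (nat (n k)) = n k] (mod int p ^ k)" for k
    using Zp_carrierD[OF assms(2), of k] by simp
  note * = zp_binom_cong[OF assms _ this]
  show "zp_binom p n 0 = \<one>\<^bsub>Zp p\<^esub>" "zp_binom p n 1 = n"
    using *[of _ 0] *[of k 1 k for k] Zp_carrierD[OF assms(2)] by (auto simp: fun_eq_iff Zp_ops)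
qed

section \<open>Evaluation of integral polynomials\<close>

lemma (in cring) add_pow_mult_int:
  assumes "a \<in> carrier R" "b \<in> carrier R"
  shows "[(k * l :: int)] \<cdot> (a \<otimes> b) = ([k] \<cdot> a) \<otimes> ([l] \<cdot> b)"
  using assms by (simp add: add_pow_ldistr_int add_pow_rdistr_int add.int_pow_pow mult.commute)

lemma poly_mapping_induct [case_names single sum]:
  fixes f :: "'k \<Rightarrow>\<^sub>0 'c::comm_monoid_add"
  assumes "\<And>m c. P (Poly_Mapping.single m c)" and "\<And>f g. P f \<Longrightarrow> P g \<Longrightarrow> P (f + g)"
  shows "P f"
proof (induction f rule: update_induct)
  case const
  show ?case using assms(1)[of _ 0] by simp
next
  case (update f a b)
  have "Poly_Mapping.update a b f = Poly_Mapping.single a b + f"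
    using update(1)
    by (intro poly_mapping_eqI) (auto simp: lookup_update lookup_add lookup_single in_keys_iff when_def)
  then show ?case using assms update by simp
qed

lemma zpoly_induct [case_names var const add mult]:
  fixes f :: "'v zpoly"
  assumes "\<And>v. P (zvar v)" "\<And>c. P (of_int c)"
    and add: "\<And>f g. P f \<Longrightarrow> P g \<Longrightarrow> P (f + g)"
    and mult: "\<And>f g. P f \<Longrightarrow> P g \<Longrightarrow> P (f * g)"
  shows "P f"
proof -
  have var_power: "P (Poly_Mapping.single (Poly_Mapping.single v k) 1)" for v k
  proof (induction k)
    case 0
    show ?case using assms(2)[of 1] by simp
  next
    case (Suc k)
    have "Poly_Mapping.single (Poly_Mapping.single v (Suc k)) (1::int) =
        zvar v * Poly_Mapping.single (Poly_Mapping.single v k) 1"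
      by (simp add: zvar_def mult_single single_add[symmetric])
    then show ?case using mult[OF assms(1) Suc] by simp
  qed
  have mon: "P (Poly_Mapping.single m 1)" for m :: "'v \<Rightarrow>\<^sub>0 nat"
  proof (induction m rule: poly_mapping_induct)
    case (single v k)
    show ?case by (rule var_power)
  next
    case (sum m n)
    have "Poly_Mapping.single (m + n) (1::int) =
        Poly_Mapping.single m 1 * Poly_Mapping.single n 1"
      by (simp add: mult_single)
    then show ?case using mult[OF sum(1,2)] by simp
  qed
  show ?thesis
  proof (induction f rule: poly_mapping_induct)
    case (single m c)
    have "Poly_Mapping.single m c = of_int c * Poly_Mapping.single m 1"
      by (simp add: mult_single flip: single_of_int)
    then show ?case using mult[OF assms(2) mon] by simp
  next
    case (sum f g)
    then show ?case using add by blast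
  qed
qed

definition mon_eval :: "('a, 'm) ring_scheme \<Rightarrow> ('v \<Rightarrow> 'a) \<Rightarrow> ('v \<Rightarrow>\<^sub>0 nat) \<Rightarrow> 'a" where
  "mon_eval R x m = (\<Otimes>\<^bsub>R\<^esub>v\<in>Poly_Mapping.keys m. x v [^]\<^bsub>R\<^esub> Poly_Mapping.lookup m v)"

context cring
begin

context
  fixes x :: "'v \<Rightarrow> 'a"
  assumes x: "\<And>v. x v \<in> carrier R"
begin

lemma mon_eval_closed [simp]: "mon_eval R x m \<in> carrier R"
  using x by (simp add: mon_eval_def)

lemma mon_eval_superset:
  assumes "finite S" "Poly_Mapping.keys m \<subseteq> S"
  shows "mon_eval R x m = (\<Otimes>v\<in>S. x v [^] Poly_Mapping.lookup m v)"
proof -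
  have "(\<Otimes>v\<in>Poly_Mapping.keys m \<union> (S - Poly_Mapping.keys m). x v [^] Poly_Mapping.lookup m v) =
      mon_eval R x m \<otimes> (\<Otimes>v\<in>S - Poly_Mapping.keys m. x v [^] Poly_Mapping.lookup m v)"
    unfolding mon_eval_def using assms x by (intro finprod_Un_disjoint) auto
  also have "(\<Otimes>v\<in>S - Poly_Mapping.keys m. x v [^] Poly_Mapping.lookup m v) = \<one>"
    by (rule finprod_one_eqI) (simp add: in_keys_iff)
  finally show ?thesis using assms(2) by (simp add: Un_absorb1)
qed

lemma mon_eval_add: "mon_eval R x (m + n) = mon_eval R x m \<otimes> mon_eval R x n"
proof -
  let ?S = "Poly_Mapping.keys m \<union> Poly_Mapping.keys n"
  have "mon_eval R x (m + n) = (\<Otimes>v\<in>?S. x v [^] Poly_Mapping.lookup m v \<otimes> x v [^] Poly_Mapping.lookup n v)"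
    using mon_eval_superset[of ?S "m + n"] keys_add[of m n] x by (simp add: lookup_add nat_pow_mult)
  also have "\<dots> = mon_eval R x m \<otimes> mon_eval R x n"
    using x mon_eval_superset[of ?S m] mon_eval_superset[of ?S n] by (simp add: finprod_multf)
  finally show ?thesis .
qed

lemma zpoly_eval_closed [simp]: "zpoly_eval R x f \<in> carrier R"
  unfolding zpoly_eval_def mon_eval_def[symmetric] by (intro finsum_closed) auto

text \<open>Coefficients may cancel in f + g, so its keys can be fewer than those of f and g
  together. Admitting zero coefficients lets all three sums run over one index set.\<close>

lemma zpoly_eval_superset:
  assumes "finite S" "Poly_Mapping.keys f \<subseteq> S"
  shows "zpoly_eval R x f = (\<Oplus>m\<in>S. [Poly_Mapping.lookup f m] \<cdot> mon_eval R x m)"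
proof -
  have "(\<Oplus>m\<in>Poly_Mapping.keys f \<union> (S - Poly_Mapping.keys f). [Poly_Mapping.lookup f m] \<cdot> mon_eval R x m) =
      zpoly_eval R x f \<oplus> (\<Oplus>m\<in>S - Poly_Mapping.keys f. [Poly_Mapping.lookup f m] \<cdot> mon_eval R x m)"
    unfolding zpoly_eval_def mon_eval_def[symmetric] using assms
    by (intro finsum_Un_disjoint) auto
  also have "(\<Oplus>m\<in>S - Poly_Mapping.keys f. [Poly_Mapping.lookup f m] \<cdot> mon_eval R x m) = \<zero>"
    by (rule add.finprod_one_eqI) (simp add: in_keys_iff add_pow_int_ge)
  finally show ?thesis using assms(2) by (simp add: Un_absorb1)
qed

lemma zpoly_eval_add: "zpoly_eval R x (f + g) = zpoly_eval R x f \<oplus> zpoly_eval R x g"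
proof -
  let ?S = "Poly_Mapping.keys f \<union> Poly_Mapping.keys g"
  have "zpoly_eval R x (f + g) =
      (\<Oplus>m\<in>?S. [Poly_Mapping.lookup f m] \<cdot> mon_eval R x m \<oplus> [Poly_Mapping.lookup g m] \<cdot> mon_eval R x m)"
    using zpoly_eval_superset[of ?S "f + g"] keys_add[of f g]
    by (simp add: lookup_add add.int_pow_mult)
  also have "\<dots> = zpoly_eval R x f \<oplus> zpoly_eval R x g"
    using zpoly_eval_superset[of ?S f] zpoly_eval_superset[of ?S g] by (simp add: finsum_addf)
  finally show ?thesis .
qed

lemma zpoly_eval_single: "zpoly_eval R x (Poly_Mapping.single m c) = [c] \<cdot> mon_eval R x m"
  using zpoly_eval_superset[of "{m}" "Poly_Mapping.single m c"] by simp

lemma zpoly_eval_zero: "zpoly_eval R x 0 = \<zero>"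
  by (simp add: zpoly_eval_def)

lemma zpoly_eval_one: "zpoly_eval R x 1 = \<one>"
  using zpoly_eval_single[of 0 1] by (simp add: mon_eval_def)

lemma zpoly_eval_var: "zpoly_eval R x (zvar v) = x v"
  using mon_eval_superset[of "{v}" "Poly_Mapping.single v 1"] x
  by (simp add: zvar_def zpoly_eval_single)

lemma zpoly_eval_mult: "zpoly_eval R x (f * g) = zpoly_eval R x f \<otimes> zpoly_eval R x g"
proof (induction f rule: poly_mapping_induct)
  case (single m c)
  show ?case
  proof (induction g rule: poly_mapping_induct)
    case (single n d)
    show ?case
      by (simp add: mult_single zpoly_eval_single mon_eval_add add_pow_mult_int)
  next
    case (sum g h)
    then show ?case by (simp add: distrib_left zpoly_eval_add r_distr)
  qed
next
  case (sum f h)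
  then show ?case by (simp add: distrib_right zpoly_eval_add l_distr)
qed

lemma zpoly_eval_uminus: "zpoly_eval R x (- f) = \<ominus> zpoly_eval R x f"
proof -
  have "zpoly_eval R x (- f) \<oplus> zpoly_eval R x f = \<zero>"
    by (simp add: zpoly_eval_zero flip: zpoly_eval_add)
  then show ?thesis by (simp add: minus_equality)
qed

lemma zpoly_eval_power: "zpoly_eval R x (f ^ n) = zpoly_eval R x f [^] n"
  by (induction n) (simp_all add: zpoly_eval_one zpoly_eval_mult m_comm)

lemma zpoly_eval_of_nat_mult: "zpoly_eval R x (of_nat n * f) = [n] \<cdot> zpoly_eval R x f"
  by (induction n) (simp_all add: zpoly_eval_zero zpoly_eval_add distrib_right a_comm)

end

end

lemma zpoly_eval_hom:
  assumes "cring R" "cring S" "h \<in> ring_hom R S" "\<And>v. x v \<in> carrier R"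
  shows "h (zpoly_eval R x f) = zpoly_eval S (\<lambda>v. h (x v)) f"
proof -
  interpret ring_hom_cring R S h
    using assms by (simp add: ring_hom_cring_def ring_hom_cring_axioms_def)
  have x': "\<And>v. h (x v) \<in> carrier S" using assms(4) by simp
  show ?thesis
  proof (induction f rule: zpoly_induct)
    case (var v)
    show ?case by (simp add: R.zpoly_eval_var[OF assms(4)] S.zpoly_eval_var[OF x'])
  next
    case (const c)
    have nat: "h (zpoly_eval R x (of_nat n)) = zpoly_eval S (\<lambda>v. h (x v)) (of_nat n)" for n
      by (induction n) (simp_all add: R.zpoly_eval_zero[OF assms(4)] S.zpoly_eval_zero[OF x']
        R.zpoly_eval_one[OF assms(4)] S.zpoly_eval_one[OF x'] R.zpoly_eval_closed[OF assms(4)]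
        R.zpoly_eval_add[OF assms(4)] S.zpoly_eval_add[OF x'])
    show ?case
      using nat by (cases c rule: int_diff_cases)
        (simp add: R.zpoly_eval_add[OF assms(4)] S.zpoly_eval_add[OF x'] R.zpoly_eval_closed[OF assms(4)]
          R.zpoly_eval_uminus[OF assms(4)] S.zpoly_eval_uminus[OF x'] diff_conv_add_uminus del: add_uminus_conv_diff)
  next
    case (add f g)
    then show ?case
      by (simp add: R.zpoly_eval_add[OF assms(4)] S.zpoly_eval_add[OF x'] R.zpoly_eval_closed[OF assms(4)])
  next
    case (mult f g)
    then show ?case
      by (simp add: R.zpoly_eval_mult[OF assms(4)] S.zpoly_eval_mult[OF x'] R.zpoly_eval_closed[OF assms(4)])
  qed
qed

section \<open>The universal Witt polynomials\<close>

text \<open>The inner binomial coefficients are divisible by p. The further factor y of each inner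
  term is kept visible because y is later a small difference, and the term is then small by p and by
  y.\<close>

lemma binomial_prime_power:
  fixes x y :: "'r::comm_ring_1"
  assumes "prime p"
  obtains r where "(x + y) ^ p = x ^ p + of_nat p * (y * r) + y ^ p"
proof -
  have p: "p > 0" using assms by (rule prime_gt_0_nat)
  have "(x + y) ^ p = (\<Sum>k\<le>p. of_nat (p choose k) * x ^ k * y ^ (p - k))"
    by (rule binomial_ring)
  also have "{..p} = insert p (insert 0 {0<..<p})"
    using p by auto
  also have "(\<Sum>k\<in>insert p (insert 0 {0<..<p}). of_nat (p choose k) * x ^ k * y ^ (p - k)) =
      x ^ p + (y ^ p + (\<Sum>k\<in>{0<..<p}. of_nat (p choose k) * x ^ k * y ^ (p - k)))"
    using p by simp
  also have "(\<Sum>k\<in>{0<..<p}. of_nat (p choose k) * x ^ k * y ^ (p - k)) =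
      (\<Sum>k\<in>{0<..<p}. of_nat p * (y * (of_nat ((p choose k) div p) * x ^ k * y ^ (p - k - 1))))"
  proof (rule sum.cong[OF refl])
    fix k assume k: "k \<in> {0<..<p}"
    then have "p dvd (p choose k)" using assms by (intro dvd_choose_prime) auto
    then have "of_nat (p choose k) = (of_nat p * of_nat ((p choose k) div p) :: 'r)"
      by (simp flip: of_nat_mult)
    moreover have "y ^ (p - k) = y * y ^ (p - k - 1)"
      using k by (simp add: Suc_diff_Suc flip: power_Suc)
    ultimately show "of_nat (p choose k) * x ^ k * y ^ (p - k) =
        of_nat p * (y * (of_nat ((p choose k) div p) * x ^ k * y ^ (p - k - 1)))"
      by (simp add: mult_ac)
  qed
  also have "\<dots> = of_nat p * (y * (\<Sum>k\<in>{0<..<p}. of_nat ((p choose k) div p) * x ^ k * y ^ (p - k - 1)))"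
    by (simp add: sum_distrib_left)
  finally show ?thesis using that by (simp add: add_ac)
qed

text \<open>If a = b + d, raising to the p-th power leaves the error p d r + d^p. The first term
  gains one factor p, and the second gains at least one because p >= 2.\<close>

lemma power_prime_power_dvd_diff:
  fixes a b :: "'r::comm_ring_1"
  assumes p: "prime p" and "of_nat p dvd a - b"
  shows "of_nat p ^ Suc k dvd a ^ (p ^ k) - b ^ (p ^ k)"
proof (induction k)
  case 0
  show ?case using assms(2) by simp
next
  case (Suc k)
  define d where "d = a ^ (p ^ k) - b ^ (p ^ k)"
  have d: "of_nat p ^ Suc k dvd d" using Suc by (simp add: d_def)
  obtain r where "(b ^ (p ^ k) + d) ^ p = (b ^ (p ^ k)) ^ p + of_nat p * (d * r) + d ^ p"
    using binomial_prime_power[OF p] by blast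
  then have "a ^ (p ^ Suc k) - b ^ (p ^ Suc k) = of_nat p * (d * r) + d ^ p"
    by (simp add: d_def mult.commute flip: power_mult)
  moreover have "of_nat p ^ Suc (Suc k) dvd of_nat p * (d * r)"
    unfolding power_Suc[of _ "Suc k"] using d by (intro mult_dvd_mono dvd_mult2) auto
  moreover have "of_nat p ^ Suc (Suc k) dvd d ^ p"
  proof -
    have "(of_nat p ^ Suc k) ^ p dvd d ^ p" using d by (rule dvd_power_same)
    moreover have "Suc (Suc k) \<le> Suc k * p"
      using prime_ge_2_nat[OF p] mult_le_mono2[of 2 p "Suc k"] by simp
    then have "of_nat p ^ Suc (Suc k) dvd ((of_nat p ^ Suc k) ^ p :: 'r)"
      unfolding power_mult[symmetric] by (rule le_imp_power_dvd)
    ultimately show ?thesis by (rule dvd_trans[rotated])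
  qed
  ultimately show ?case by simp
qed

text \<open>A type-class ring packed as a record, so that \<open>zpoly_eval\<close> can also
  substitute polynomials into polynomials.\<close>

definition type_ring :: "'r::comm_ring_1 ring" where
  "type_ring = \<lparr>carrier = UNIV, monoid.mult = (*), one = 1, zero = 0, add = (+)\<rparr>"

lemma type_ring_simps [simp]:
  "carrier type_ring = UNIV" "x \<otimes>\<^bsub>type_ring\<^esub> y = x * y" "\<one>\<^bsub>type_ring\<^esub> = 1"
  "\<zero>\<^bsub>type_ring\<^esub> = 0" "x \<oplus>\<^bsub>type_ring\<^esub> y = x + y"
  by (simp_all add: type_ring_def)

lemma type_ring_cring: "cring type_ring"
  by (rule cringI, rule abelian_groupI)
    (auto intro!: comm_monoidI exI[of _ "- _"] simp: algebra_simps)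

interpretation type_ring: cring type_ring
  by (rule type_ring_cring)

lemma type_ring_pow [simp]: "x [^]\<^bsub>type_ring\<^esub> (n::nat) = x ^ n"
  by (induction n) (simp_all add: mult.commute)

lemma type_ring_a_inv [simp]: "\<ominus>\<^bsub>type_ring\<^esub> x = - x"
  using type_ring.minus_equality[of "- x" x] by simp

text \<open>The lift of Frobenius to integral polynomials, the endomorphism that Dwork's lemma
  requires.\<close>

definition frob :: "nat \<Rightarrow> 'v zpoly \<Rightarrow> 'v zpoly" where
  "frob p = zpoly_eval type_ring (\<lambda>v. zvar v ^ p)"

lemma frob_simps:
  "frob p (f + g) = frob p f + frob p g" "frob p (f * g) = frob p f * frob p g"
  "frob p (- f) = - frob p f" "frob p 0 = 0" "frob p 1 = 1" "frob p (zvar v) = zvar v ^ p"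
  by (simp_all add: frob_def type_ring.zpoly_eval_add type_ring.zpoly_eval_mult
      type_ring.zpoly_eval_uminus type_ring.zpoly_eval_zero type_ring.zpoly_eval_one
      type_ring.zpoly_eval_var)

lemma frob_power: "frob p (f ^ n) = frob p f ^ n"
  by (induction n) (simp_all add: frob_simps)

lemma frob_of_nat: "frob p (of_nat n) = of_nat n"
  by (induction n) (simp_all add: frob_simps)

lemma frob_sum: "frob p (sum f A) = (\<Sum>i\<in>A. frob p (f i))"
  by (induction A rule: infinite_finite_induct) (simp_all add: frob_simps)

text \<open>The polynomials with this congruence contain the variables and are closed under sums,
  products and negation. Only sums need an argument: modulo p the power map is additive.\<close>

lemma frob_cong:
  assumes p: "prime p"
  shows "of_nat p dvd frob p f - f ^ p"
proof -
  let ?D = "\<lambda>f::'a zpoly. of_nat p dvd frob p f - f ^ p"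
  have add: "?D (f + g)" if fg: "?D f" "?D g" for f g
  proof -
    obtain r where "(f + g) ^ p = f ^ p + of_nat p * (g * r) + g ^ p"
      using binomial_prime_power[OF p] by blast
    then have "frob p (f + g) - (f + g) ^ p =
        (frob p f - f ^ p) + (frob p g - g ^ p) - of_nat p * (g * r)"
      by (simp add: frob_simps)
    then show ?thesis using fg by simp
  qed
  have nat: "?D (of_nat n)" for n
  proof (induction n)
    case 0
    show ?case using prime_gt_0_nat[OF p] by (simp add: frob_simps power_0_left)
  next
    case (Suc n)
    then show ?case using add[of 1 "of_nat n"] by (simp add: frob_simps)
  qed
  \<comment> \<open>Expanding (f + (- f))^p = 0 gives (- f)^p modulo p without a case distinction on
    the parity of p.\<close>
  have uminus: "?D (- f)" if f: "?D f" for f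
  proof -
    obtain r where "(f + - f) ^ p = f ^ p + of_nat p * (- f * r) + (- f) ^ p"
      using binomial_prime_power[OF p] by blast
    then have "frob p (- f) - (- f) ^ p = - (frob p f - f ^ p) - of_nat p * (f * r)"
      using prime_gt_0_nat[OF p] by (simp add: frob_simps power_0_left algebra_simps)
    then show ?thesis using f by (metis dvd_diff dvd_minus_iff dvd_triv_left)
  qed
  show ?thesis
  proof (induction f rule: zpoly_induct)
    case (var v)
    show ?case by (simp add: frob_simps)
  next
    case (const c)
    show ?case
      using nat uminus by (cases c rule: int_cases2) (simp_all add: nat uminus)
  next
    case (add f g)
    then show ?case by (rule \<open>\<And>f g. ?D f \<Longrightarrow> ?D g \<Longrightarrow> ?D (f + g)\<close>)
  next
    case (mult f g)
    have "frob p (f * g) - (f * g) ^ p =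
        (frob p f - f ^ p) * frob p g + f ^ p * (frob p g - g ^ p)"
      by (simp add: frob_simps algebra_simps power_mult_distrib)
    then show ?case using mult by simp
  qed
qed

section \<open>Ghost components and Dwork's lemma\<close>

lemma witt_ghost_0: "witt_ghost p 0 S = S 0"
  by (simp add: witt_ghost_def)

lemma witt_ghost_Suc:
  "witt_ghost p (Suc n) S = witt_ghost p n (\<lambda>i. S i ^ p) + of_nat (p ^ Suc n) * S (Suc n)"
  by (simp add: witt_ghost_def Suc_diff_le power_mult)

lemma witt_ghost_cong: "(\<And>i. i \<le> n \<Longrightarrow> S i = T i) \<Longrightarrow> witt_ghost p n S = witt_ghost p n T"
  by (simp add: witt_ghost_def)

lemma frob_witt_ghost: "frob p (witt_ghost p n S) = witt_ghost p n (\<lambda>i. frob p (S i))"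
  unfolding witt_ghost_def frob_sum by (simp add: frob_simps frob_of_nat frob_power flip: of_nat_power)

text \<open>In the i-th term, a congruence modulo p becomes one modulo p^(n - i + 1) on taking p^(n
  - i)-th powers, and the weight p^i supplies the rest.\<close>

lemma frob_witt_ghost_cong:
  assumes p: "prime p"
  shows "of_nat p ^ Suc n dvd frob p (witt_ghost p n S) - witt_ghost p n (\<lambda>i. S i ^ p)"
proof -
  have "frob p (witt_ghost p n S) - witt_ghost p n (\<lambda>i. S i ^ p) =
      (\<Sum>i\<le>n. of_nat (p ^ i) * (frob p (S i) ^ p ^ (n - i) - (S i ^ p) ^ p ^ (n - i)))"
    unfolding frob_witt_ghost by (simp add: witt_ghost_def right_diff_distrib sum_subtractf)
  moreover have "of_nat p ^ Suc n dvd
      of_nat (p ^ i) * (frob p (S i) ^ p ^ (n - i) - (S i ^ p) ^ p ^ (n - i))" if "i \<le> n" for i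
  proof -
    have "of_nat p ^ Suc n = of_nat (p ^ i) * (of_nat p ^ Suc (n - i) :: 'a zpoly)"
      using that by (simp add: Suc_diff_le[symmetric] flip: power_add)
    then show ?thesis
      using power_prime_power_dvd_diff[OF p frob_cong[OF p]] by (simp only:) (intro mult_dvd_mono; simp)
  qed
  ultimately show ?thesis by (simp only:) (rule dvd_sum, simp)
qed

text \<open>Dwork's lemma. By \<open>witt_ghost_Suc\<close> the component of index n + 1 enters the
  ghost component linearly with coefficient p^(n + 1). The hypothesis and
  \<open>frob_witt_ghost_cong\<close> make the remaining part divisible by that power, so the
  equation can be solved.\<close>

lemma ghost_vectorI:
  fixes w :: "nat \<Rightarrow> 'v zpoly"
  assumes p: "prime p" and w: "\<And>n. of_nat p ^ Suc n dvd w (Suc n) - frob p (w n)"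
  obtains S where "\<And>n. witt_ghost p n S = w n"
proof -
  \<comment> \<open>Each S n is a whole vector that is right up to index n and is kept there
    afterwards. The diagonal of these vectors is the solution.\<close>
  have "\<exists>S. \<forall>n. (\<forall>i\<le>n. witt_ghost p i (S n) = w i) \<and> (\<forall>i\<le>n. S (Suc n) i = S n i)"
  proof (rule dependent_nat_choice)
    show "\<exists>S. \<forall>i\<le>0. witt_ghost p i S = w i"
      by (auto simp: witt_ghost_0 intro!: exI[of _ "\<lambda>i. w 0"])
  next
    fix S :: "nat \<Rightarrow> 'v zpoly" and n
    assume S: "\<forall>i\<le>n. witt_ghost p i S = w i"
    have "of_nat p ^ Suc n dvd (w (Suc n) - frob p (w n)) +
        (frob p (witt_ghost p n S) - witt_ghost p n (\<lambda>i. S i ^ p))"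
      using w[of n] frob_witt_ghost_cong[OF p, of n S] by (rule dvd_add)
    then have "of_nat p ^ Suc n dvd w (Suc n) - witt_ghost p n (\<lambda>i. S i ^ p)"
      using S by simp
    then obtain t where t: "w (Suc n) - witt_ghost p n (\<lambda>i. S i ^ p) = of_nat p ^ Suc n * t"
      by (rule dvdE)
    have "witt_ghost p i (S(Suc n := t)) = w i" if "i \<le> Suc n" for i
    proof (cases "i = Suc n")
      case True
      have "witt_ghost p n (\<lambda>i. (S(Suc n := t)) i ^ p) = witt_ghost p n (\<lambda>i. S i ^ p)"
        by (rule witt_ghost_cong) simp
      then show ?thesis using t True unfolding True witt_ghost_Suc
        by (simp add: algebra_simps)
    next
      case False
      then have "witt_ghost p i (S(Suc n := t)) = witt_ghost p i S"
        using that by (intro witt_ghost_cong) simp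
      then show ?thesis using S False that by simp
    qed
    then show "\<exists>T. (\<forall>i\<le>Suc n. witt_ghost p i T = w i) \<and> (\<forall>i\<le>n. T i = S i)"
      by (intro exI[of _ "S(Suc n := t)"]) simp
  qed
  then obtain S where S: "\<And>n i. i \<le> n \<Longrightarrow> witt_ghost p i (S n) = w i"
    and stable: "\<And>n i. i \<le> n \<Longrightarrow> S (Suc n) i = S n i"
    by blast
  have "S i i = S n i" if "i \<le> n" for n i
    using that by (induction n rule: dec_induct) (simp_all add: stable)
  then have "witt_ghost p n (\<lambda>i. S i i) = witt_ghost p n (S n)" for n
    by (rule witt_ghost_cong)
  then have "witt_ghost p n (\<lambda>i. S i i) = w n" for n
    using S[of n n] by simp
  then show ?thesis using that by blast
qed

lemma lookup_of_nat_mult: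
  "Poly_Mapping.lookup (of_nat n * f) m = of_nat n * Poly_Mapping.lookup (f :: 'v zpoly) m"
  by (induction n) (simp_all add: distrib_right lookup_add)

lemma zpoly_of_nat_cancel:
  fixes f g :: "'v zpoly"
  assumes "n > 0" "of_nat n * f = of_nat n * g"
  shows "f = g"
  using assms by (metis lookup_of_nat_mult mult_cancel_left of_nat_eq_0_iff poly_mapping_eqI neq0_conv)

text \<open>The same recursion determines the top component, because integral polynomials have no
  p-torsion.\<close>

lemma witt_ghost_inj:
  fixes S T :: "nat \<Rightarrow> 'v zpoly"
  assumes "p > 0" "\<And>n. witt_ghost p n S = witt_ghost p n T"
  shows "S = T"
proof
  fix n show "S n = T n"
  proof (induction n rule: less_induct)
    case (less n)
    show ?case
    proof (cases n)
      case 0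
      then show ?thesis using assms(2)[of 0] by (simp add: witt_ghost_0)
    next
      case (Suc k)
      have "witt_ghost p k (\<lambda>i. S i ^ p) = witt_ghost p k (\<lambda>i. T i ^ p)"
        by (rule witt_ghost_cong) (simp add: less Suc)
      then have "of_nat (p ^ Suc k) * S (Suc k) = of_nat (p ^ Suc k) * T (Suc k)"
        using assms(2)[of "Suc k"] by (simp add: witt_ghost_Suc)
      then show ?thesis
        unfolding Suc by (rule zpoly_of_nat_cancel[rotated]) (use assms(1) in simp)
    qed
  qed
qed

section \<open>Witt polynomials for sum, product and negation\<close>

lemma frob_witt_ghost_var:
  "witt_ghost p (Suc n) (\<lambda>i. zvar (g i)) - frob p (witt_ghost p n (\<lambda>i. zvar (g i))) =
     of_nat p ^ Suc n * zvar (g (Suc n))"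
  by (simp add: witt_ghost_Suc frob_witt_ghost frob_simps)

text \<open>Dwork's lemma and injectivity of the ghost map justify the definite descriptions in
  \<open>witt_sum\<close> and \<open>witt_prod\<close>.\<close>

lemma witt_poly_the:
  fixes w :: "nat \<Rightarrow> 'v zpoly"
  assumes p: "prime p" and w: "\<And>n. of_nat p ^ Suc n dvd w (Suc n) - frob p (w n)"
  shows "witt_ghost p n (THE S. \<forall>n. witt_ghost p n S = w n) = w n"
proof -
  obtain S where S: "\<And>n. witt_ghost p n S = w n"
    using ghost_vectorI[of p w] p w by metis
  have "(THE S. \<forall>n. witt_ghost p n S = w n) = S"
    using S by (intro the_equality) (auto intro!: witt_ghost_inj[OF prime_gt_0_nat[OF p]])
  then show ?thesis using S by simp
qed

lemma witt_ghost_sum: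
  assumes "prime p"
  shows "witt_ghost p n (witt_sum p) =
    witt_ghost p n (\<lambda>i. zvar (Inl i)) + witt_ghost p n (\<lambda>i. zvar (Inr i))"
  unfolding witt_sum_def
proof (rule witt_poly_the[OF assms])
  fix n
  let ?X = "\<lambda>n. witt_ghost p n (\<lambda>i. zvar (Inl i)) :: (nat + nat) zpoly"
  let ?Y = "\<lambda>n. witt_ghost p n (\<lambda>i. zvar (Inr i)) :: (nat + nat) zpoly"
  have "?X (Suc n) + ?Y (Suc n) - frob p (?X n + ?Y n) =
      (?X (Suc n) - frob p (?X n)) + (?Y (Suc n) - frob p (?Y n))"
    by (simp add: frob_simps)
  also have "of_nat p ^ Suc n dvd \<dots>"
    unfolding frob_witt_ghost_var by (intro dvd_add dvd_triv_left)
  finally show "of_nat p ^ Suc n dvd ?X (Suc n) + ?Y (Suc n) - frob p (?X n + ?Y n)" .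
qed

lemma witt_ghost_prod:
  assumes "prime p"
  shows "witt_ghost p n (witt_prod p) =
    witt_ghost p n (\<lambda>i. zvar (Inl i)) * witt_ghost p n (\<lambda>i. zvar (Inr i))"
  unfolding witt_prod_def
proof (rule witt_poly_the[OF assms])
  fix n
  let ?X = "\<lambda>n. witt_ghost p n (\<lambda>i. zvar (Inl i)) :: (nat + nat) zpoly"
  let ?Y = "\<lambda>n. witt_ghost p n (\<lambda>i. zvar (Inr i)) :: (nat + nat) zpoly"
  have "?X (Suc n) * ?Y (Suc n) - frob p (?X n * ?Y n) =
      (?X (Suc n) - frob p (?X n)) * ?Y (Suc n) + frob p (?X n) * (?Y (Suc n) - frob p (?Y n))"
    by (simp add: frob_simps algebra_simps)
  also have "of_nat p ^ Suc n dvd \<dots>"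
    unfolding frob_witt_ghost_var by (intro dvd_add dvd_mult2 dvd_mult dvd_triv_left)
  finally show "of_nat p ^ Suc n dvd ?X (Suc n) * ?Y (Suc n) - frob p (?X n * ?Y n)" .
qed

text \<open>Componentwise negation is wrong for p = 2, so additive inverses are produced by Dwork's
  lemma as well.\<close>

lemma witt_neg_exists:
  assumes "prime p"
  obtains N :: "nat \<Rightarrow> nat zpoly"
  where "\<And>n. witt_ghost p n N = - witt_ghost p n zvar"
proof -
  let ?X = "\<lambda>n. witt_ghost p n zvar :: nat zpoly"
  have "of_nat p ^ Suc n dvd - ?X (Suc n) - frob p (- ?X n)" for n
  proof -
    have "- ?X (Suc n) - frob p (- ?X n) = - (?X (Suc n) - frob p (?X n))"
      by (simp add: frob_simps)
    then show ?thesis using frob_witt_ghost_var[of p n "\<lambda>i. i"] by (simp del: power_Suc)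
  qed
  then show ?thesis using ghost_vectorI[OF assms, of "\<lambda>n. - ?X n"] that by metis
qed

section \<open>Witt vectors over a ring\<close>

definition ghost :: "('a, 'm) ring_scheme \<Rightarrow> nat \<Rightarrow> nat \<Rightarrow> (nat \<Rightarrow> 'a) \<Rightarrow> 'a" where
  "ghost R p n x = (\<Oplus>\<^bsub>R\<^esub>i\<in>{..n}. [(p ^ i)] \<cdot>\<^bsub>R\<^esub> (x i [^]\<^bsub>R\<^esub> (p ^ (n - i))))"

lemma Witt_carrier: "x \<in> carrier (Witt p R) \<longleftrightarrow> (\<forall>i. x i \<in> carrier R)"
  by (simp add: Witt_def)

lemma Witt_ops:
  "x \<oplus>\<^bsub>Witt p R\<^esub> y = (\<lambda>n. zpoly_eval R (case_sum x y) (witt_sum p n))"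
  "x \<otimes>\<^bsub>Witt p R\<^esub> y = (\<lambda>n. zpoly_eval R (case_sum x y) (witt_prod p n))"
  "\<zero>\<^bsub>Witt p R\<^esub> = (\<lambda>n. \<zero>\<^bsub>R\<^esub>)"
  "\<one>\<^bsub>Witt p R\<^esub> = teich R \<one>\<^bsub>R\<^esub>"
  by (simp_all add: Witt_def)

text \<open>Preservation of zero is assumed separately: it follows from \<open>ring_hom\<close> only
  once the target is known to be a ring, which is what is being proved.\<close>

lemma cring_surj_image:
  assumes "cring R" "h \<in> ring_hom R S" "h ` carrier R = carrier S" "h \<zero>\<^bsub>R\<^esub> = \<zero>\<^bsub>S\<^esub>"
  shows "cring S"
proof -
  interpret R: cring R by fact
  have "ring (S\<lparr>carrier := h ` carrier R, zero := h \<zero>\<^bsub>R\<^esub>\<rparr>)"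
    using assms(2) by (rule R.ring_hom_imp_img_ring)
  then have S: "ring S" by (simp add: assms(3,4))
  show ?thesis
  proof (intro cring.intro S comm_monoid.intro comm_monoid_axioms.intro)
    show "monoid S" using S by (rule ring.is_monoid)
    fix x y assume "x \<in> carrier S" "y \<in> carrier S"
    then obtain a b where "a \<in> carrier R" "x = h a" "b \<in> carrier R" "y = h b"
      unfolding assms(3)[symmetric] by blast
    then show "x \<otimes>\<^bsub>S\<^esub> y = y \<otimes>\<^bsub>S\<^esub> x"
      using ring_hom_mult[OF assms(2)] R.m_comm by metis
  qed
qed

context cring
begin

lemma teich_closed [simp]: "a \<in> carrier R \<Longrightarrow> teich R a \<in> carrier (Witt p R)"
  by (simp add: Witt_carrier teich_def)

lemma zpoly_eval_ghost:
  assumes x: "\<And>v. x v \<in> carrier R"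
  shows "zpoly_eval R x (witt_ghost p n S) = ghost R p n (\<lambda>i. zpoly_eval R x (S i))"
proof -
  have sum: "zpoly_eval R x (sum f A) = (\<Oplus>i\<in>A. zpoly_eval R x (f i))" if "finite A"
    for f and A :: "nat set"
    using that
    by (induction A) (simp_all add: zpoly_eval_zero[OF x] zpoly_eval_add[OF x] zpoly_eval_closed[OF x])
  show ?thesis
    unfolding witt_ghost_def ghost_def
    by (simp only: sum finite_atMost zpoly_eval_of_nat_mult[OF x] zpoly_eval_power[OF x])
qed

lemma ghost_closed [simp]: "x \<in> carrier (Witt p R) \<Longrightarrow> ghost R p n x \<in> carrier R"
  by (auto simp: ghost_def Witt_carrier intro!: finsum_closed)

lemma ghost_teich:
  assumes "p > 0" "a \<in> carrier R"
  shows "ghost R p n (teich R a) = a [^] (p ^ n)"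
proof -
  have zero_pow: "\<zero> [^] (p ^ k) = \<zero>" for k
    using assms(1) nat_pow_zero[of "p ^ k"] by simp
  have "ghost R p n (teich R a) = [(p ^ 0)] \<cdot> (teich R a 0 [^] (p ^ (n - 0)))"
    unfolding ghost_def
    by (rule finsum_single) (use assms in \<open>simp_all add: teich_def zero_pow\<close>)
  then show ?thesis using assms by (simp add: teich_def)
qed

lemma ghost_zero:
  assumes "p > 0"
  shows "ghost R p n \<zero>\<^bsub>Witt p R\<^esub> = \<zero>"
proof -
  have "\<zero>\<^bsub>Witt p R\<^esub> = teich R \<zero>" by (simp add: Witt_ops teich_def)
  then show ?thesis using ghost_teich[OF assms zero_closed] assms by (simp add: nat_pow_zero)
qed

lemma ghost_split:
  assumes "x \<in> carrier (Witt p R)"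
  shows "ghost R p n x = [(p ^ n)] \<cdot> x n \<oplus> (\<Oplus>i\<in>{..<n}. [(p ^ i)] \<cdot> (x i [^] (p ^ (n - i))))"
  unfolding ghost_def using assms by (subst add.finprod_Suc3) (auto simp: Witt_carrier)

lemma Witt_closed:
  assumes "x \<in> carrier (Witt p R)" "y \<in> carrier (Witt p R)"
  shows "x \<oplus>\<^bsub>Witt p R\<^esub> y \<in> carrier (Witt p R)" "x \<otimes>\<^bsub>Witt p R\<^esub> y \<in> carrier (Witt p R)"
proof -
  have xy: "\<And>v. case_sum x y v \<in> carrier R"
    using assms by (auto simp: Witt_carrier split: sum.split)
  show "x \<oplus>\<^bsub>Witt p R\<^esub> y \<in> carrier (Witt p R)" "x \<otimes>\<^bsub>Witt p R\<^esub> y \<in> carrier (Witt p R)"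
    by (simp_all add: Witt_ops zpoly_eval_closed[OF xy], simp_all add: Witt_carrier zpoly_eval_closed[OF xy])
qed

context
  fixes p :: nat
  assumes p: "prime p"
begin

text \<open>This is the defining identity of \<open>witt_sum\<close> and \<open>witt_prod\<close>
  evaluated at the components, so it holds over every commutative ring, also with p-torsion.\<close>

lemma ghost_hom: "ghost R p n \<in> ring_hom (Witt p R) R"
proof (rule ring_hom_memI)
  fix x y assume x: "x \<in> carrier (Witt p R)" and y: "y \<in> carrier (Witt p R)"
  have xy: "\<And>v. case_sum x y v \<in> carrier R"
    using x y by (auto simp: Witt_carrier split: sum.split)
  have X: "zpoly_eval R (case_sum x y) (witt_ghost p n (\<lambda>i. zvar (Inl i))) = ghost R p n x"
    "zpoly_eval R (case_sum x y) (witt_ghost p n (\<lambda>i. zvar (Inr i))) = ghost R p n y"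
    by (simp_all add: zpoly_eval_ghost[OF xy] zpoly_eval_var[OF xy])
  show "ghost R p n (x \<otimes>\<^bsub>Witt p R\<^esub> y) = ghost R p n x \<otimes> ghost R p n y"
    unfolding Witt_ops zpoly_eval_ghost[OF xy, symmetric]
    by (simp add: witt_ghost_prod[OF p] zpoly_eval_mult[OF xy] X)
  show "ghost R p n (x \<oplus>\<^bsub>Witt p R\<^esub> y) = ghost R p n x \<oplus> ghost R p n y"
    unfolding Witt_ops zpoly_eval_ghost[OF xy, symmetric]
    by (simp add: witt_ghost_sum[OF p] zpoly_eval_add[OF xy] X)
next
  show "ghost R p n \<one>\<^bsub>Witt p R\<^esub> = \<one>"
    using p by (simp add: Witt_ops ghost_teich prime_gt_0_nat)
qed simp

context
  assumes torsion_free: "\<And>a. a \<in> carrier R \<Longrightarrow> [p] \<cdot> a = \<zero> \<Longrightarrow> a = \<zero>"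
begin

lemma prime_power_torsion_free:
  assumes "a \<in> carrier R" "[(p ^ n)] \<cdot> a = \<zero>"
  shows "a = \<zero>"
  using assms(2)
proof (induction n)
  case 0
  then show ?case using assms(1) by simp
next
  case (Suc n)
  have "[p] \<cdot> ([(p ^ n)] \<cdot> a) = \<zero>"
    using Suc(2) assms(1) by (simp add: add.nat_pow_pow mult.commute)
  then have "[(p ^ n)] \<cdot> a = \<zero>" using torsion_free assms(1) by simp
  then show ?case by (rule Suc(1))
qed

text \<open>The induction of \<open>witt_ghost_inj\<close>, with torsion-freeness now a property of
  R. Together with \<open>ghost_hom\<close> it reduces identities between Witt vectors to identities
  in R.\<close>

lemma ghost_inj:
  assumes x: "x \<in> carrier (Witt p R)" and y: "y \<in> carrier (Witt p R)"
    and eq: "\<And>n. ghost R p n x = ghost R p n y"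
  shows "x = y"
proof
  fix n show "x n = y n"
  proof (induction n rule: less_induct)
    case (less n)
    have xy: "\<And>i. x i \<in> carrier R" "\<And>i. y i \<in> carrier R" using x y by (auto simp: Witt_carrier)
    define s where "s = (\<Oplus>i\<in>{..<n}. [(p ^ i)] \<cdot> (x i [^] (p ^ (n - i))))"
    have s: "s \<in> carrier R" using xy by (auto simp: s_def intro!: finsum_closed)
    have "(\<Oplus>i\<in>{..<n}. [(p ^ i)] \<cdot> (y i [^] (p ^ (n - i)))) = s"
      unfolding s_def by (rule finsum_cong') (use less xy in auto)
    then have "[(p ^ n)] \<cdot> x n \<oplus> s = [(p ^ n)] \<cdot> y n \<oplus> s"
      using eq[of n] ghost_split[OF x, of n] ghost_split[OF y, of n] by (simp add: s_def)
    then have "[(p ^ n)] \<cdot> x n = [(p ^ n)] \<cdot> y n"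
      using s xy by simp
    then have "[(p ^ n)] \<cdot> x n \<ominus> [(p ^ n)] \<cdot> y n = \<zero>"
      using xy by (simp add: minus_eq_zero_iff)
    then have "[(p ^ n)] \<cdot> (x n \<ominus> y n) = \<zero>"
      using xy by (simp add: a_minus_def add.nat_pow_distrib add.nat_pow_inv)
    then have "x n \<ominus> y n = \<zero>"
      using prime_power_torsion_free xy by simp
    then show ?case using xy by (simp add: minus_eq_zero_iff)
  qed
qed

lemma Witt_cring: "cring (Witt p R)"
proof -
  note G = ring_hom_add[OF ghost_hom] ring_hom_mult[OF ghost_hom] ring_hom_one[OF ghost_hom]
    ghost_zero[OF prime_gt_0_nat[OF p]]
  have zero: "\<zero>\<^bsub>Witt p R\<^esub> \<in> carrier (Witt p R)" and one: "\<one>\<^bsub>Witt p R\<^esub> \<in> carrier (Witt p R)"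
    by (simp_all add: Witt_ops) (simp add: Witt_carrier)
  note closed = Witt_closed zero one
  show ?thesis
  proof (rule cringI)
    show "abelian_group (Witt p R)"
    proof (rule abelian_groupI)
      fix x assume x: "x \<in> carrier (Witt p R)"
      then have x': "\<And>i. x i \<in> carrier R" by (simp add: Witt_carrier)
      obtain N :: "nat \<Rightarrow> nat zpoly" where N: "\<And>n. witt_ghost p n N = - witt_ghost p n zvar"
        using witt_neg_exists[OF p] by blast
      define y where "y = (\<lambda>i. zpoly_eval R x (N i))"
      have y: "y \<in> carrier (Witt p R)"
        by (simp add: Witt_carrier y_def zpoly_eval_closed[OF x'])
      have "ghost R p n y = \<ominus> ghost R p n x" for n
        using zpoly_eval_ghost[where x = x and p = p and n = n and S = N] zpoly_eval_ghost[where x = x and p = p and n = n and S = zvar] x'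
        by (simp add: N zpoly_eval_uminus[OF x'] zpoly_eval_var[OF x'] y_def)
      then have "y \<oplus>\<^bsub>Witt p R\<^esub> x = \<zero>\<^bsub>Witt p R\<^esub>"
        using x y closed by (intro ghost_inj) (simp_all add: G l_neg)
      then show "\<exists>y\<in>carrier (Witt p R). y \<oplus>\<^bsub>Witt p R\<^esub> x = \<zero>\<^bsub>Witt p R\<^esub>"
        using y by blast
    qed (use closed in \<open>auto intro!: ghost_inj simp: G a_ac\<close>)
    show "comm_monoid (Witt p R)"
      by (rule comm_monoidI) (use closed in \<open>auto intro!: ghost_inj simp: G m_ac\<close>)
  qed (use closed in \<open>auto intro!: ghost_inj simp: G l_distr\<close>)
qed

lemma teich_mult:
  assumes "a \<in> carrier R" "b \<in> carrier R"
  shows "teich R a \<otimes>\<^bsub>Witt p R\<^esub> teich R b = teich R (a \<otimes> b)"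
  using assms prime_gt_0_nat[OF p] Witt_closed
  by (intro ghost_inj) (simp_all add: ring_hom_mult[OF ghost_hom] ghost_teich nat_pow_distrib)

lemma teich_power:
  assumes "a \<in> carrier R"
  shows "teich R a [^]\<^bsub>Witt p R\<^esub> (k::nat) = teich R (a [^] k)"
  using assms by (induction k) (simp_all add: Witt_ops(4) teich_mult)

end

end

end

lemma Witt_map_hom:
  assumes "cring R" "cring S" "h \<in> ring_hom R S"
  shows "(\<lambda>x. h \<circ> x) \<in> ring_hom (Witt p R) (Witt p S)"
proof (rule ring_hom_memI)
  interpret ring_hom_cring R S h
    using assms by (simp add: ring_hom_cring_def ring_hom_cring_axioms_def)
  fix x y assume xy: "x \<in> carrier (Witt p R)" "y \<in> carrier (Witt p R)"
  then have "\<And>v. case_sum x y v \<in> carrier R"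
    by (auto simp: Witt_carrier split: sum.split)
  note hom = zpoly_eval_hom[OF assms this]
  have "(\<lambda>v. h (case_sum x y v)) = case_sum (h \<circ> x) (h \<circ> y)"
    by (auto split: sum.split)
  then show "h \<circ> (x \<otimes>\<^bsub>Witt p R\<^esub> y) = (h \<circ> x) \<otimes>\<^bsub>Witt p S\<^esub> (h \<circ> y)"
    "h \<circ> (x \<oplus>\<^bsub>Witt p R\<^esub> y) = (h \<circ> x) \<oplus>\<^bsub>Witt p S\<^esub> (h \<circ> y)"
    by (simp_all add: Witt_ops fun_eq_iff hom)
next
  interpret ring_hom_cring R S h
    using assms by (simp add: ring_hom_cring_def ring_hom_cring_axioms_def)
  show "h \<circ> \<one>\<^bsub>Witt p R\<^esub> = \<one>\<^bsub>Witt p S\<^esub>"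
    by (simp add: Witt_ops teich_def fun_eq_iff)
qed (use assms(3) in \<open>auto simp: Witt_carrier ring_hom_closed\<close>)

lemma Witt_map_teich:
  assumes "cring R" "cring S" "h \<in> ring_hom R S"
  shows "h \<circ> teich R a = teich S (h a)"
  using ring_hom_zero[OF assms(3)] assms(1,2) by (auto simp: teich_def cring_def)

text \<open>This provides the ring of Witt vectors over the finite quotients, which have p-torsion,
  so that \<open>ghost_inj\<close> fails for them. Components lift one at a time, so surjectivity
  passes to Witt vectors.\<close>

lemma Witt_cring_surj:
  assumes "cring R" "cring S" "h \<in> ring_hom R S" "h ` carrier R = carrier S" "cring (Witt p R)"
  shows "cring (Witt p S)"
proof (rule cring_surj_image[OF assms(5) Witt_map_hom[OF assms(1-3)]])
  show "(\<lambda>x. h \<circ> x) ` carrier (Witt p R) = carrier (Witt p S)"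
  proof (intro equalityI subsetI)
    fix y assume "y \<in> carrier (Witt p S)"
    then have "\<And>i. \<exists>a\<in>carrier R. h a = y i"
      using assms(4) by (metis Witt_carrier imageE)
    then obtain x where "\<And>i. x i \<in> carrier R \<and> h (x i) = y i" by metis
    then show "y \<in> (\<lambda>x. h \<circ> x) ` carrier (Witt p R)"
      by (intro image_eqI[of _ _ x]) (auto simp: Witt_carrier)
  qed (use assms(3) in \<open>auto simp: Witt_carrier ring_hom_closed\<close>)
  show "h \<circ> \<zero>\<^bsub>Witt p R\<^esub> = \<zero>\<^bsub>Witt p S\<^esub>"
    using ring_hom_zero[OF assms(3)] assms(1,2) by (simp add: Witt_ops cring_def fun_eq_iff)
qed

section \<open>Congruences between Witt vectors over the base\<close>

context cring
begin

lemma geometric_sum: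
  assumes x: "x \<in> carrier R"
  shows "(\<Oplus>i\<in>{..<n::nat}. x [^] i) \<otimes> (x \<ominus> \<one>) = x [^] n \<ominus> \<one>"
proof (induction n)
  case 0
  show ?case using x by (simp add: a_minus_def r_neg)
next
  case (Suc n)
  let ?s = "\<Oplus>i\<in>{..<n}. x [^] i"
  have s: "?s \<in> carrier R" and xn: "x [^] n \<in> carrier R" using x by auto
  have "(\<Oplus>i\<in>{..<Suc n}. x [^] i) = x [^] n \<oplus> ?s"
    unfolding lessThan_Suc using x by (intro finsum_insert) auto
  moreover have "(x [^] n \<oplus> ?s) \<otimes> (x \<ominus> \<one>) = x [^] n \<otimes> (x \<ominus> \<one>) \<oplus> ?s \<otimes> (x \<ominus> \<one>)"
    using s xn x by (intro l_distr) auto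
  moreover have "x [^] n \<otimes> (x \<ominus> \<one>) \<oplus> (x [^] n \<ominus> \<one>) = x [^] n \<otimes> x \<ominus> \<one>"
    using xn x by algebra
  ultimately show ?case using Suc by simp
qed

lemma cyclo_mult: "x \<in> carrier R \<Longrightarrow> cyclo p R x \<otimes> (x \<ominus> \<one>) = x [^] p \<ominus> \<one>"
  unfolding cyclo_def by (rule geometric_sum)

lemma cyclo_closed [simp]: "x \<in> carrier R \<Longrightarrow> cyclo p R x \<in> carrier R"
  by (auto simp: cyclo_def)

lemma cyclo_one: "cyclo p R \<one> = [p] \<cdot> \<one>"
proof -
  have "cyclo p R \<one> = (\<Oplus>i\<in>{..<p}. \<one>)"
    unfolding cyclo_def by (rule finsum_cong') auto
  then show ?thesis using add.finprod_const[of \<one> "{..<p}"] by simp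
qed

text \<open>The binomial theorem in the form that serves twice: for q^m over Z_p, and for (1 + (q -
  1) z)^m over a quotient.\<close>

lemma ps_one_plus_monom_power:
  assumes c: "c \<in> carrier R"
  shows "((\<one>\<^bsub>ps R\<^esub> \<oplus>\<^bsub>ps R\<^esub> ps_monom R c 1) [^]\<^bsub>ps R\<^esub> m) k = [(m choose k)] \<cdot> (c [^] k)"
proof (induction m arbitrary: k)
  case 0
  show ?case by (cases k) (simp_all add: ps_one)
next
  case (Suc m)
  interpret P: cring "ps R" by (rule ps_cring)
  let ?P = "\<one>\<^bsub>ps R\<^esub> \<oplus>\<^bsub>ps R\<^esub> ps_monom R c 1"
  have P: "?P \<in> carrier (ps R)" and Pm: "?P [^]\<^bsub>ps R\<^esub> m \<in> carrier (ps R)" using c by auto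
  have "?P [^]\<^bsub>ps R\<^esub> Suc m = ?P [^]\<^bsub>ps R\<^esub> m \<oplus>\<^bsub>ps R\<^esub> ps_monom R c 1 \<otimes>\<^bsub>ps R\<^esub> ?P [^]\<^bsub>ps R\<^esub> m"
  proof -
    have "Q \<otimes>\<^bsub>ps R\<^esub> (\<one>\<^bsub>ps R\<^esub> \<oplus>\<^bsub>ps R\<^esub> X) = Q \<oplus>\<^bsub>ps R\<^esub> X \<otimes>\<^bsub>ps R\<^esub> Q"
      if "Q \<in> carrier (ps R)" "X \<in> carrier (ps R)" for Q X
      using that by (simp add: P.r_distr P.m_comm)
    from this[OF Pm, of "ps_monom R c 1"] show ?thesis using c by simp
  qed
  then have "(?P [^]\<^bsub>ps R\<^esub> Suc m) k =
      [(m choose k)] \<cdot> (c [^] k) \<oplus> (if k < 1 then \<zero> else c \<otimes> ([(m choose (k - 1))] \<cdot> (c [^] (k - 1))))"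
    unfolding Suc.IH[symmetric]
    by (simp only: ps_add[of R "_ [^]\<^bsub>ps R\<^esub> m"] ps_monom_mult[OF c Pm])
  also have "\<dots> = [(Suc m choose k)] \<cdot> (c [^] k)"
  proof (cases k)
    case (Suc k')
    then show ?thesis
      using c by (simp add: add_pow_rdistr add.nat_pow_mult m_comm a_comm)
  qed (use c in simp)
  finally show ?case .
qed

end

lemma cyclo_hom:
  assumes "cring R" "cring S" "h \<in> ring_hom R S" "x \<in> carrier R"
  shows "h (cyclo p R x) = cyclo p S (h x)"
proof -
  interpret ring_hom_cring R S h
    using assms by (simp add: ring_hom_cring_def ring_hom_cring_axioms_def)
  have pow: "h (x [^]\<^bsub>R\<^esub> i) = h x [^]\<^bsub>S\<^esub> i" for i :: nat
    by (induction i) (use assms(4) in simp_all)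
  have "h (cyclo p R x) = (\<Oplus>\<^bsub>S\<^esub>i\<in>{..<p}. (h \<circ> (\<lambda>i. x [^]\<^bsub>R\<^esub> i)) i)"
    unfolding cyclo_def using assms(4) by (intro hom_finsum) auto
  also have "\<dots> = cyclo p S (h x)"
    unfolding cyclo_def using assms(4) by (intro S.finsum_cong') (auto simp: pow)
  finally show ?thesis .
qed

section \<open>The filtration of Z_p[[q - 1]] by powers of p, modulo a power of q - 1\<close>

locale prime_base =
  fixes p :: nat
  assumes p: "prime p"
begin

lemma p_gt_0: "p > 0"
  using p by (rule prime_gt_0_nat)

sublocale Z: cring "Zp p"
  using p_gt_0 by (rule Zp_cring)

sublocale O: cring "OQ p"
  by (rule Z.ps_cring)

lemma OQ_torsion_free:
  assumes "a \<in> carrier (OQ p)" "[p] \<cdot>\<^bsub>OQ p\<^esub> a = \<zero>\<^bsub>OQ p\<^esub>"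
  shows "a = \<zero>\<^bsub>OQ p\<^esub>"
proof
  fix k
  have "[p] \<cdot>\<^bsub>Zp p\<^esub> a k = \<zero>\<^bsub>Zp p\<^esub>"
    using Z.ps_coeff_add_pow[OF assms(1), of p k] assms(2) by (simp add: ps_zero)
  then show "a k = \<zero>\<^bsub>OQ p\<^esub> k"
    using Zp_torsion_free[OF p p_gt_0] assms(1) by (simp add: ps_zero ps_carrier)
qed

sublocale W: cring "Witt p (OQ p)"
  using p OQ_torsion_free by (rule O.Witt_cring)

text \<open>For a p-adic integer, \<open>a l = 0\<close> says that p^l divides it. The lemmas on
  levels are the rules for this valuation.\<close>

lemma Zp_level_antimono: "a \<in> carrier (Zp p) \<Longrightarrow> a l = 0 \<Longrightarrow> k \<le> l \<Longrightarrow> a k = 0"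
  using Zp_mod[of a p k l] by simp

lemma Zp_level_dvd: "a \<in> carrier (Zp p) \<Longrightarrow> k \<le> l \<Longrightarrow> a k = 0 \<longleftrightarrow> int p ^ k dvd a l"
  using Zp_mod[of a p k l] by (auto simp: dvd_eq_mod_eq_0)

lemma Zp_level_mult:
  assumes "a \<in> carrier (Zp p)" "b \<in> carrier (Zp p)" "a c = 0" "b d = 0"
  shows "(a \<otimes>\<^bsub>Zp p\<^esub> b) (c + d) = 0"
proof -
  have "int p ^ c dvd a (c + d)" "int p ^ d dvd b (c + d)"
    using assms by (simp_all flip: Zp_level_dvd)
  then have "int p ^ (c + d) dvd a (c + d) * b (c + d)"
    unfolding power_add by (rule mult_dvd_mono)
  then show ?thesis by (simp add: Zp_ops dvd_eq_mod_eq_0)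
qed

lemma Zp_level_0: "a \<in> carrier (Zp p) \<Longrightarrow> a 0 = 0"
  using Zp_carrierD[of a p 0] by simp

text \<open>Deliberately an equivalence: reading it backwards divides by p^k with a loss of exactly
  k levels.\<close>

lemma Zp_level_add_pow:
  assumes "a \<in> carrier (Zp p)"
  shows "([(p ^ k)] \<cdot>\<^bsub>Zp p\<^esub> a) (c + k) = 0 \<longleftrightarrow> a c = 0"
proof -
  have "([(p ^ k)] \<cdot>\<^bsub>Zp p\<^esub> a) (c + k) = 0 \<longleftrightarrow> int p ^ k * int p ^ c dvd int p ^ k * a (c + k)"
    using assms by (simp add: Zp_add_pow[OF p_gt_0] power_add mult.commute dvd_eq_mod_eq_0)
  also have "\<dots> \<longleftrightarrow> int p ^ c dvd a (c + k)"
    using p_gt_0 by simp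
  finally show ?thesis using assms by (simp flip: Zp_level_dvd)
qed

lemma Zp_level_finsum:
  assumes "\<And>i. i \<in> A \<Longrightarrow> f i \<in> carrier (Zp p)" "\<And>i. i \<in> A \<Longrightarrow> f i l = 0"
  shows "(\<Oplus>\<^bsub>Zp p\<^esub>i\<in>A. f i) l = 0"
  using assms
proof (induction A rule: infinite_finite_induct)
  case (insert x A)
  then have "(\<Oplus>\<^bsub>Zp p\<^esub>i\<in>insert x A. f i) = f x \<oplus>\<^bsub>Zp p\<^esub> (\<Oplus>\<^bsub>Zp p\<^esub>i\<in>A. f i)"
    by (intro Z.finsum_insert) auto
  then show ?case using insert by (simp add: Zp_ops)
qed (simp_all add: Zp_ops)

text \<open>The ideal \<open>(p ^ c, (q - 1) ^ M)\<close> of \<open>OQ p\<close>.\<close>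
definition J :: "nat \<Rightarrow> nat \<Rightarrow> (nat \<Rightarrow> nat \<Rightarrow> int) set" where
  "J M c = {f \<in> carrier (OQ p). \<forall>j<M. f j c = 0}"

lemma J_closed: "f \<in> J M c \<Longrightarrow> f \<in> carrier (OQ p)"
  by (simp add: J_def)

lemma J_0: "f \<in> carrier (OQ p) \<Longrightarrow> f \<in> J M 0"
  by (simp add: J_def ps_carrier Zp_level_0)

lemma J_antimono: "f \<in> J M l \<Longrightarrow> k \<le> l \<Longrightarrow> f \<in> J M k"
  by (auto simp: J_def ps_carrier intro: Zp_level_antimono)

lemma J_add: "f \<in> J M c \<Longrightarrow> g \<in> J M c \<Longrightarrow> f \<oplus>\<^bsub>OQ p\<^esub> g \<in> J M c"
  by (simp add: J_def ps_add Zp_ops)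

lemma J_minus: "f \<in> J M c \<Longrightarrow> g \<in> J M c \<Longrightarrow> f \<ominus>\<^bsub>OQ p\<^esub> g \<in> J M c"
  by (simp add: J_def Z.ps_minus Zp_minus[OF p_gt_0] ps_carrier)

lemma J_zero: "\<zero>\<^bsub>OQ p\<^esub> \<in> J M c"
  by (simp add: J_def ps_zero Zp_ops)

text \<open>For fixed M the exponents of p add, because coefficients below M of a product involve
  only coefficients below M of the factors.\<close>

lemma J_mult:
  assumes "f \<in> J M c" "g \<in> J M d"
  shows "f \<otimes>\<^bsub>OQ p\<^esub> g \<in> J M (c + d)"
proof -
  have "(f \<otimes>\<^bsub>OQ p\<^esub> g) j (c + d) = 0" if "j < M" for j
    unfolding ps_mult using assms that
    by (intro Zp_level_finsum Zp_level_mult) (auto simp: J_def ps_carrier)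
  then show ?thesis using assms by (simp add: J_def)
qed

lemma J_mult_left: "f \<in> J M c \<Longrightarrow> g \<in> carrier (OQ p) \<Longrightarrow> f \<otimes>\<^bsub>OQ p\<^esub> g \<in> J M c"
  using J_mult[of f M c g 0] by (simp add: J_0)

lemma J_add_pow:
  assumes "f \<in> carrier (OQ p)"
  shows "[(p ^ k)] \<cdot>\<^bsub>OQ p\<^esub> f \<in> J M (c + k) \<longleftrightarrow> f \<in> J M c"
  using assms by (simp add: J_def Z.ps_coeff_add_pow Zp_level_add_pow ps_carrier)

lemma J_finsum_minus:
  assumes "finite A" "\<And>i. i \<in> A \<Longrightarrow> f i \<in> carrier (OQ p)" "\<And>i. i \<in> A \<Longrightarrow> g i \<in> carrier (OQ p)"
    "\<And>i. i \<in> A \<Longrightarrow> f i \<ominus>\<^bsub>OQ p\<^esub> g i \<in> J M c"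
  shows "(\<Oplus>\<^bsub>OQ p\<^esub>i\<in>A. f i) \<ominus>\<^bsub>OQ p\<^esub> (\<Oplus>\<^bsub>OQ p\<^esub>i\<in>A. g i) \<in> J M c"
  using assms
proof (induction A)
  case empty
  show ?case by (simp add: a_minus_def O.r_neg J_zero)
next
  case (insert x A)
  let ?f = "\<Oplus>\<^bsub>OQ p\<^esub>i\<in>A. f i" and ?g = "\<Oplus>\<^bsub>OQ p\<^esub>i\<in>A. g i"
  have c: "?f \<in> carrier (OQ p)" "?g \<in> carrier (OQ p)" "f x \<in> carrier (OQ p)" "g x \<in> carrier (OQ p)"
    using insert by auto
  have "(\<Oplus>\<^bsub>OQ p\<^esub>i\<in>insert x A. f i) = f x \<oplus>\<^bsub>OQ p\<^esub> ?f" "(\<Oplus>\<^bsub>OQ p\<^esub>i\<in>insert x A. g i) = g x \<oplus>\<^bsub>OQ p\<^esub> ?g"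
    using insert by (auto intro!: O.finsum_insert)
  moreover have "(f x \<oplus>\<^bsub>OQ p\<^esub> ?f) \<ominus>\<^bsub>OQ p\<^esub> (g x \<oplus>\<^bsub>OQ p\<^esub> ?g) =
      (f x \<ominus>\<^bsub>OQ p\<^esub> g x) \<oplus>\<^bsub>OQ p\<^esub> (?f \<ominus>\<^bsub>OQ p\<^esub> ?g)"
    using c by algebra
  ultimately show ?case using insert by (simp add: J_add)
qed

text \<open>The argument of \<open>power_prime_power_dvd_diff\<close> for the filtration
  \<open>J M\<close>, where smallness means divisibility by p only modulo (q - 1)^M.\<close>

lemma J_prime_power_diff:
  assumes "f \<in> carrier (OQ p)" "g \<in> carrier (OQ p)" "f \<ominus>\<^bsub>OQ p\<^esub> g \<in> J M c" "c \<ge> 1"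
  shows "f [^]\<^bsub>OQ p\<^esub> (p ^ k) \<ominus>\<^bsub>OQ p\<^esub> g [^]\<^bsub>OQ p\<^esub> (p ^ k) \<in> J M (c + k)"
proof (induction k)
  case 0
  then show ?case using assms by simp
next
  case (Suc k)
  define a where "a = f [^]\<^bsub>OQ p\<^esub> (p ^ k)"
  define b where "b = g [^]\<^bsub>OQ p\<^esub> (p ^ k)"
  define d where "d = a \<ominus>\<^bsub>OQ p\<^esub> b"
  have d: "d \<in> J M (c + k)" using Suc by (simp add: d_def a_def b_def)
  have carr: "a \<in> carrier (OQ p)" "b \<in> carrier (OQ p)" "d \<in> carrier (OQ p)"
    using assms(1,2) by (auto simp: a_def b_def d_def)
  \<comment> \<open>\<open>binomial_prime_power\<close> lives in type-class rings. It is applied to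
    two polynomial variables, which are then evaluated at b and d.\<close>
  define v where "v i = (if i = (0::nat) then b else d)" for i
  have v: "\<And>i. v i \<in> carrier (OQ p)" and v01: "v 0 = b" "v 1 = d"
    using carr by (simp_all add: v_def)
  obtain r where "(zvar 0 + zvar 1) ^ p = zvar 0 ^ p + of_nat p * (zvar 1 * r) + (zvar 1 ^ p :: nat zpoly)"
    using binomial_prime_power[OF p] by blast
  then have "zpoly_eval (OQ p) v ((zvar 0 + zvar 1) ^ p) =
      zpoly_eval (OQ p) v (zvar 0 ^ p + of_nat p * (zvar 1 * r) + zvar 1 ^ p)"
    by (rule arg_cong)
  moreover define s where "s = zpoly_eval (OQ p) v r"
  moreover have s: "s \<in> carrier (OQ p)" by (simp add: s_def O.zpoly_eval_closed[OF v])
  ultimately have "(b \<oplus>\<^bsub>OQ p\<^esub> d) [^]\<^bsub>OQ p\<^esub> p =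
      b [^]\<^bsub>OQ p\<^esub> p \<oplus>\<^bsub>OQ p\<^esub> [p] \<cdot>\<^bsub>OQ p\<^esub> (d \<otimes>\<^bsub>OQ p\<^esub> s) \<oplus>\<^bsub>OQ p\<^esub> d [^]\<^bsub>OQ p\<^esub> p"
    by (simp only: O.zpoly_eval_add[OF v] O.zpoly_eval_power[OF v] O.zpoly_eval_of_nat_mult[OF v])
      (simp only: O.zpoly_eval_mult[OF v] O.zpoly_eval_var[OF v] v01)
  moreover have "b \<oplus>\<^bsub>OQ p\<^esub> d = a" unfolding d_def using carr(1,2) by algebra
  moreover define t where "t = [p] \<cdot>\<^bsub>OQ p\<^esub> (d \<otimes>\<^bsub>OQ p\<^esub> s)"
  moreover have "t \<in> carrier (OQ p)" "a [^]\<^bsub>OQ p\<^esub> p \<in> carrier (OQ p)"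
    "b [^]\<^bsub>OQ p\<^esub> p \<in> carrier (OQ p)" "d [^]\<^bsub>OQ p\<^esub> p \<in> carrier (OQ p)"
    using carr s by (auto simp: t_def)
  ultimately have "a [^]\<^bsub>OQ p\<^esub> p \<ominus>\<^bsub>OQ p\<^esub> b [^]\<^bsub>OQ p\<^esub> p = t \<oplus>\<^bsub>OQ p\<^esub> d [^]\<^bsub>OQ p\<^esub> p"
    by (simp only:) algebra
  moreover have "t \<in> J M (c + k + 1)"
    using J_add_pow[of "d \<otimes>\<^bsub>OQ p\<^esub> s" 1 M "c + k"] J_mult_left[OF d s] carr s by (simp add: t_def)
  \<comment> \<open>Since p >= 2 it suffices to use d^2, which has level 2 (c + k). This exceeds c +
    k because c >= 1.\<close>
  moreover have "d [^]\<^bsub>OQ p\<^esub> p \<in> J M (c + k + 1)"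
  proof -
    obtain e where e: "p = Suc (Suc e)"
      using prime_ge_2_nat[OF p] by (metis add_2_eq_Suc le_Suc_ex)
    have "(d \<otimes>\<^bsub>OQ p\<^esub> d) \<otimes>\<^bsub>OQ p\<^esub> d [^]\<^bsub>OQ p\<^esub> e \<in> J M ((c + k) + (c + k))"
      using carr by (intro J_mult_left J_mult d) auto
    moreover have "d [^]\<^bsub>OQ p\<^esub> Suc (Suc e) = (d \<otimes>\<^bsub>OQ p\<^esub> d) \<otimes>\<^bsub>OQ p\<^esub> d [^]\<^bsub>OQ p\<^esub> e"
      using carr by (simp add: O.m_ac)
    ultimately have "d [^]\<^bsub>OQ p\<^esub> p \<in> J M ((c + k) + (c + k))"
      unfolding e by simp
    then show ?thesis by (rule J_antimono) (use assms(4) in simp)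
  qed
  ultimately have "a [^]\<^bsub>OQ p\<^esub> p \<ominus>\<^bsub>OQ p\<^esub> b [^]\<^bsub>OQ p\<^esub> p \<in> J M (c + Suc k)"
    using J_add by simp
  then show ?case
    using assms(1,2) by (simp add: a_def b_def O.nat_pow_pow mult.commute)
qed

text \<open>
  Since \<open>g\<close> is congruent to \<open>p\<close> modulo \<open>q - 1\<close>, each of the \<open>M\<close> coefficients of \<open>f\<close> that matter
  loses at most one power of \<open>p\<close>.
\<close>
lemma J_cancel:
  assumes g: "g \<in> carrier (OQ p)" "g 0 = [p] \<cdot>\<^bsub>Zp p\<^esub> \<one>\<^bsub>Zp p\<^esub>" and f: "f \<in> carrier (OQ p)"
    and gf: "g \<otimes>\<^bsub>OQ p\<^esub> f \<in> J M (c + M)"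
  shows "f \<in> J M c"
proof -
  have carr: "\<And>i. f i \<in> carrier (Zp p)" "\<And>i. g i \<in> carrier (Zp p)"
    using f g by (simp_all add: ps_carrier)
  \<comment> \<open>The exponent falls by one with each index, so the earlier coefficients are known
    one level deeper than is claimed for f j. That extra level pays for dividing by the constant
    term p of g.\<close>
  have level: "f j (c + (M - 1 - j)) = 0" if "j < M" for j
    using that
  proof (induction j rule: less_induct)
    case (less j)
    define l where "l = c + (M - 1 - j)"
    define s where "s = (\<Oplus>\<^bsub>Zp p\<^esub>i\<in>{..<j}. f i \<otimes>\<^bsub>Zp p\<^esub> g (j - i))"
    have s: "s \<in> carrier (Zp p)" using carr by (auto simp: s_def)
    have "s (l + 1) = 0"
      unfolding s_def
    proof (rule Zp_level_finsum)
      fix i assume "i \<in> {..<j}"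
      then have i: "i < j" by simp
      have "f i (l + 1) = 0"
        by (rule Zp_level_antimono[OF carr(1) less.IH[OF i]]) (use i less.prems in \<open>auto simp: l_def\<close>)
      then show "(f i \<otimes>\<^bsub>Zp p\<^esub> g (j - i)) (l + 1) = 0"
        by (simp add: Zp_ops)
    qed (use carr in simp)
    moreover have "(f \<otimes>\<^bsub>OQ p\<^esub> g) j = f j \<otimes>\<^bsub>Zp p\<^esub> g 0 \<oplus>\<^bsub>Zp p\<^esub> s"
      unfolding ps_mult s_def using carr by (subst Z.add.finprod_Suc3) auto
    moreover have "(f \<otimes>\<^bsub>OQ p\<^esub> g) j (l + 1) = 0"
      using Zp_level_antimono[of "(f \<otimes>\<^bsub>OQ p\<^esub> g) j" "c + M" "l + 1"] gf less.prems f g(1) O.m_comm[OF f g(1)]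
        J_closed[OF gf]
      by (auto simp: J_def l_def ps_carrier)
    ultimately have "(f j \<otimes>\<^bsub>Zp p\<^esub> g 0) (l + 1) = 0"
      by (simp add: Zp_ops)
    moreover have "f j \<otimes>\<^bsub>Zp p\<^esub> g 0 = [(p ^ 1)] \<cdot>\<^bsub>Zp p\<^esub> f j"
      using carr by (simp add: g(2) Z.add_pow_rdistr)
    ultimately have "f j l = 0"
      using Zp_level_add_pow[of "f j" 1 l] carr by simp
    then show ?case by (simp add: l_def)
  qed
  have "f j c = 0" if "j < M" for j
    by (rule Zp_level_antimono[OF carr(1) level[OF that]]) simp
  then show ?thesis using f by (simp add: J_def)
qed

text \<open>A quantitative form of \<open>ghost_inj\<close>. In the k-th ghost component the earlier
  terms agree to level c + k: the p^(k - i)-th power gains k - i and the weight p^i gains i. So p^k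
  (x k - y k) has level c + k, and dividing by p^k leaves c.\<close>

lemma J_ghost_imp_components:
  assumes x: "x \<in> carrier (Witt p (OQ p))" and y: "y \<in> carrier (Witt p (OQ p))" and "c \<ge> 1"
    and ghosts: "\<And>k. ghost (OQ p) p k x \<ominus>\<^bsub>OQ p\<^esub> ghost (OQ p) p k y \<in> J M (c + k)"
  shows "x k \<ominus>\<^bsub>OQ p\<^esub> y k \<in> J M c"
proof (induction k rule: less_induct)
  case (less k)
  have xy: "\<And>i. x i \<in> carrier (OQ p)" "\<And>i. y i \<in> carrier (OQ p)"
    using x y by (auto simp: Witt_carrier)
  let ?t = "\<lambda>x i. [(p ^ i)] \<cdot>\<^bsub>OQ p\<^esub> (x i [^]\<^bsub>OQ p\<^esub> (p ^ (k - i)))"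
  define s where "s = (\<Oplus>\<^bsub>OQ p\<^esub>i\<in>{..<k}. ?t x i)"
  define t where "t = (\<Oplus>\<^bsub>OQ p\<^esub>i\<in>{..<k}. ?t y i)"
  have st: "s \<in> carrier (OQ p)" "t \<in> carrier (OQ p)"
    using xy by (auto simp: s_def t_def)
  have "s \<ominus>\<^bsub>OQ p\<^esub> t \<in> J M (c + k)"
    unfolding s_def t_def
  proof (rule J_finsum_minus)
    fix i assume "i \<in> {..<k}"
    then have i: "i < k" by simp
    let ?a = "x i [^]\<^bsub>OQ p\<^esub> (p ^ (k - i))" and ?b = "y i [^]\<^bsub>OQ p\<^esub> (p ^ (k - i))"
    have "?a \<ominus>\<^bsub>OQ p\<^esub> ?b \<in> J M (c + (k - i))"
      using xy less i assms(3) by (intro J_prime_power_diff) auto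
    then have "[(p ^ i)] \<cdot>\<^bsub>OQ p\<^esub> (?a \<ominus>\<^bsub>OQ p\<^esub> ?b) \<in> J M (c + (k - i) + i)"
      using J_add_pow[of "?a \<ominus>\<^bsub>OQ p\<^esub> ?b" i M "c + (k - i)"] xy by simp
    then show "?t x i \<ominus>\<^bsub>OQ p\<^esub> ?t y i \<in> J M (c + k)"
      using i xy by (simp add: a_minus_def O.add.nat_pow_distrib O.add.nat_pow_inv)
  qed (use xy in auto)
  moreover have "[(p ^ k)] \<cdot>\<^bsub>OQ p\<^esub> (x k \<ominus>\<^bsub>OQ p\<^esub> y k) =
      (ghost (OQ p) p k x \<ominus>\<^bsub>OQ p\<^esub> ghost (OQ p) p k y) \<ominus>\<^bsub>OQ p\<^esub> (s \<ominus>\<^bsub>OQ p\<^esub> t)"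
  proof -
    have gx: "ghost (OQ p) p k x = [(p ^ k)] \<cdot>\<^bsub>OQ p\<^esub> x k \<oplus>\<^bsub>OQ p\<^esub> s"
      and gy: "ghost (OQ p) p k y = [(p ^ k)] \<cdot>\<^bsub>OQ p\<^esub> y k \<oplus>\<^bsub>OQ p\<^esub> t"
      using O.ghost_split[OF x, of k] O.ghost_split[OF y, of k] by (simp_all add: s_def t_def)
    have "[(p ^ k)] \<cdot>\<^bsub>OQ p\<^esub> (x k \<ominus>\<^bsub>OQ p\<^esub> y k) =
        [(p ^ k)] \<cdot>\<^bsub>OQ p\<^esub> x k \<ominus>\<^bsub>OQ p\<^esub> [(p ^ k)] \<cdot>\<^bsub>OQ p\<^esub> y k"
      using xy by (simp add: a_minus_def O.add.nat_pow_distrib O.add.nat_pow_inv)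
    moreover have "[(p ^ k)] \<cdot>\<^bsub>OQ p\<^esub> x k \<in> carrier (OQ p)" "[(p ^ k)] \<cdot>\<^bsub>OQ p\<^esub> y k \<in> carrier (OQ p)"
      using xy by auto
    ultimately show ?thesis unfolding gx gy using st by (simp only:) algebra
  qed
  ultimately have "[(p ^ k)] \<cdot>\<^bsub>OQ p\<^esub> (x k \<ominus>\<^bsub>OQ p\<^esub> y k) \<in> J M (c + k)"
    using ghosts[of k] J_minus by simp
  then show ?case using J_add_pow xy by simp
qed

end

section \<open>Powers of the section in the group scheme\<close>

text \<open>The index is shifted: this is the \<open>(m + 1)\<close>-th power of the section.\<close>
primrec G_power :: "nat \<Rightarrow> ('a, 'm) ring_scheme \<Rightarrow> 'a \<Rightarrow> nat \<Rightarrow> nat \<Rightarrow> 'a" where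
  "G_power p A q 0 = G_section p A q"
| "G_power p A q (Suc m) = G_op p A q (G_power p A q m) (G_section p A q)"

context cring
begin

lemma G_power_closed:
  assumes "cring (Witt p R)" and q: "q \<in> carrier R"
  shows "G_power p R q m \<in> carrier (Witt p R)"
proof -
  interpret W: cring "Witt p R" by fact
  show ?thesis
    using q by (induction m) (simp_all add: G_section_def G_op_def)
qed

text \<open>The map y |-> 1 + Phi_p([q]) y turns \<open>G_op\<close> into multiplication, and it
  sends the section to [q]^p because Phi_p([q]) ([q] - 1) = [q]^p - 1.\<close>

lemma one_plus_cyclo_G_power:
  assumes "cring (Witt p R)" and q: "q \<in> carrier R"
  shows "\<one>\<^bsub>Witt p R\<^esub> \<oplus>\<^bsub>Witt p R\<^esub> cyclo_teich p R q \<otimes>\<^bsub>Witt p R\<^esub> G_power p R q m =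
    teich R q [^]\<^bsub>Witt p R\<^esub> (p * Suc m)"
proof -
  interpret W: cring "Witt p R" by fact
  define T where "T = teich R q"
  define F where "F = cyclo p (Witt p R) T"
  define s where "s = G_section p R q"
  have T: "T \<in> carrier (Witt p R)" using q by (simp add: T_def)
  have F: "F \<in> carrier (Witt p R)" using T by (simp add: F_def)
  have s: "s \<in> carrier (Witt p R)" using T by (simp add: s_def G_section_def T_def)
  have Tp: "T [^]\<^bsub>Witt p R\<^esub> p \<in> carrier (Witt p R)" using T by simp
  have "F \<otimes>\<^bsub>Witt p R\<^esub> s = T [^]\<^bsub>Witt p R\<^esub> p \<ominus>\<^bsub>Witt p R\<^esub> \<one>\<^bsub>Witt p R\<^esub>"
    unfolding F_def s_def G_section_def T_def[symmetric] using T by (rule W.cyclo_mult)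
  then have base: "\<one>\<^bsub>Witt p R\<^esub> \<oplus>\<^bsub>Witt p R\<^esub> F \<otimes>\<^bsub>Witt p R\<^esub> s = T [^]\<^bsub>Witt p R\<^esub> p"
    using Tp by (simp only:) algebra
  have "\<one>\<^bsub>Witt p R\<^esub> \<oplus>\<^bsub>Witt p R\<^esub> F \<otimes>\<^bsub>Witt p R\<^esub> G_power p R q m = (T [^]\<^bsub>Witt p R\<^esub> p) [^]\<^bsub>Witt p R\<^esub> Suc m"
  proof (induction m)
    case 0
    show ?case using base Tp by (simp add: s_def)
  next
    case (Suc m)
    define y where "y = G_power p R q m"
    have y: "y \<in> carrier (Witt p R)" unfolding y_def by (rule G_power_closed[OF assms])
    have "\<one>\<^bsub>Witt p R\<^esub> \<oplus>\<^bsub>Witt p R\<^esub> F \<otimes>\<^bsub>Witt p R\<^esub> (y \<oplus>\<^bsub>Witt p R\<^esub> s \<oplus>\<^bsub>Witt p R\<^esub> F \<otimes>\<^bsub>Witt p R\<^esub> y \<otimes>\<^bsub>Witt p R\<^esub> s) =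
        (\<one>\<^bsub>Witt p R\<^esub> \<oplus>\<^bsub>Witt p R\<^esub> F \<otimes>\<^bsub>Witt p R\<^esub> y) \<otimes>\<^bsub>Witt p R\<^esub> (\<one>\<^bsub>Witt p R\<^esub> \<oplus>\<^bsub>Witt p R\<^esub> F \<otimes>\<^bsub>Witt p R\<^esub> s)"
      using F s y by algebra
    then show ?case
      using Suc base by (simp add: G_op_def y_def s_def F_def T_def)
  qed
  then show ?thesis
    using T by (simp only: W.nat_pow_pow F_def T_def)
qed

lemma ps_finsum_coeff:
  assumes "finite A" "\<And>i. i \<in> A \<Longrightarrow> f i \<in> carrier (ps R)"
  shows "(\<Oplus>\<^bsub>ps R\<^esub>i\<in>A. f i) k = (\<Oplus>i\<in>A. f i k)"
  using assms
proof (induction A)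
  interpret P: cring "ps R" by (rule ps_cring)
  case (insert x A)
  then have "(\<Oplus>\<^bsub>ps R\<^esub>i\<in>insert x A. f i) = f x \<oplus>\<^bsub>ps R\<^esub> (\<Oplus>\<^bsub>ps R\<^esub>i\<in>A. f i)"
    by (intro P.finsum_insert) auto
  moreover have "(\<Oplus>i\<in>insert x A. f i k) = f x k \<oplus> (\<Oplus>i\<in>A. f i k)"
    using insert by (intro finsum_insert) (auto simp: ps_carrier)
  ultimately show ?case using insert by (simp add: ps_add)
next
  interpret P: cring "ps R" by (rule ps_cring)
  case empty
  show ?case by (simp add: ps_zero)
qed

text \<open>Composing a linear series with g exposes the coefficients of g; this is how \<psi> is
  extracted from the pairing. Coefficient 0 is excluded because the constant term 1 enters
  there.\<close>

lemma ps_comp_linear: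
  assumes c: "c \<in> carrier R" and g: "g \<in> carrier (ps R)" and k: "k > 0"
  shows "ps_comp R (\<one>\<^bsub>ps R\<^esub> \<oplus>\<^bsub>ps R\<^esub> ps_monom R c 1) g k = c \<otimes> g k"
proof -
  interpret P: cring "ps R" by (rule ps_cring)
  have gi: "\<And>i. (g [^]\<^bsub>ps R\<^esub> (i::nat)) k \<in> carrier R"
    using g by (simp add: ps_coeff_closed[of "g [^]\<^bsub>ps R\<^esub> _" R k])
  have "(\<Oplus>i\<in>{..k}. (\<one>\<^bsub>ps R\<^esub> \<oplus>\<^bsub>ps R\<^esub> ps_monom R c 1) i \<otimes> (g [^]\<^bsub>ps R\<^esub> i) k) =
      (\<one>\<^bsub>ps R\<^esub> \<oplus>\<^bsub>ps R\<^esub> ps_monom R c 1) 1 \<otimes> (g [^]\<^bsub>ps R\<^esub> (1::nat)) k"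
  proof (rule finsum_single)
    show "(\<one>\<^bsub>ps R\<^esub> \<oplus>\<^bsub>ps R\<^esub> ps_monom R c 1) i \<otimes> (g [^]\<^bsub>ps R\<^esub> i) k = \<zero>" if "i \<noteq> 1" for i
      using that gi[of i] k by (cases "i = 0") (simp_all add: ps_add ps_one ps_monom_def)
  qed (use c gi[of 1] k in \<open>simp_all add: ps_add ps_one ps_monom_def\<close>)
  also have "\<dots> = c \<otimes> g k"
    using c g by (simp add: ps_add ps_one ps_monom_def)
  finally show ?thesis by (simp add: ps_comp_def)
qed

lemma ps_smult_var: "c \<in> carrier R \<Longrightarrow> ps_smult R c (ps_var R) = ps_monom R c 1"
  by (auto simp: ps_smult_def ps_monom_def fun_eq_iff)

lemma ps_var_mult_cancel:
  assumes "f \<in> carrier (ps R)" "g \<in> carrier (ps R)"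
    "ps_var R \<otimes>\<^bsub>ps R\<^esub> f = ps_var R \<otimes>\<^bsub>ps R\<^esub> g"
  shows "f = g"
proof
  fix k
  have "(ps_var R \<otimes>\<^bsub>ps R\<^esub> f) (Suc k) = (ps_var R \<otimes>\<^bsub>ps R\<^esub> g) (Suc k)"
    using assms(3) by simp
  then show "f k = g k"
    using assms(1,2) by (simp add: ps_monom_mult ps_carrier del: One_nat_def)
qed

end

lemma G_power_hom:
  assumes "cring R" "cring S" "h \<in> ring_hom R S" "cring (Witt p R)" "cring (Witt p S)"
    and q: "q \<in> carrier R"
  shows "h \<circ> G_power p R q m = G_power p S (h q) m"
proof -
  interpret R: cring R by fact
  interpret W: ring_hom_cring "Witt p R" "Witt p S" "\<lambda>x. h \<circ> x"
    using assms(4,5) Witt_map_hom[OF assms(1-3)] by (simp add: ring_hom_cring_def ring_hom_cring_axioms_def)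
  have T: "h \<circ> teich R q = teich S (h q)"
    using assms by (intro Witt_map_teich)
  have F: "h \<circ> cyclo_teich p R q = cyclo_teich p S (h q)"
    using cyclo_hom[OF assms(4,5) Witt_map_hom[OF assms(1-3)], of "teich R q" p] q T by simp
  have s: "h \<circ> G_section p R q = G_section p S (h q)"
    using q by (simp add: G_section_def T a_minus_def)
  have sc: "G_section p R q \<in> carrier (Witt p R)"
    using R.G_power_closed[OF assms(4) q, of 0] by simp
  show ?thesis
  proof (induction m)
    case (Suc m)
    show ?case
      using q R.G_power_closed[OF assms(4) q] sc by (simp add: G_op_def s F Suc.IH)
  qed (simp add: s)
qed

context prime_base
begin

abbreviation "q \<equiv> q_univ p"
abbreviation "W \<equiv> Witt p (OQ p)"

lemma q_eq: "q = \<one>\<^bsub>OQ p\<^esub> \<oplus>\<^bsub>OQ p\<^esub> ps_monom (Zp p) \<one>\<^bsub>Zp p\<^esub> 1"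
  by (simp add: q_univ_def)

lemma q_closed [simp]: "q \<in> carrier (OQ p)"
  by (simp add: q_eq)

lemma q_minus_1: "q \<ominus>\<^bsub>OQ p\<^esub> \<one>\<^bsub>OQ p\<^esub> = q_minus_1 p"
proof -
  have "q_minus_1 p \<in> carrier (OQ p)" by simp
  then show ?thesis unfolding q_univ_def by algebra
qed

lemma q_power_coeff: "(q [^]\<^bsub>OQ p\<^esub> m) k = [(m choose k)] \<cdot>\<^bsub>Zp p\<^esub> \<one>\<^bsub>Zp p\<^esub>"
  unfolding q_eq by (subst Z.ps_one_plus_monom_power) simp_all

lemma zp_binom_closed: "n \<in> carrier (Zp p) \<Longrightarrow> zp_binom p n i \<in> carrier (Zp p)"
  using p by (rule zp_binom_spec)

lemma q_pow_closed: "n \<in> carrier (Zp p) \<Longrightarrow> q_pow p n \<in> carrier (OQ p)"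
  by (simp add: q_pow_def ps_carrier zp_binom_closed)

text \<open>Coefficients of both series are binomials, and only those of index below M count. So K
  has to cover the denominators i! with i < M.\<close>

lemma q_pow_approx:
  assumes n: "n \<in> carrier (Zp p)" and K: "\<And>i. i < M \<Longrightarrow> a + multiplicity p (fact i) \<le> K"
    and m: "[int m = n K] (mod int p ^ K)"
  shows "q_pow p n \<ominus>\<^bsub>OQ p\<^esub> q [^]\<^bsub>OQ p\<^esub> m \<in> J M a"
proof -
  have "zp_binom p n i a = int (m choose i) mod int p ^ a" if "i < M" for i
    using K[OF that] m by (rule zp_binom_cong[OF p n])
  then show ?thesis
    using q_pow_closed[OF n] zp_binom_closed[OF n]
    by (simp add: J_def Z.ps_minus Zp_minus[OF p_gt_0] q_power_coeff q_pow_def Zp_of_nat[OF p_gt_0])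
qed

lemma W_teich_power:
  assumes "a \<in> carrier (OQ p)"
  shows "teich (OQ p) a [^]\<^bsub>W\<^esub> (k::nat) = teich (OQ p) (a [^]\<^bsub>OQ p\<^esub> k)"
  using O.teich_power[OF p _ assms] OQ_torsion_free by blast

text \<open>
  Multiplication by \<open>cyclo_teich p (OQ p) q\<close> is injective on \<open>W\<close> and turns the claim into one about
  Teichmueller representatives; the content is that this cancellation is continuous.
\<close>
lemma unit_mult_section_approx:
  assumes n: "n \<in> carrier (Zp p)" and u: "cyclo_unit p n u" and N: "N \<ge> 1"
    and approx: "q_pow p n \<ominus>\<^bsub>OQ p\<^esub> q [^]\<^bsub>OQ p\<^esub> m \<in> J M (N + M)"
    and y: "y \<in> carrier W"
    and y_eq: "\<one>\<^bsub>W\<^esub> \<oplus>\<^bsub>W\<^esub> cyclo_teich p (OQ p) q \<otimes>\<^bsub>W\<^esub> y = teich (OQ p) q [^]\<^bsub>W\<^esub> (p * m)"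
  shows "(u \<otimes>\<^bsub>W\<^esub> G_section p (OQ p) (q_pow p n)) k \<ominus>\<^bsub>OQ p\<^esub> y k \<in> J M N"
proof -
  define F where "F = cyclo_teich p (OQ p) q"
  define Tn where "Tn = teich (OQ p) (q_pow p n)"
  define T where "T = teich (OQ p) (q [^]\<^bsub>OQ p\<^esub> m)"
  define x where "x = u \<otimes>\<^bsub>W\<^esub> G_section p (OQ p) (q_pow p n)"
  have qn: "q_pow p n \<in> carrier (OQ p)" using n by (rule q_pow_closed)
  have qm: "q [^]\<^bsub>OQ p\<^esub> m \<in> carrier (OQ p)" by simp
  have Tn: "Tn \<in> carrier W" and T: "T \<in> carrier W"
    using qn by (simp_all add: Tn_def T_def)
  have F: "F \<in> carrier W" by (simp add: F_def)
  have u': "u \<in> carrier W" and uF: "cyclo p W Tn = u \<otimes>\<^bsub>W\<^esub> F"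
    using u by (auto simp: cyclo_unit_def F_def Tn_def)
  have s: "Tn \<ominus>\<^bsub>W\<^esub> \<one>\<^bsub>W\<^esub> \<in> carrier W" using Tn by simp
  have x: "x \<in> carrier W" using u' s by (simp add: x_def G_section_def Tn_def)
  \<comment> \<open>The unit u converts Phi_p([q]) into Phi_p([q^n]), after which the product with
    [q^n] - 1 telescopes.\<close>
  have "F \<otimes>\<^bsub>W\<^esub> x = (u \<otimes>\<^bsub>W\<^esub> F) \<otimes>\<^bsub>W\<^esub> (Tn \<ominus>\<^bsub>W\<^esub> \<one>\<^bsub>W\<^esub>)"
    using F u' s by (simp add: x_def G_section_def Tn_def W.m_ac)
  also have "\<dots> = Tn [^]\<^bsub>W\<^esub> p \<ominus>\<^bsub>W\<^esub> \<one>\<^bsub>W\<^esub>"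
    unfolding uF[symmetric] using Tn by (rule W.cyclo_mult)
  finally have Fx: "F \<otimes>\<^bsub>W\<^esub> x = Tn [^]\<^bsub>W\<^esub> p \<ominus>\<^bsub>W\<^esub> \<one>\<^bsub>W\<^esub>" .
  have Fy_carr: "F \<otimes>\<^bsub>W\<^esub> y \<in> carrier W" using F y by simp
  have "teich (OQ p) q [^]\<^bsub>W\<^esub> m = T"
    unfolding T_def by (rule W_teich_power) simp
  then have "teich (OQ p) q [^]\<^bsub>W\<^esub> (p * m) = T [^]\<^bsub>W\<^esub> p"
    using W.nat_pow_pow[of "teich (OQ p) q" m p] by (simp add: mult.commute)
  then have Fy: "\<one>\<^bsub>W\<^esub> \<oplus>\<^bsub>W\<^esub> F \<otimes>\<^bsub>W\<^esub> y = T [^]\<^bsub>W\<^esub> p"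
    using y_eq by (simp add: F_def)
  have diff: "F \<otimes>\<^bsub>W\<^esub> (x \<ominus>\<^bsub>W\<^esub> y) = Tn [^]\<^bsub>W\<^esub> p \<ominus>\<^bsub>W\<^esub> T [^]\<^bsub>W\<^esub> p"
  proof -
    have "F \<otimes>\<^bsub>W\<^esub> (x \<ominus>\<^bsub>W\<^esub> y) = F \<otimes>\<^bsub>W\<^esub> x \<ominus>\<^bsub>W\<^esub> F \<otimes>\<^bsub>W\<^esub> y"
      using F x y by (simp add: a_minus_def W.r_distr W.r_minus)
    also have "\<dots> = (Tn [^]\<^bsub>W\<^esub> p \<ominus>\<^bsub>W\<^esub> \<one>\<^bsub>W\<^esub>) \<ominus>\<^bsub>W\<^esub> F \<otimes>\<^bsub>W\<^esub> y"
      by (simp only: Fx)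
    also have "\<dots> = Tn [^]\<^bsub>W\<^esub> p \<ominus>\<^bsub>W\<^esub> (\<one>\<^bsub>W\<^esub> \<oplus>\<^bsub>W\<^esub> F \<otimes>\<^bsub>W\<^esub> y)"
    proof -
      have "(a \<ominus>\<^bsub>W\<^esub> \<one>\<^bsub>W\<^esub>) \<ominus>\<^bsub>W\<^esub> b = a \<ominus>\<^bsub>W\<^esub> (\<one>\<^bsub>W\<^esub> \<oplus>\<^bsub>W\<^esub> b)"
        if "a \<in> carrier W" "b \<in> carrier W" for a b
        using that by (simp add: a_minus_def W.minus_add W.a_assoc)
      then show ?thesis using Fy_carr Tn by simp
    qed
    finally show ?thesis by (simp only: Fy)
  qed
  have "x k \<ominus>\<^bsub>OQ p\<^esub> y k \<in> J M N"
  proof (rule J_ghost_imp_components[OF x y N])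
    fix k
    interpret h: ring_hom_cring W "OQ p" "ghost (OQ p) p k"
      using W.cring_axioms O.cring_axioms O.ghost_hom[OF p]
      by (simp add: ring_hom_cring_def ring_hom_cring_axioms_def)
    have pow: "ghost (OQ p) p k (t [^]\<^bsub>W\<^esub> i) = ghost (OQ p) p k t [^]\<^bsub>OQ p\<^esub> i"
      if "t \<in> carrier W" for t and i :: nat
      by (induction i) (use that in simp_all)
    let ?g = "ghost (OQ p) p k"
    have gT: "?g (teich (OQ p) a [^]\<^bsub>W\<^esub> p) = a [^]\<^bsub>OQ p\<^esub> (p ^ Suc k)" if "a \<in> carrier (OQ p)" for a
      using that by (simp add: pow O.ghost_teich[OF p_gt_0] O.nat_pow_pow mult.commute)
    have "?g F \<otimes>\<^bsub>OQ p\<^esub> (?g x \<ominus>\<^bsub>OQ p\<^esub> ?g y) = ?g (F \<otimes>\<^bsub>W\<^esub> (x \<ominus>\<^bsub>W\<^esub> y))"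
      using F x y by (simp add: a_minus_def)
    also have "\<dots> = ?g (Tn [^]\<^bsub>W\<^esub> p) \<ominus>\<^bsub>OQ p\<^esub> ?g (T [^]\<^bsub>W\<^esub> p)"
      using Tn T by (simp add: diff) (simp add: a_minus_def)
    also have "\<dots> = q_pow p n [^]\<^bsub>OQ p\<^esub> (p ^ Suc k) \<ominus>\<^bsub>OQ p\<^esub> (q [^]\<^bsub>OQ p\<^esub> m) [^]\<^bsub>OQ p\<^esub> (p ^ Suc k)"
      unfolding Tn_def T_def gT[OF qn] gT[OF qm] ..
    \<comment> \<open>The extra p-th power raises the exponent of p from k to k + 1. Of the total,
      cancelling F uses M, and N + k is what \<open>J_ghost_imp_components\<close> requires.\<close>
    also have "\<dots> \<in> J M (N + M + Suc k)"
      using approx qn qm N by (intro J_prime_power_diff) auto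
    finally have mem: "?g F \<otimes>\<^bsub>OQ p\<^esub> (?g x \<ominus>\<^bsub>OQ p\<^esub> ?g y) \<in> J M (N + k + M)"
      by (rule J_antimono) simp
    \<comment> \<open>The constant coefficient is the specialisation q = 1, where the cyclotomic
      polynomial takes the value p. This is the hypothesis of \<open>J_cancel\<close>.\<close>
    have "(?g F) 0 = cyclo p (Zp p) ((?g (teich (OQ p) q)) 0)"
      using cyclo_hom[OF W.cring_axioms Z.cring_axioms, of "\<lambda>t. ?g t 0" "teich (OQ p) q" p]
        ring_hom_trans[OF O.ghost_hom[OF p] Z.ps_coeff0_hom, of k]
      by (simp add: F_def comp_def)
    also have "(?g (teich (OQ p) q)) 0 = \<one>\<^bsub>Zp p\<^esub>"
      by (simp add: O.ghost_teich[OF p_gt_0] q_power_coeff)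
    finally have gF: "(?g F) 0 = [p] \<cdot>\<^bsub>Zp p\<^esub> \<one>\<^bsub>Zp p\<^esub>"
      by (simp add: Z.cyclo_one)
    show "?g x \<ominus>\<^bsub>OQ p\<^esub> ?g y \<in> J M (N + k)"
      by (rule J_cancel[OF _ gF _ mem]) (use F x y in auto)
  qed
  then show ?thesis by (simp add: x_def)
qed

end

section \<open>Finite quotients of the base\<close>

context prime_base
begin

lemma J_ideal: "ideal (J M N) (OQ p)"
proof (rule idealI[OF O.ring_axioms])
  show "subgroup (J M N) (add_monoid (OQ p))"
  proof (rule O.add.subgroupI)
    show "J M N \<subseteq> carrier (OQ p)" using J_closed by blast
    show "J M N \<noteq> {}" using J_zero by blast
    show "\<ominus>\<^bsub>OQ p\<^esub> a \<in> J M N" if "a \<in> J M N" for a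
      using J_minus[OF J_zero that] J_closed[OF that] by (simp add: a_minus_def)
  qed (rule J_add)
  fix a x assume ax: "a \<in> J M N" "x \<in> carrier (OQ p)"
  then show "a \<otimes>\<^bsub>OQ p\<^esub> x \<in> J M N" by (rule J_mult_left)
  then show "x \<otimes>\<^bsub>OQ p\<^esub> a \<in> J M N" using ax J_closed O.m_comm by metis
qed

text \<open>Residues are stored as reduced representatives, so congruence of coefficients is
  equality of entries.\<close>

lemma J_minus_iff:
  assumes "a \<in> carrier (OQ p)" "b \<in> carrier (OQ p)"
  shows "a \<ominus>\<^bsub>OQ p\<^esub> b \<in> J M N \<longleftrightarrow> (\<forall>j<M. a j N = b j N)"
proof -
  have "(a \<ominus>\<^bsub>OQ p\<^esub> b) j N = 0 \<longleftrightarrow> a j N = b j N" for j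
  proof -
    have ab: "a j \<in> carrier (Zp p)" "b j \<in> carrier (Zp p)"
      using assms by (simp_all add: ps_carrier)
    have "(a \<ominus>\<^bsub>OQ p\<^esub> b) j N = (a j N - b j N) mod int p ^ N"
      using assms ab by (simp add: Z.ps_minus Zp_minus[OF p_gt_0])
    also have "\<dots> = 0 \<longleftrightarrow> [a j N = b j N] (mod int p ^ N)"
      by (simp add: cong_iff_dvd_diff dvd_eq_mod_eq_0)
    also have "\<dots> \<longleftrightarrow> a j N = b j N"
      using Zp_carrierD[OF ab(1), of N] Zp_carrierD[OF ab(2), of N] by (simp add: cong_def)
    finally show ?thesis .
  qed
  then show ?thesis using assms by (simp add: J_def)
qed

text \<open>The universe \<open>'a\<close> has to be infinite in order to contain copies of all these finite rings.\<close>
lemma finite_quotient: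
  assumes "infinite (UNIV :: 'a set)"
  obtains A :: "'a ring" and h where "cring A" "h \<in> ring_hom (OQ p) A"
    "h ` carrier (OQ p) = carrier A"
    "\<And>a b. a \<in> carrier (OQ p) \<Longrightarrow> b \<in> carrier (OQ p) \<Longrightarrow> h a = h b \<longleftrightarrow> a \<ominus>\<^bsub>OQ p\<^esub> b \<in> J M N"
proof -
  \<comment> \<open>The list of the first M coefficients modulo p^N is a complete invariant modulo
    \<open>J M N\<close> with finitely many values. An injection g of these values into the universe
    lets \<open>image_ring\<close> carry the quotient structure there.\<close>
  define t where "t a = map (\<lambda>j. a j N) [0..<M]" for a :: "nat \<Rightarrow> nat \<Rightarrow> int"
  define S where "S = {xs. set xs \<subseteq> {0..<int p ^ N} \<and> length xs = M}"
  have "finite S"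
    unfolding S_def by (rule finite_lists_length_eq) simp
  moreover obtain T :: "'a set" where "finite T" "card T = card S"
    using infinite_arbitrarily_large[OF assms] by blast
  ultimately obtain g where "bij_betw g S T"
    using finite_same_card_bij by metis
  then have g: "inj_on g S" by (rule bij_betw_imp_inj_on)
  define h where "h = g \<circ> t"
  have tS: "t a \<in> S" if "a \<in> carrier (OQ p)" for a
    using that Zp_carrierD(1,2)[of "a _" p N] by (auto simp: S_def t_def ps_carrier)
  have h_eq: "h a = h b \<longleftrightarrow> a \<ominus>\<^bsub>OQ p\<^esub> b \<in> J M N"
    if "a \<in> carrier (OQ p)" "b \<in> carrier (OQ p)" for a b
  proof -
    have "h a = h b \<longleftrightarrow> t a = t b"
      using inj_on_eq_iff[OF g tS tS] that by (simp add: h_def)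
    also have "\<dots> \<longleftrightarrow> (\<forall>j<M. a j N = b j N)"
      by (auto simp: t_def)
    finally show ?thesis using J_minus_iff that by simp
  qed
  have weak: "weak_ring_morphism h (J M N) (OQ p)"
    using J_ideal h_eq by (rule weak_ring_morphismI)
  define A where "A = image_ring h (OQ p)"
  have hom: "h \<in> ring_hom (OQ p) A"
    unfolding A_def by (rule O.weak_ring_morphism_is_hom[OF weak])
  have surj: "h ` carrier (OQ p) = carrier A"
    by (simp add: A_def image_ring_carrier)
  have "cring A"
    using O.cring_axioms hom surj by (rule cring_surj_image) (simp add: A_def image_ring_zero)
  then show ?thesis using that hom surj h_eq by blast
qed

end

text \<open>A is Z_p[[q - 1]] / (p^N, (q - 1)^M), presented by its surjection h. The bounds M >= 1
  and N >= 1 make A nonzero, so that N and M are the exact nilpotency orders of p and of q -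
  1.\<close>

locale quotient_base = prime_base p + A: cring A
  for p :: nat and A :: "'a ring" +
  fixes h :: "(nat \<Rightarrow> nat \<Rightarrow> int) \<Rightarrow> 'a" and M N :: nat
  assumes hom: "h \<in> ring_hom (OQ p) A"
    and surj: "h ` carrier (OQ p) = carrier A"
    and h_eq: "\<And>a b. a \<in> carrier (OQ p) \<Longrightarrow> b \<in> carrier (OQ p) \<Longrightarrow> h a = h b \<longleftrightarrow> a \<ominus>\<^bsub>OQ p\<^esub> b \<in> J M N"
    and M: "M \<ge> 1" and N: "N \<ge> 1"
begin

sublocale h: ring_hom_cring "OQ p" A h
  by unfold_locales (rule hom)

lemma h_eq_zero: "a \<in> carrier (OQ p) \<Longrightarrow> h a = \<zero>\<^bsub>A\<^esub> \<longleftrightarrow> a \<in> J M N"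
  using h_eq[of a "\<zero>\<^bsub>OQ p\<^esub>"] by (simp add: a_minus_def)

lemma h_pow: "a \<in> carrier (OQ p) \<Longrightarrow> h (a [^]\<^bsub>OQ p\<^esub> (k::nat)) = h a [^]\<^bsub>A\<^esub> k"
  by (induction k) simp_all

lemma h_add_pow: "a \<in> carrier (OQ p) \<Longrightarrow> h ([(k::nat)] \<cdot>\<^bsub>OQ p\<^esub> a) = [k] \<cdot>\<^bsub>A\<^esub> h a"
  by (induction k) simp_all

lemma h_minus: "a \<in> carrier (OQ p) \<Longrightarrow> b \<in> carrier (OQ p) \<Longrightarrow> h (a \<ominus>\<^bsub>OQ p\<^esub> b) = h a \<ominus>\<^bsub>A\<^esub> h b"
  by (simp add: a_minus_def)

text \<open>An equivalence, because \<open>zp_to\<close> reads the residue at the least exponent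
  that kills p; \<open>q_minus_1_power_eq_zero_iff\<close> plays the same role for
  \<open>ev\<close>.\<close>

lemma p_power_eq_zero_iff: "[(p ^ k)] \<cdot>\<^bsub>A\<^esub> \<one>\<^bsub>A\<^esub> = \<zero>\<^bsub>A\<^esub> \<longleftrightarrow> N \<le> k"
proof -
  have "[(p ^ k)] \<cdot>\<^bsub>A\<^esub> \<one>\<^bsub>A\<^esub> = \<zero>\<^bsub>A\<^esub> \<longleftrightarrow> [(p ^ k)] \<cdot>\<^bsub>OQ p\<^esub> \<one>\<^bsub>OQ p\<^esub> \<in> J M N"
    using h_eq_zero[of "[(p ^ k)] \<cdot>\<^bsub>OQ p\<^esub> \<one>\<^bsub>OQ p\<^esub>"] by (simp add: h_add_pow)
  also have "\<dots> \<longleftrightarrow> int p ^ N dvd int p ^ k"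
    using M by (auto simp: J_def Z.ps_coeff_add_pow ps_one Zp_of_nat[OF p_gt_0] Zp_ops dvd_eq_mod_eq_0)
  also have "\<dots> \<longleftrightarrow> N \<le> k"
    using prime_ge_2_nat[OF p] by (simp add: dvd_power_iff_le flip: of_nat_power)
  finally show ?thesis .
qed

lemma p_nilpotent: "p_nilpotent_ring p A"
  using A.cring_axioms p_power_eq_zero_iff[of N] by (auto simp: p_nilpotent_ring_def)

lemma monom_in_J: "c \<in> carrier (Zp p) \<Longrightarrow> M \<le> k \<Longrightarrow> ps_monom (Zp p) c k \<in> J M N"
  by (simp add: J_def) (simp add: ps_monom_def Zp_ops)

lemma var_power: "q_minus_1 p [^]\<^bsub>OQ p\<^esub> (k::nat) = ps_monom (Zp p) \<one>\<^bsub>Zp p\<^esub> k"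
  using Z.ps_monom_power[of "\<one>\<^bsub>Zp p\<^esub>" k] by simp

lemma h_q_minus_1: "h q \<ominus>\<^bsub>A\<^esub> \<one>\<^bsub>A\<^esub> = h (q_minus_1 p)"
  using h_minus[of q "\<one>\<^bsub>OQ p\<^esub>"] by (simp add: q_minus_1)

lemma h_q_minus_1_power:
  "(h q \<ominus>\<^bsub>A\<^esub> \<one>\<^bsub>A\<^esub>) [^]\<^bsub>A\<^esub> (k::nat) = h (ps_monom (Zp p) \<one>\<^bsub>Zp p\<^esub> k)"
proof -
  have "(h q \<ominus>\<^bsub>A\<^esub> \<one>\<^bsub>A\<^esub>) [^]\<^bsub>A\<^esub> k = h (q_minus_1 p [^]\<^bsub>OQ p\<^esub> k)"
    unfolding h_q_minus_1 by (rule h_pow[symmetric]) simp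
  then show ?thesis by (simp only: var_power)
qed

lemma q_minus_1_power_eq_zero_iff: "(h q \<ominus>\<^bsub>A\<^esub> \<one>\<^bsub>A\<^esub>) [^]\<^bsub>A\<^esub> (k::nat) = \<zero>\<^bsub>A\<^esub> \<longleftrightarrow> M \<le> k"
proof -
  have "(h q \<ominus>\<^bsub>A\<^esub> \<one>\<^bsub>A\<^esub>) [^]\<^bsub>A\<^esub> k = \<zero>\<^bsub>A\<^esub> \<longleftrightarrow> ps_monom (Zp p) \<one>\<^bsub>Zp p\<^esub> k \<in> J M N"
    unfolding h_q_minus_1_power by (rule h_eq_zero) simp
  also have "\<dots> \<longleftrightarrow> M \<le> k"
  proof
    assume "ps_monom (Zp p) \<one>\<^bsub>Zp p\<^esub> k \<in> J M N"
    then have "k < M \<Longrightarrow> (1::int) mod int p ^ N = 0"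
      by (simp add: J_def) (auto simp: ps_monom_def Zp_ops)
    moreover have "(1::int) mod int p ^ N \<noteq> 0"
      using N prime_gt_1_nat[OF p] by simp
    ultimately show "M \<le> k" by linarith
  qed (simp add: monom_in_J)
  finally show ?thesis .
qed

text \<open>Constant term 1 makes f invertible and makes f - 1 a multiple of q - 1, which is
  nilpotent in A. It is applied to q and to q^n.\<close>

lemma Q_point:
  assumes f: "f \<in> carrier (OQ p)" and f0: "f 0 = \<one>\<^bsub>Zp p\<^esub>"
  shows "h f \<in> Q_points A"
proof -
  have "f \<in> Units (OQ p)"
    using f f0 by (intro Z.ps_UnitsI) simp_all
  then have "h f \<otimes>\<^bsub>A\<^esub> h (inv\<^bsub>OQ p\<^esub> f) = \<one>\<^bsub>A\<^esub>" "h (inv\<^bsub>OQ p\<^esub> f) \<in> carrier A"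
    using f by (simp_all flip: h.hom_mult)
  then have unit: "h f \<in> Units A"
    using f A.m_comm unfolding Units_def by (auto intro!: bexI[of _ "h (inv\<^bsub>OQ p\<^esub> f)"])
  define g where "g k = f (Suc k)" for k
  have g: "g \<in> carrier (OQ p)" using f by (simp add: g_def ps_carrier)
  have "f \<ominus>\<^bsub>OQ p\<^esub> \<one>\<^bsub>OQ p\<^esub> = q_minus_1 p \<otimes>\<^bsub>OQ p\<^esub> g"
  proof
    fix k show "(f \<ominus>\<^bsub>OQ p\<^esub> \<one>\<^bsub>OQ p\<^esub>) k = (q_minus_1 p \<otimes>\<^bsub>OQ p\<^esub> g) k"
      unfolding Z.ps_minus[OF f O.one_closed] Z.ps_monom_mult[OF Z.one_closed g]
      using f f0 by (cases k) (simp_all add: ps_one g_def ps_carrier a_minus_def Z.r_neg)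
  qed
  then have "h f \<ominus>\<^bsub>A\<^esub> \<one>\<^bsub>A\<^esub> = h (q_minus_1 p) \<otimes>\<^bsub>A\<^esub> h g"
    using h_minus[of f "\<one>\<^bsub>OQ p\<^esub>"] f g by simp
  then have "(h f \<ominus>\<^bsub>A\<^esub> \<one>\<^bsub>A\<^esub>) [^]\<^bsub>A\<^esub> M = h (q_minus_1 p) [^]\<^bsub>A\<^esub> M \<otimes>\<^bsub>A\<^esub> h g [^]\<^bsub>A\<^esub> M"
    using g by (simp add: A.nat_pow_distrib)
  also have "\<dots> = \<zero>\<^bsub>A\<^esub>"
    using q_minus_1_power_eq_zero_iff[of M] g by (simp add: h_q_minus_1)
  finally show ?thesis using unit by (auto simp: Q_points_def)
qed

text \<open>\<open>ev\<close> keeps the residues modulo p^N of the first M coefficients, and h kills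
  exactly what is dropped. Evaluation at the tautological point is thus the homomorphism h, whose
  algebraic rules replace the truncated sum.\<close>

lemma ev_eq:
  assumes f: "f \<in> carrier (OQ p)"
  shows "ev p A (h q) f = h f"
proof -
  have fi: "\<And>i. f i \<in> carrier (Zp p)" using f by (simp add: ps_carrier)
  have LeastN: "(LEAST N. [(p ^ N)] \<cdot>\<^bsub>A\<^esub> \<one>\<^bsub>A\<^esub> = \<zero>\<^bsub>A\<^esub>) = N"
    unfolding p_power_eq_zero_iff by (rule Least_equality) auto
  have LeastM: "(LEAST M::nat. (h q \<ominus>\<^bsub>A\<^esub> \<one>\<^bsub>A\<^esub>) [^]\<^bsub>A\<^esub> M = \<zero>\<^bsub>A\<^esub>) = M"
    unfolding q_minus_1_power_eq_zero_iff by (rule Least_equality) auto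
  have zp_to: "zp_to p A a = h (ps_const (Zp p) a)" if a: "a \<in> carrier (Zp p)" for a
  proof -
    have "a N \<ge> 0" using Zp_carrierD[OF a] by blast
    then have "zp_to p A a = h ([(nat (a N))] \<cdot>\<^bsub>OQ p\<^esub> \<one>\<^bsub>OQ p\<^esub>)"
      by (simp add: zp_to_def LeastN h_add_pow add_pow_int_ge)
    also have "\<dots> = h (ps_const (Zp p) a)"
    proof (subst h_eq)
      have "([(nat (a N))] \<cdot>\<^bsub>Zp p\<^esub> \<one>\<^bsub>Zp p\<^esub>) N = a N"
        using Zp_carrierD[OF a, of N] by (simp add: Zp_of_nat[OF p_gt_0])
      then show "[(nat (a N))] \<cdot>\<^bsub>OQ p\<^esub> \<one>\<^bsub>OQ p\<^esub> \<ominus>\<^bsub>OQ p\<^esub> ps_const (Zp p) a \<in> J M N"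
        using a by (subst J_minus_iff) (simp_all add: Z.ps_coeff_add_pow ps_one, simp add: ps_const_def)
    qed (use a in simp_all)
    finally show ?thesis .
  qed
  have "ev p A (h q) f = (\<Oplus>\<^bsub>A\<^esub>i\<in>{..<M}. (h \<circ> (\<lambda>i. ps_monom (Zp p) (f i) i)) i)"
    unfolding ev_def LeastM
  proof (rule A.finsum_cong'[OF refl])
    fix i assume "i \<in> {..<M}"
    have "ps_monom (Zp p) (f i) i = ps_const (Zp p) (f i) \<otimes>\<^bsub>OQ p\<^esub> q_minus_1 p [^]\<^bsub>OQ p\<^esub> i"
    proof -
      have "ps_const (Zp p) (f i) \<otimes>\<^bsub>OQ p\<^esub> ps_monom (Zp p) \<one>\<^bsub>Zp p\<^esub> i =
          ps_smult (Zp p) (f i) (ps_monom (Zp p) \<one>\<^bsub>Zp p\<^esub> i)"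
        using fi by (intro Z.ps_const_mult) simp_all
      then show ?thesis
        unfolding var_power using fi by (auto simp: ps_smult_def ps_monom_def fun_eq_iff)
    qed
    then show "zp_to p A (f i) \<otimes>\<^bsub>A\<^esub> (h q \<ominus>\<^bsub>A\<^esub> \<one>\<^bsub>A\<^esub>) [^]\<^bsub>A\<^esub> i = (h \<circ> (\<lambda>i. ps_monom (Zp p) (f i) i)) i"
      using fi by (simp add: zp_to h_q_minus_1 h_pow)
  qed (use fi in simp)
  also have "\<dots> = h (\<Oplus>\<^bsub>OQ p\<^esub>i\<in>{..<M}. ps_monom (Zp p) (f i) i)"
    using fi by (intro h.hom_finsum[symmetric]) simp
  also have "\<dots> = h f"
  proof (subst h_eq)
    have "(\<Oplus>\<^bsub>OQ p\<^esub>i\<in>{..<M}. ps_monom (Zp p) (f i) i) j = f j" if "j < M" for j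
    proof -
      have "(\<Oplus>\<^bsub>OQ p\<^esub>i\<in>{..<M}. ps_monom (Zp p) (f i) i) j = (\<Oplus>\<^bsub>Zp p\<^esub>i\<in>{..<M}. ps_monom (Zp p) (f i) i j)"
        using fi by (intro Z.ps_finsum_coeff) simp_all
      also have "\<dots> = ps_monom (Zp p) (f j) j j"
        by (rule Z.finsum_single) (use that fi in \<open>simp_all add: ps_monom_def\<close>)
      finally show ?thesis by (simp add: ps_monom_def)
    qed
    then show "(\<Oplus>\<^bsub>OQ p\<^esub>i\<in>{..<M}. ps_monom (Zp p) (f i) i) \<ominus>\<^bsub>OQ p\<^esub> f \<in> J M N"
      using f fi by (subst J_minus_iff) auto
  qed (use f fi in auto)
  finally show ?thesis .
qed

sublocale WA: cring "Witt p A"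
  by (rule Witt_cring_surj[OF O.cring_axioms A.cring_axioms hom surj W.cring_axioms])

sublocale Wh: ring_hom_cring W "Witt p A" "\<lambda>x. h \<circ> x"
  by unfold_locales (rule Witt_map_hom[OF O.cring_axioms A.cring_axioms hom])

lemma h_teich: "h \<circ> teich (OQ p) a = teich A (h a)"
  by (rule Witt_map_teich[OF O.cring_axioms A.cring_axioms hom])

lemma G_power_h: "h \<circ> G_power p (OQ p) q m = G_power p A (h q) m"
  by (rule G_power_hom[OF O.cring_axioms A.cring_axioms hom W.cring_axioms WA.cring_axioms q_closed])

lemma h_G_section: "a \<in> carrier (OQ p) \<Longrightarrow> h \<circ> G_section p (OQ p) a = G_section p A (h a)"
  by (simp add: G_section_def a_minus_def h_teich)

lemma G_power_in_G_points: "G_power p A (h q) m \<in> G_points p A (h q)"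
proof -
  have "\<one>\<^bsub>Witt p A\<^esub> \<oplus>\<^bsub>Witt p A\<^esub> cyclo_teich p A (h q) \<otimes>\<^bsub>Witt p A\<^esub> G_power p A (h q) m =
      teich A (h q) [^]\<^bsub>Witt p A\<^esub> (p * Suc m)"
    by (rule A.one_plus_cyclo_G_power[OF WA.cring_axioms]) simp
  also have "\<dots> = h \<circ> (teich (OQ p) q [^]\<^bsub>W\<^esub> (p * Suc m))"
  proof -
    have "h \<circ> (t [^]\<^bsub>W\<^esub> k) = (h \<circ> t) [^]\<^bsub>Witt p A\<^esub> k" if "t \<in> carrier W" for t and k :: nat
      by (induction k) (use that in \<open>simp_all del: comp_apply\<close>)
    then show ?thesis by (simp add: h_teich)
  qed
  also have "\<dots> = teich A (h q [^]\<^bsub>A\<^esub> (p * Suc m))"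
    by (simp add: W_teich_power h_teich h_pow del: mult_Suc_right)
  finally have "\<one>\<^bsub>Witt p A\<^esub> \<oplus>\<^bsub>Witt p A\<^esub> cyclo_teich p A (h q) \<otimes>\<^bsub>Witt p A\<^esub> G_power p A (h q) m =
      teich A (h q [^]\<^bsub>A\<^esub> (p * Suc m))" .
  moreover have "h q \<in> Units A"
    using Q_point[of q] q_power_coeff[of 1 0] by (auto simp: Q_points_def)
  then have "h q [^]\<^bsub>A\<^esub> k \<in> Units A" for k :: nat
    by (induction k) simp_all
  ultimately show ?thesis
    using A.G_power_closed[OF WA.cring_axioms h.hom_closed[OF q_closed], of m]
    unfolding G_points_def mem_Collect_eq by blast
qed

end

section \<open>The dual action\<close>

context quotient_base
begin

text \<open>Multiplicativity of the pairing reduces the claim to the section itself, whose value is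
  fixed by the coordinate. The exponent is j + 1 because of the shifted index of
  \<open>G_power\<close>.\<close>

lemma pairing_G_power:
  assumes "cartier_duality p F e" "normalized_coordinate p e"
  shows "e A (h q) (G_power p A (h q) j) =
    (\<one>\<^bsub>ps A\<^esub> \<oplus>\<^bsub>ps A\<^esub> ps_monom A (h q \<ominus>\<^bsub>A\<^esub> \<one>\<^bsub>A\<^esub>) 1) [^]\<^bsub>ps A\<^esub> Suc j"
proof -
  interpret P: cring "ps A" by (rule A.ps_cring)
  have Q: "h q \<in> Q_points A"
    using Q_point[of q] q_power_coeff[of 1 0] by simp
  have base: "e A (h q) (G_section p A (h q)) = \<one>\<^bsub>ps A\<^esub> \<oplus>\<^bsub>ps A\<^esub> ps_monom A (h q \<ominus>\<^bsub>A\<^esub> \<one>\<^bsub>A\<^esub>) 1"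
    using assms(2) p_nilpotent Q by (simp add: normalized_coordinate_def A.ps_smult_var del: One_nat_def)
  show ?thesis
  proof (induction j)
    case 0
    show ?case using base by simp
  next
    case (Suc j)
    have "e A (h q) (G_op p A (h q) (G_power p A (h q) j) (G_section p A (h q))) =
        e A (h q) (G_power p A (h q) j) \<otimes>\<^bsub>ps A\<^esub> e A (h q) (G_section p A (h q))"
      using assms(1) p_nilpotent Q G_power_in_G_points[of j] G_power_in_G_points[of 0]
      unfolding cartier_duality_def by simp
    then show ?case using Suc base by simp
  qed
qed

text \<open>The invariance of the pairing is read off at z^k for one test point over A. Both sides
  are images under h, and comparing them gives the congruence modulo the kernel of h.\<close>

lemma dual_action_coefficient_approx:
  fixes e :: "'a ring \<Rightarrow> 'a \<Rightarrow> (nat \<Rightarrow> 'a) \<Rightarrow> nat \<Rightarrow> 'a"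
  assumes e: "cartier_duality p F e" "normalized_coordinate p e"
    and n: "n \<in> carrier (Zp p)" and u: "cyclo_unit p n u" and act: "dual_action p e n u \<psi>"
    and k: "k > 0"
  shows "(q_pow p n \<ominus>\<^bsub>OQ p\<^esub> \<one>\<^bsub>OQ p\<^esub>) \<otimes>\<^bsub>OQ p\<^esub> \<psi> k \<ominus>\<^bsub>OQ p\<^esub> ps_monom (Zp p) (zp_binom p n k) k \<in> J M N"
proof -
  \<comment> \<open>N is the precision wanted at the end, M is spent on cancelling Phi_p([q]), and
    the sum bounds the loss of each single i!.\<close>
  define K where "K = N + M + (\<Sum>i<M. multiplicity p (fact i :: nat))"
  have K: "N + M + multiplicity p (fact i :: nat) \<le> K" if "i < M" for i
    unfolding K_def using that by (intro add_left_mono member_le_sum) auto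
  \<comment> \<open>Adding p^K leaves the residue unchanged and keeps the exponent positive, so that
    subtracting 1 for the shifted index of \<open>G_power\<close> is harmless.\<close>
  define m' where "m' = nat (n K) + p ^ K - 1"
  have m: "Suc m' = nat (n K) + p ^ K" using p_gt_0 by (simp add: m'_def)
  have m_cong: "[int (Suc m') = n K] (mod int p ^ K)"
    using Zp_carrierD[OF n, of K] unfolding m by (simp add: cong_def)
  have qn: "q_pow p n \<in> carrier (OQ p)" using n by (rule q_pow_closed)
  have psi: "\<psi> \<in> carrier (ps (OQ p))" using act by (simp add: dual_action_def)
  then have psi_k: "\<And>i. \<psi> i \<in> carrier (OQ p)" unfolding ps_carrier[of \<psi>] by blast
  have approx: "q_pow p n \<ominus>\<^bsub>OQ p\<^esub> q [^]\<^bsub>OQ p\<^esub> Suc m' \<in> J M (N + M)"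
    using K m_cong by (rule q_pow_approx[OF n])
  define y where "y = G_power p (OQ p) q m'"
  define x where "x = G_power p A (h q) m'"
  have y: "y \<in> carrier W"
    unfolding y_def by (rule O.G_power_closed[OF W.cring_axioms q_closed])
  have y_eq: "\<one>\<^bsub>W\<^esub> \<oplus>\<^bsub>W\<^esub> cyclo_teich p (OQ p) q \<otimes>\<^bsub>W\<^esub> y = teich (OQ p) q [^]\<^bsub>W\<^esub> (p * Suc m')"
    unfolding y_def by (rule O.one_plus_cyclo_G_power[OF W.cring_axioms q_closed])
  have hy: "h \<circ> y = x" unfolding x_def y_def by (rule G_power_h)
  define s where "s = G_section p (OQ p) (q_pow p n)"
  have s: "s \<in> carrier W" using qn by (simp add: s_def G_section_def)
  have uU: "u \<in> Units W" using u by (simp add: cyclo_unit_def)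
  then have u': "u \<in> carrier W" "inv\<^bsub>W\<^esub> u \<in> carrier W" by auto
  \<comment> \<open>Over the base, the point u ([q^n] - 1) and the power y agree only up to
    \<open>J M N\<close>. Applying h turns this into equality, so the action takes x exactly to the
    section over q^n.\<close>
  have "h \<circ> (u \<otimes>\<^bsub>W\<^esub> s) = h \<circ> y"
  proof
    fix i
    have "(u \<otimes>\<^bsub>W\<^esub> s) i \<ominus>\<^bsub>OQ p\<^esub> y i \<in> J M N"
      unfolding s_def by (rule unit_mult_section_approx[OF n u N approx y y_eq])
    moreover have "u \<otimes>\<^bsub>W\<^esub> s \<in> carrier W" using u' s by simp
    ultimately show "(h \<circ> (u \<otimes>\<^bsub>W\<^esub> s)) i = (h \<circ> y) i"
      using h_eq[of "(u \<otimes>\<^bsub>W\<^esub> s) i" "y i"] y by (simp add: Witt_carrier)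
  qed
  then have x_eq: "x = (h \<circ> u) \<otimes>\<^bsub>Witt p A\<^esub> (h \<circ> s)"
    using hy Wh.hom_mult[OF u'(1) s] by simp
  have "G_act p u A (h q) x = (h \<circ> inv\<^bsub>W\<^esub> u) \<otimes>\<^bsub>Witt p A\<^esub> x"
    using u'(2) by (simp add: G_act_def ev_eq Witt_carrier comp_def)
  also have "\<dots> = h \<circ> (inv\<^bsub>W\<^esub> u \<otimes>\<^bsub>W\<^esub> (u \<otimes>\<^bsub>W\<^esub> s))"
    unfolding x_eq using u' s by (simp only: Wh.hom_mult W.m_closed)
  also have "inv\<^bsub>W\<^esub> u \<otimes>\<^bsub>W\<^esub> (u \<otimes>\<^bsub>W\<^esub> s) = s"
    using uU u' s by (simp flip: W.m_assoc)
  also have "h \<circ> s = G_section p A (h (q_pow p n))"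
    unfolding s_def using qn by (rule h_G_section)
  finally have act_x: "G_act p u A (h q) x = G_section p A (h (q_pow p n))" .
  have Q: "h q \<in> Q_points A"
    using Q_point[of q] q_power_coeff[of 1 0] by simp
  have Qn: "h (q_pow p n) \<in> Q_points A"
    using qn zp_binom_0_1(1)[OF p n] by (intro Q_point) (simp_all add: q_pow_def)
  define c where "c = h (q_pow p n) \<ominus>\<^bsub>A\<^esub> \<one>\<^bsub>A\<^esub>"
  have c: "c \<in> carrier A" using qn by (simp add: c_def)
  have "e A (h (q_pow p n)) (G_section p A (h (q_pow p n))) = \<one>\<^bsub>ps A\<^esub> \<oplus>\<^bsub>ps A\<^esub> ps_monom A c 1"
    using e(2) p_nilpotent Qn A.ps_smult_var[OF c]
    by (simp add: normalized_coordinate_def c_def del: One_nat_def)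
  moreover have "ps_comp A (e A (ev p A (h q) (q_pow p n)) (G_act p u A (h q) x))
      (\<lambda>i. ev p A (h q) (\<psi> i)) = e A (h q) x"
    using act p_nilpotent Q G_power_in_G_points[of m'] by (simp add: dual_action_def x_def)
  ultimately have "ps_comp A (\<one>\<^bsub>ps A\<^esub> \<oplus>\<^bsub>ps A\<^esub> ps_monom A c 1) (\<lambda>i. h (\<psi> i)) = e A (h q) x"
    using qn psi_k by (simp add: ev_eq act_x)
  then have "c \<otimes>\<^bsub>A\<^esub> h (\<psi> k) = e A (h q) x k"
    using A.ps_comp_linear[OF c, of "\<lambda>i. h (\<psi> i)" k] k psi_k by (simp add: ps_carrier[of _ A])
  also have "\<dots> = [(Suc m' choose k)] \<cdot>\<^bsub>A\<^esub> ((h q \<ominus>\<^bsub>A\<^esub> \<one>\<^bsub>A\<^esub>) [^]\<^bsub>A\<^esub> k)"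
    unfolding x_def pairing_G_power[OF e] by (rule A.ps_one_plus_monom_power) simp
  also have "\<dots> = h ([(Suc m' choose k)] \<cdot>\<^bsub>OQ p\<^esub> ps_monom (Zp p) \<one>\<^bsub>Zp p\<^esub> k)"
    by (simp only: h_q_minus_1_power h_add_pow[OF Z.ps_monom_closed[OF Z.one_closed]])
  finally have "h ((q_pow p n \<ominus>\<^bsub>OQ p\<^esub> \<one>\<^bsub>OQ p\<^esub>) \<otimes>\<^bsub>OQ p\<^esub> \<psi> k) =
      h ([(Suc m' choose k)] \<cdot>\<^bsub>OQ p\<^esub> ps_monom (Zp p) \<one>\<^bsub>Zp p\<^esub> k)"
    using qn psi_k by (simp add: c_def h_minus)
  \<comment> \<open>For k < M the two binomials agree modulo p^N. For k >= M both monomials lie in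
    the kernel of h.\<close>
  also have "\<dots> = h (ps_monom (Zp p) (zp_binom p n k) k)"
  proof (subst h_eq)
    have "zp_binom p n k N = int (Suc m' choose k) mod int p ^ N" if "k < M"
      using K[OF that] m_cong by (intro zp_binom_cong[OF p n]) auto
    then show "[(Suc m' choose k)] \<cdot>\<^bsub>OQ p\<^esub> ps_monom (Zp p) \<one>\<^bsub>Zp p\<^esub> k \<ominus>\<^bsub>OQ p\<^esub>
        ps_monom (Zp p) (zp_binom p n k) k \<in> J M N"
      using zp_binom_closed[OF n]
      by (subst J_minus_iff)
        (simp_all add: Z.ps_coeff_add_pow, simp add: ps_monom_def Zp_of_nat[OF p_gt_0])
  qed (use zp_binom_closed[OF n] in simp_all)
  finally show ?thesis
    by (subst (asm) h_eq) (use qn psi_k zp_binom_closed[OF n] in simp_all)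
qed

end

section \<open>Passage from the quotients to Z_p[[q - 1]], and the formula for \<psi>\<close>

context prime_base
begin

lemma J_Inter_zero:
  assumes "a \<in> carrier (OQ p)" "b \<in> carrier (OQ p)"
    and "\<And>M N. M \<ge> 1 \<Longrightarrow> N \<ge> 1 \<Longrightarrow> a \<ominus>\<^bsub>OQ p\<^esub> b \<in> J M N"
  shows "a = b"
proof (intro ext)
  fix j N
  \<comment> \<open>The hypothesis requires positive indices, so the comparison is made one level
    deeper and then reduced to level N.\<close>
  have "a j (Suc N) = b j (Suc N)"
    using assms(3)[of "Suc j" "Suc N"] assms(1,2) by (simp add: J_minus_iff)
  moreover have "a j N = a j (Suc N) mod int p ^ N" "b j N = b j (Suc N) mod int p ^ N"
    using assms(1,2) Zp_carrierD(3)[of _ p N] by (simp_all add: ps_carrier)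
  ultimately show "a j N = b j N" by simp
qed

text \<open>The congruence of \<open>dual_action_coefficient_approx\<close> no longer mentions A, so
  it holds for all M and N at once. As the ideals intersect in zero, it is an equality.\<close>

lemma dual_action_coefficient:
  fixes e :: "'a ring \<Rightarrow> 'a \<Rightarrow> (nat \<Rightarrow> 'a) \<Rightarrow> nat \<Rightarrow> 'a"
  assumes "infinite (UNIV :: 'a set)" "cartier_duality p F e" "normalized_coordinate p e"
    "n \<in> carrier (Zp p)" "cyclo_unit p n u" "dual_action p e n u \<psi>" "k > 0"
  shows "(q_pow p n \<ominus>\<^bsub>OQ p\<^esub> \<one>\<^bsub>OQ p\<^esub>) \<otimes>\<^bsub>OQ p\<^esub> \<psi> k = ps_monom (Zp p) (zp_binom p n k) k"
proof (rule J_Inter_zero)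
  have "\<And>i. \<psi> i \<in> carrier (OQ p)"
    using assms(6) by (simp only: dual_action_def ps_carrier[of \<psi>])
  then show "(q_pow p n \<ominus>\<^bsub>OQ p\<^esub> \<one>\<^bsub>OQ p\<^esub>) \<otimes>\<^bsub>OQ p\<^esub> \<psi> k \<in> carrier (OQ p)"
    using q_pow_closed[OF assms(4)] by simp
  show "ps_monom (Zp p) (zp_binom p n k) k \<in> carrier (OQ p)"
    using zp_binom_closed[OF assms(4)] by simp
  fix M N :: nat
  assume MN: "M \<ge> 1" "N \<ge> 1"
  obtain A :: "'a ring" and h where "cring A" "h \<in> ring_hom (OQ p) A"
    "h ` carrier (OQ p) = carrier A"
    "\<And>a b. a \<in> carrier (OQ p) \<Longrightarrow> b \<in> carrier (OQ p) \<Longrightarrow> h a = h b \<longleftrightarrow> a \<ominus>\<^bsub>OQ p\<^esub> b \<in> J M N"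
    using finite_quotient[OF assms(1), of M N] by blast
  then interpret quotient_base p A h M N
    using MN by (intro quotient_base.intro prime_base_axioms quotient_base_axioms.intro) auto
  show "(q_pow p n \<ominus>\<^bsub>OQ p\<^esub> \<one>\<^bsub>OQ p\<^esub>) \<otimes>\<^bsub>OQ p\<^esub> \<psi> k \<ominus>\<^bsub>OQ p\<^esub> ps_monom (Zp p) (zp_binom p n k) k \<in> J M N"
    using assms(2-7) by (rule dual_action_coefficient_approx)
qed

context
  fixes n
  assumes n: "n \<in> Units (Zp p)"
begin

lemma n_closed: "n \<in> carrier (Zp p)"
  using n by (rule Z.Units_closed)

lemma h_series_coeff_closed: "h_series p n i \<in> carrier (OQ p)"
  using zp_binom_closed[OF n_closed] by (simp add: h_series_def)

lemma var_mult_h_series: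
  "q_minus_1 p \<otimes>\<^bsub>OQ p\<^esub> h_series p n i =
    (if i = 0 then \<zero>\<^bsub>OQ p\<^esub> else ps_monom (Zp p) (zp_binom p n i) i)"
proof (cases i)
  case 0
  then show ?thesis by (simp add: h_series_def)
next
  case (Suc j)
  have b: "zp_binom p n i \<in> carrier (Zp p)" by (rule zp_binom_closed[OF n_closed])
  show ?thesis
  proof
    fix k
    have "(q_minus_1 p \<otimes>\<^bsub>OQ p\<^esub> ps_monom (Zp p) (zp_binom p n i) j) k = ps_monom (Zp p) (zp_binom p n i) i k"
      unfolding Z.ps_monom_mult[OF Z.one_closed Z.ps_monom_closed[OF b]]
      using b Suc by (auto simp: ps_monom_def)
    then show "(q_minus_1 p \<otimes>\<^bsub>OQ p\<^esub> h_series p n i) k =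
        (if i = 0 then \<zero>\<^bsub>OQ p\<^esub> else ps_monom (Zp p) (zp_binom p n i) i) k"
      using Suc by (simp add: h_series_def)
  qed
qed

lemma value_at_1_h_series: "value_at_1 p (h_series p n) = (\<lambda>j. zp_binom p n (Suc j))"
proof
  fix j
  have b: "zp_binom p n (Suc j) \<in> carrier (Zp p)" by (rule zp_binom_closed[OF n_closed])
  have coeff: "h_series p n i j = (if i = Suc j then zp_binom p n (Suc j) else \<zero>\<^bsub>Zp p\<^esub>)" for i
    by (cases i) (auto simp: h_series_def ps_monom_def ps_zero)
  show "value_at_1 p (h_series p n) j = zp_binom p n (Suc j)"
  \<comment> \<open>Only z^(j + 1) carries (q - 1)^j. The sum runs over nonzero terms, so its index
    set is empty when this binomial vanishes and a singleton otherwise.\<close>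
  proof (cases "zp_binom p n (Suc j) = \<zero>\<^bsub>Zp p\<^esub>")
    case True
    then have "{i. h_series p n i j \<noteq> \<zero>\<^bsub>Zp p\<^esub>} = {}" by (simp add: coeff)
    then show ?thesis unfolding value_at_1_def by (simp add: True)
  next
    case False
    then have "{i. h_series p n i j \<noteq> \<zero>\<^bsub>Zp p\<^esub>} = {Suc j}" by (auto simp: coeff)
    then show ?thesis unfolding value_at_1_def using b by (simp add: coeff)
  qed
qed

lemma value_at_1_h_series_closed: "value_at_1 p (h_series p n) \<in> carrier (OQ p)"
  using zp_binom_closed[OF n_closed] by (simp add: value_at_1_h_series ps_carrier)

text \<open>The constant term is the binomial coefficient of n with lower index 1, that is n itself,
  a p-adic unit by assumption.\<close>

lemma value_at_1_h_series_Units: "value_at_1 p (h_series p n) \<in> Units (OQ p)"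
  using zp_binom_0_1(2)[OF p n_closed] n
  by (intro Z.ps_UnitsI value_at_1_h_series_closed) (simp add: value_at_1_h_series)

lemma var_mult_value_at_1:
  "q_minus_1 p \<otimes>\<^bsub>OQ p\<^esub> value_at_1 p (h_series p n) = q_pow p n \<ominus>\<^bsub>OQ p\<^esub> \<one>\<^bsub>OQ p\<^esub>"
proof
  fix k
  have b: "zp_binom p n k \<in> carrier (Zp p)" by (rule zp_binom_closed[OF n_closed])
  show "(q_minus_1 p \<otimes>\<^bsub>OQ p\<^esub> value_at_1 p (h_series p n)) k = (q_pow p n \<ominus>\<^bsub>OQ p\<^esub> \<one>\<^bsub>OQ p\<^esub>) k"
    unfolding Z.ps_monom_mult[OF Z.one_closed value_at_1_h_series_closed]
      Z.ps_minus[OF q_pow_closed[OF n_closed] O.one_closed]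
    using b zp_binom_0_1(1)[OF p n_closed]
    by (cases k) (simp_all add: value_at_1_h_series q_pow_def ps_one a_minus_def Z.r_neg)
qed

lemma h_series_eq_one_plus_pow:
  "ps_smult (OQ p) (q_minus_1 p) (h_series p n) =
     one_plus_pow p n (ps_smult (OQ p) (q_minus_1 p) (ps_var (OQ p))) \<ominus>\<^bsub>ps (OQ p)\<^esub> \<one>\<^bsub>ps (OQ p)\<^esub>"
proof
  fix k
  let ?X = "q_minus_1 p"
  let ?b = "\<lambda>i. ps_const (Zp p) (zp_binom p n i)"
  have b: "?b i \<in> carrier (OQ p)" for i by (simp add: zp_binom_closed[OF n_closed])
  have X: "?X \<in> carrier (OQ p)" by simp
  have pow: "ps_monom (OQ p) ?X 1 [^]\<^bsub>ps (OQ p)\<^esub> i = ps_monom (OQ p) (ps_monom (Zp p) \<one>\<^bsub>Zp p\<^esub> i) i" for i :: nat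
    using O.ps_monom_power[OF X, of i] Z.ps_monom_power[OF Z.one_closed, of i] by simp
  have coeff: "one_plus_pow p n (ps_smult (OQ p) ?X (ps_var (OQ p))) k =
      ps_monom (Zp p) (zp_binom p n k) k" for k
  proof -
    have "one_plus_pow p n (ps_smult (OQ p) ?X (ps_var (OQ p))) k =
        (\<Oplus>\<^bsub>OQ p\<^esub>i\<in>{..k}. ?b i \<otimes>\<^bsub>OQ p\<^esub> ps_monom (OQ p) (ps_monom (Zp p) \<one>\<^bsub>Zp p\<^esub> i) i k)"
      unfolding one_plus_pow_def ps_comp_def O.ps_smult_var[OF X] pow ..
    \<comment> \<open>The substituted series is the monomial (q - 1) z, so its i-th power meets z^k
      only for i = k.\<close>
    also have "\<dots> = ?b k \<otimes>\<^bsub>OQ p\<^esub> ps_monom (OQ p) (ps_monom (Zp p) \<one>\<^bsub>Zp p\<^esub> k) k k"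
      using b by (intro O.finsum_single) (simp_all add: ps_monom_def[of "OQ p"])
    also have "\<dots> = ?b k \<otimes>\<^bsub>OQ p\<^esub> ps_monom (Zp p) \<one>\<^bsub>Zp p\<^esub> k"
      by (simp add: ps_monom_def[of "OQ p"])
    also have "\<dots> = ps_smult (Zp p) (zp_binom p n k) (ps_monom (Zp p) \<one>\<^bsub>Zp p\<^esub> k)"
      using zp_binom_closed[OF n_closed] by (intro Z.ps_const_mult) simp_all
    also have "\<dots> = ps_monom (Zp p) (zp_binom p n k) k"
      using zp_binom_closed[OF n_closed] by (auto simp: ps_smult_def ps_monom_def fun_eq_iff)
    finally show ?thesis .
  qed
  have closed: "one_plus_pow p n (ps_smult (OQ p) ?X (ps_var (OQ p))) \<in> carrier (ps (OQ p))"
    unfolding ps_carrier[of _ "OQ p"] coeff using zp_binom_closed[OF n_closed] by simp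
  interpret P: cring "ps (OQ p)" by (rule O.ps_cring)
  have zero: "ps_monom (Zp p) (zp_binom p n 0) 0 = \<one>\<^bsub>OQ p\<^esub>"
    using zp_binom_0_1(1)[OF p n_closed] by (simp add: ps_monom_def ps_one fun_eq_iff)
  have "ps_smult (OQ p) ?X (h_series p n) k = ?X \<otimes>\<^bsub>OQ p\<^esub> h_series p n k"
    by (simp add: ps_smult_def)
  also have "\<dots> = ps_monom (Zp p) (zp_binom p n k) k \<ominus>\<^bsub>OQ p\<^esub> (if k = 0 then \<one>\<^bsub>OQ p\<^esub> else \<zero>\<^bsub>OQ p\<^esub>)"
    unfolding var_mult_h_series using zp_binom_closed[OF n_closed]
    by (simp add: zero a_minus_def O.r_neg)
  finally show "ps_smult (OQ p) ?X (h_series p n) k =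
      (one_plus_pow p n (ps_smult (OQ p) ?X (ps_var (OQ p))) \<ominus>\<^bsub>ps (OQ p)\<^esub> \<one>\<^bsub>ps (OQ p)\<^esub>) k"
    unfolding O.ps_minus[OF closed P.one_closed] coeff by (simp only: ps_one)
qed

text \<open>As q^n - 1 = (q - 1) h_n(1, q), the coefficient equation has the factor q - 1 on both
  sides. Multiplication by q - 1 only shifts coefficients, so it can be cancelled, and the remaining
  factor h_n(1, q) is a unit.\<close>

lemma dual_action_eq:
  fixes e :: "'a ring \<Rightarrow> 'a \<Rightarrow> (nat \<Rightarrow> 'a) \<Rightarrow> nat \<Rightarrow> 'a"
  assumes "infinite (UNIV :: 'a set)" "cartier_duality p F e" "normalized_coordinate p e"
    "cyclo_unit p n u" and act: "dual_action p e n u \<psi>"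
  shows "\<psi> = ps_smult (OQ p) (inv\<^bsub>OQ p\<^esub> (value_at_1 p (h_series p n))) (h_series p n)"
proof
  fix k
  let ?v = "value_at_1 p (h_series p n)"
  have psi: "\<psi> k \<in> carrier (OQ p)"
    using act by (simp only: dual_action_def ps_carrier[of \<psi>])
  note v = value_at_1_h_series_closed and X = Z.ps_monom_closed[OF Z.one_closed, of 1]
  have "?v \<otimes>\<^bsub>OQ p\<^esub> \<psi> k = h_series p n k"
  proof (rule Z.ps_var_mult_cancel)
    have "q_minus_1 p \<otimes>\<^bsub>OQ p\<^esub> (?v \<otimes>\<^bsub>OQ p\<^esub> \<psi> k) = (q_pow p n \<ominus>\<^bsub>OQ p\<^esub> \<one>\<^bsub>OQ p\<^esub>) \<otimes>\<^bsub>OQ p\<^esub> \<psi> k"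
      unfolding var_mult_value_at_1[symmetric] by (rule O.m_assoc[OF X v psi, symmetric])
    also have "\<dots> = q_minus_1 p \<otimes>\<^bsub>OQ p\<^esub> h_series p n k"
    proof (cases "k = 0")
      case True
      then have "\<psi> k = \<zero>\<^bsub>OQ p\<^esub>" using act by (simp add: dual_action_def)
      then show ?thesis
        using True q_pow_closed[OF n_closed] by (simp add: var_mult_h_series del: One_nat_def)
    next
      case False
      then show ?thesis
        using dual_action_coefficient[OF assms(1-3) n_closed assms(4,5)]
        by (simp add: var_mult_h_series del: One_nat_def)
    qed
    finally show "q_minus_1 p \<otimes>\<^bsub>OQ p\<^esub> (?v \<otimes>\<^bsub>OQ p\<^esub> \<psi> k) = q_minus_1 p \<otimes>\<^bsub>OQ p\<^esub> h_series p n k" .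
  qed (use v psi h_series_coeff_closed in simp_all)
  then have "inv\<^bsub>OQ p\<^esub> ?v \<otimes>\<^bsub>OQ p\<^esub> h_series p n k = inv\<^bsub>OQ p\<^esub> ?v \<otimes>\<^bsub>OQ p\<^esub> (?v \<otimes>\<^bsub>OQ p\<^esub> \<psi> k)"
    by simp
  also have "\<dots> = \<psi> k"
    using value_at_1_h_series_Units v psi by (simp flip: O.m_assoc)
  finally show "\<psi> k = ps_smult (OQ p) (inv\<^bsub>OQ p\<^esub> ?v) (h_series p n) k"
    by (simp add: ps_smult_def)
qed

end

end

theorem corollary2p11p4:
  fixes p :: nat
    and F :: "nat \<Rightarrow> nat \<Rightarrow> nat \<Rightarrow> nat \<Rightarrow> int"
    and e :: "'a ring \<Rightarrow> 'a \<Rightarrow> (nat \<Rightarrow> 'a) \<Rightarrow> nat \<Rightarrow> 'a"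
    and n :: "nat \<Rightarrow> int"
    and u \<psi> :: "nat \<Rightarrow> nat \<Rightarrow> nat \<Rightarrow> int"
  assumes "infinite (UNIV :: 'a set)"
    and "prime p"
    and "formal_group_law (OQ p) F"
    and "cartier_duality p F e"
    and "normalized_coordinate p e"
    and "n \<in> Units (Zp p)"
    and "cyclo_unit p n u"
    and "dual_action p e n u \<psi>"
  shows "ps_smult (OQ p) (q_minus_1 p) (h_series p n) =
           one_plus_pow p n (ps_smult (OQ p) (q_minus_1 p) (ps_var (OQ p)))
             \<ominus>\<^bsub>ps (OQ p)\<^esub> \<one>\<^bsub>ps (OQ p)\<^esub> \<and>
         q_minus_1 p \<otimes>\<^bsub>OQ p\<^esub> value_at_1 p (h_series p n) = q_pow p n \<ominus>\<^bsub>OQ p\<^esub> \<one>\<^bsub>OQ p\<^esub> \<and>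
         value_at_1 p (h_series p n) \<in> Units (OQ p) \<and>
         \<psi> = ps_smult (OQ p) (inv\<^bsub>OQ p\<^esub> (value_at_1 p (h_series p n))) (h_series p n)"
proof -
  interpret prime_base p
    using assms(2) by unfold_locales
  show ?thesis
    using h_series_eq_one_plus_pow[OF assms(6)] var_mult_value_at_1[OF assms(6)]
      value_at_1_h_series_Units[OF assms(6)] dual_action_eq[OF assms(6,1,4,5,7,8)]
    by blast
qed

end
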